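(* Let $\Theta\subset\mathbb R^p$ be compact with $\|\theta\|\le D_\Theta$ for all $\theta=(Q,K,V)\in\Theta$, let $\sigma:\mathbb R\to\mathbb R$ be $L_\sigma$-Lipschitz and let $W_1,W_2,b_1,b_2$ have norms bounded by $D_\Theta$. Fix $T>0$, $\rho\in\mathcal P(\Theta)$ and a compactly supported $\mu_0\in\mathcal P_2(\mathbb R^d)$. Then the equation $\partial_t\mu_t+\nabla_x\cdot\big(\mu_t(V_{\rho,\mu_t}+F)\big)=0$ with initial datum $\mu_0$ admits a unique weak solution $\mu\in C([0,T];\mathcal P_2(\mathbb R^d))$, in the sense that for every $\varphi\in C_c^\infty([0,T]\times\mathbb R^d)$, $$\int\varphi(T,x)\,d\mu_T(x)-\int\varphi(0,x)\,d\mu_0(x)=\int_0^T\!\!\int\Big(\partial_t\varphi+\nabla_x\varphi\cdot V_{\rho,\mu_t}(x)+\nabla_x\varphi\cdot F(x)\Big)d\mu_t(x)\,dt .$$ Moreover, if $\mu,\mu'$ are the solutions associated to initial data $\mu_0,\mu_0'$, both supported in $B_{R_0}$, with the same $\rho$, then $$\sup_{t\in[0,T]}\mathcal W_2(\mu_t,\mu_t')\le e^{CT}\,\mathcal W_2(\mu_0,\mu_0'),$$ where $C=C(D_\Theta,L_\sigma,R(T))$.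
   Context: $\mathcal P_2$: probability measures with finite second moment, with the $2$-Wasserstein distance $\mathcal W_2$; $B_R=\{|x|\le R\}$. A parameter $\theta=(Q,K,V)$ is a triple of matrices identified with a point of $\mathbb R^p$, with $Qx,Ky$ in a common Euclidean space and $V$ of size $d\times d$. For a probability measure $\mu$ on $\mathbb R^d$, $$K^\theta_\mu(x,y)=\frac{\exp(\frac1{\sqrt d}\langle Qx,Ky\rangle)}{\int\exp(\frac1{\sqrt d}\langle Qx,Ky'\rangle)\,d\mu(y')},\quad A(x,\mu,\theta)=\int K^\theta_\mu(x,y)\,Vy\,d\mu(y),\quad V_{\rho,\mu}(x)=\int_\Theta A(x,\mu,\theta)\,\rho(d\theta).$$ $F(x)=W_2\,\sigma(W_1x+b_1)+b_2$ with $\sigma$ applied entrywise. $R(T)$ is the a priori confinement radius: a radius (of the form $R_0e^{C_0T}+(e^{C_0T}-1)$) such that solutions with $\mathrm{Supp}(\mu_0)\subset B_{R_0}$ satisfy $\mathrm{Supp}(\mu_t)\subset B_{R(T)}$ for all $t\in[0,T]$. *)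

theory Defs
  imports "HOL-Probability.Probability"
begin

subsection \<open>Probability measures and the 2-Wasserstein distance\<close>

definition measure_support :: "'a::topological_space measure \<Rightarrow> 'a set" where
  "measure_support \<mu> = {x. \<forall>U. open U \<and> x \<in> U \<longrightarrow> emeasure \<mu> U > 0}"

definition P2 :: "'a::euclidean_space measure set" where
  "P2 = {\<mu>. prob_space \<mu> \<and> sets \<mu> = sets borel \<and> integrable \<mu> (\<lambda>x. (norm x)\<^sup>2)}"

definition couplings :: "'a::euclidean_space measure \<Rightarrow> 'a measure \<Rightarrow> ('a \<times> 'a) measure set" where
  "couplings \<mu> \<nu> = {\<gamma>. prob_space \<gamma> \<and> sets \<gamma> = sets (borel \<Otimes>\<^sub>M borel) \<and>
     distr \<gamma> borel fst = \<mu> \<and> distr \<gamma> borel snd = \<nu>}"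

text \<open>Used only on \<^const>\<open>P2\<close>, where the product measure is a coupling and the squared
  distance is integrable for every coupling, so that the infimum is a genuine one.\<close>

definition wasserstein2 :: "'a::euclidean_space measure \<Rightarrow> 'a measure \<Rightarrow> real" where
  "wasserstein2 \<mu> \<nu> =
     sqrt (INF \<gamma> \<in> couplings \<mu> \<nu>. integral\<^sup>L \<gamma> (\<lambda>(x, y). (dist x y)\<^sup>2))"

definition P2_continuous_curve :: "real \<Rightarrow> (real \<Rightarrow> 'a::euclidean_space measure) \<Rightarrow> bool" where
  "P2_continuous_curve T \<mu> \<longleftrightarrow> (\<forall>t\<in>{0..T}. \<mu> t \<in> P2 \<and>
     ((\<lambda>s. wasserstein2 (\<mu> s) (\<mu> t)) \<longlongrightarrow> 0) (at t within {0..T}))"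

text \<open>Members have space \<open>\<Theta>\<close>: they are measures on the subspace \<open>\<Theta>\<close> itself.\<close>

definition prob_measures_on :: "'a::topological_space set \<Rightarrow> 'a measure set" where
  "prob_measures_on \<Theta> = {\<rho>. prob_space \<rho> \<and> sets \<rho> = sets (restrict_space borel \<Theta>)}"

subsection \<open>Attention and perceptron vector fields\<close>

text \<open>A parameter \<open>(Q, K, V)\<close>. The product and vector norms of the library are Euclidean, so
  \<^const>\<open>norm\<close> is the Euclidean norm of the parameter as a point of \<open>\<real>\<^sup>p\<close>.\<close>

type_synonym ('d, 'k) param = "(real^'d^'k) \<times> (real^'d^'k) \<times> (real^'d^'d)"

definition attention_weight :: "('d::finite, 'k::finite) param \<Rightarrow> real^'d \<Rightarrow> real^'d \<Rightarrow> real" where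
  "attention_weight = (\<lambda>(Q, K, V) x y. exp (1 / sqrt (real CARD('d)) * ((Q *v x) \<bullet> (K *v y))))"

definition value_matrix :: "('d::finite, 'k::finite) param \<Rightarrow> real^'d^'d" where
  "value_matrix = (\<lambda>(Q, K, V). V)"

definition attention_kernel ::
    "('d::finite, 'k::finite) param \<Rightarrow> (real^'d) measure \<Rightarrow> real^'d \<Rightarrow> real^'d \<Rightarrow> real" where
  "attention_kernel \<theta> \<mu> x y =
     attention_weight \<theta> x y / (\<integral>y'. attention_weight \<theta> x y' \<partial>\<mu>)"

definition attention ::
    "real^'d \<Rightarrow> (real^'d) measure \<Rightarrow> ('d::finite, 'k::finite) param \<Rightarrow> real^'d" where
  "attention x \<mu> \<theta> = (\<integral>y. attention_kernel \<theta> \<mu> x y *\<^sub>R (value_matrix \<theta> *v y) \<partial>\<mu>)"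

definition attention_field ::
    "('d::finite, 'k::finite) param measure \<Rightarrow> (real^'d) measure \<Rightarrow> real^'d \<Rightarrow> real^'d" where
  "attention_field \<rho> \<mu> x = (\<integral>\<theta>. attention x \<mu> \<theta> \<partial>\<rho>)"

text \<open>For heavy-tailed \<open>\<mu>\<close> with finite second moment the exponential integrals diverge, and
  Bochner integrals then take the value 0. This predicate says that all the integrals that define
  the attention field converge.\<close>

definition attention_field_defined ::
    "('d::finite, 'k::finite) param measure \<Rightarrow> (real^'d) measure \<Rightarrow> bool" where
  "attention_field_defined \<rho> \<mu> \<longleftrightarrow> (\<forall>x.
     (\<forall>\<theta>\<in>space \<rho>. integrable \<mu> (attention_weight \<theta> x) \<and>
        integrable \<mu> (\<lambda>y. attention_kernel \<theta> \<mu> x y *\<^sub>R (value_matrix \<theta> *v y))) \<and>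
     integrable \<rho> (attention x \<mu>))"

definition perceptron :: "(real \<Rightarrow> real) \<Rightarrow> real^'d^'m \<Rightarrow> real^'m^'d \<Rightarrow> real^'m \<Rightarrow> real^'d \<Rightarrow>
    real^'d \<Rightarrow> real^'d::finite" where
  "perceptron \<sigma> W\<^sub>1 W\<^sub>2 b\<^sub>1 b\<^sub>2 x = W\<^sub>2 *v (\<chi> i. \<sigma> ((W\<^sub>1 *v x + b\<^sub>1) $ i)) + b\<^sub>2"

subsection \<open>Test functions and weak solutions\<close>

fun C_diff :: "nat \<Rightarrow> ('a::euclidean_space \<Rightarrow> real) \<Rightarrow> bool" where
  "C_diff 0 f \<longleftrightarrow> continuous_on UNIV f"
| "C_diff (Suc n) f \<longleftrightarrow>
     f differentiable_on UNIV \<and> (\<forall>v. C_diff n (\<lambda>x. frechet_derivative f (at x) v))"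

text \<open>Smooth compactly supported functions on the slab \<open>[0,T] \<times> \<real>\<^sup>d\<close> are represented by their
  smooth compactly supported extensions to \<open>\<real> \<times> \<real>\<^sup>d\<close>; no vanishing at the times 0 and \<open>T\<close> is
  imposed.\<close>

definition test_functions :: "(real \<times> (real^'d::finite) \<Rightarrow> real) set" where
  "test_functions = {\<phi>. (\<forall>n. C_diff n \<phi>) \<and> compact (closure {z. \<phi> z \<noteq> 0})}"

definition time_derivative :: "(real \<times> (real^'d::finite) \<Rightarrow> real) \<Rightarrow> real \<Rightarrow> real^'d \<Rightarrow> real" where
  "time_derivative \<phi> t x = frechet_derivative \<phi> (at (t, x)) (1, 0)"

definition space_gradient :: "(real \<times> (real^'d::finite) \<Rightarrow> real) \<Rightarrow> real \<Rightarrow> real^'d \<Rightarrow> real^'d" where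
  "space_gradient \<phi> t x = (\<chi> i. frechet_derivative \<phi> (at (t, x)) (0, axis i 1))"

definition transport_integrand ::
    "('d::finite, 'k::finite) param measure \<Rightarrow> (real^'d \<Rightarrow> real^'d) \<Rightarrow> (real \<Rightarrow> (real^'d) measure) \<Rightarrow>
     (real \<times> (real^'d) \<Rightarrow> real) \<Rightarrow> real \<Rightarrow> real^'d \<Rightarrow> real" where
  "transport_integrand \<rho> F \<mu> \<phi> t x = time_derivative \<phi> t x
     + space_gradient \<phi> t x \<bullet> attention_field \<rho> (\<mu> t) x + space_gradient \<phi> t x \<bullet> F x"

text \<open>The second and third conjuncts give the equation a meaning for curves in \<^const>\<open>P2\<close> that
  are not assumed compactly supported: the attention field exists and is locally bounded on
  \<open>[0,T] \<times> \<real>\<^sup>d\<close>. Curves with uniformly compact support satisfy both automatically.\<close>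

definition weak_solution ::
    "real \<Rightarrow> ('d::finite, 'k::finite) param measure \<Rightarrow> (real^'d \<Rightarrow> real^'d) \<Rightarrow> (real^'d) measure \<Rightarrow>
     (real \<Rightarrow> (real^'d) measure) \<Rightarrow> bool" where
  "weak_solution T \<rho> F \<mu>\<^sub>0 \<mu> \<longleftrightarrow>
     P2_continuous_curve T \<mu> \<and>
     (\<forall>t\<in>{0..T}. attention_field_defined \<rho> (\<mu> t)) \<and>
     (\<forall>r. bounded ((\<lambda>(t, x). attention_field \<rho> (\<mu> t) x) ` ({0..T} \<times> cball 0 r))) \<and>
     \<mu> 0 = \<mu>\<^sub>0 \<and>
     (\<forall>\<phi>\<in>test_functions.
        (\<forall>t\<in>{0..T}. integrable (\<mu> t) (transport_integrand \<rho> F \<mu> \<phi> t)) \<and>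
        set_integrable lborel {0..T} (\<lambda>t. \<integral>x. transport_integrand \<rho> F \<mu> \<phi> t x \<partial>\<mu> t) \<and>
        (\<integral>x. \<phi> (T, x) \<partial>\<mu> T) - (\<integral>x. \<phi> (0, x) \<partial>\<mu>\<^sub>0)
          = (LINT t:{0..T}|lborel. (\<integral>x. transport_integrand \<rho> F \<mu> \<phi> t x \<partial>\<mu> t)))"

definition confinement_radius ::
    "real \<Rightarrow> ('d::finite, 'k::finite) param measure \<Rightarrow> (real^'d \<Rightarrow> real^'d) \<Rightarrow> real \<Rightarrow> real \<Rightarrow> bool" where
  "confinement_radius T \<rho> F R\<^sub>0 R \<longleftrightarrow>
     (\<forall>\<mu>\<^sub>0\<in>P2. \<forall>\<mu>. measure_support \<mu>\<^sub>0 \<subseteq> cball 0 R\<^sub>0 \<and> weak_solution T \<rho> F \<mu>\<^sub>0 \<mu> \<longrightarrow>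
        (\<forall>t\<in>{0..T}. measure_support (\<mu> t) \<subseteq> cball 0 R))"

end

theory Submission
  imports Defs
begin

text \<open>
  If a smooth function increases along the velocity field, its integral against a weak solution
  increases in time. Radial barriers of this kind confine the supports: on a short time step because the
  field is locally bounded, and then, once the supports are bounded, at the rate given by the linear
  growth of the velocity. On compactly supported measures the velocity is Lipschitz in space and in the
  measure. Barriers built from finite unions of balls that follow trajectories \<open>X\<close> and expand at the
  Lipschitz rate show that \<open>\<mu>\<^sub>t\<close> gives every neighbourhood of \<open>X\<^sub>t(K)\<close> at least the mass
  \<open>\<mu>\<^sub>0(K)\<close>, for compact \<open>K\<close>. Hence \<open>\<mu>\<^sub>t\<close> is the push-forward of \<open>\<mu>\<^sub>0\<close> by the flow, and no
  regularisation of the velocity is needed. Stability and uniqueness follow by pushing couplings along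
  two flows and Gronwall's inequality; existence is Picard's theorem for the displacement field.
\<close>

section \<open>Smooth functions\<close>

text \<open>Two features shape the argument. Competing solutions are arbitrary curves in
  \<open>P2\<close>, so their supports have to be confined before any estimate whose constant
  depends on a radius applies; the only information available at that stage is the local boundedness
  of the attention field contained in \<open>weak_solution\<close>. Secondly, the velocity is merely
  Lipschitz in space and continuous in time, so a test function composed with the flow or its
  inverse is in general no longer smooth. The usual duality proof solves a backward transport
  equation and regularises; one-sided barriers need only a sign of the derivative, not an exact
  solution. The stability rate is twice the Lipschitz constant of the velocity on the ball of radius
  \<open>R\<close>: once for the dependence on the position and once for the dependence on the
  measure. The size of the field at the origin, \<open>norm (F 0)\<close>, enters the rate of growth
  of the support and not the Lipschitz constant.\<close>

definition smooth :: "('a::euclidean_space \<Rightarrow> real) \<Rightarrow> bool" where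
  "smooth f \<longleftrightarrow> (\<forall>n. C_diff n f)"

lemma C_diff_continuous: "C_diff n f \<Longrightarrow> continuous_on UNIV f"
  by (cases n) (auto intro: differentiable_imp_continuous_on)

lemma C_diff_SucD: "C_diff (Suc n) f \<Longrightarrow> C_diff n f"
proof (induction n arbitrary: f)
  case 0
  then show ?case using C_diff_continuous[of "Suc 0" f] by simp
next
  case (Suc n)
  then show ?case by simp
qed

text \<open>\<open>C_diff\<close> recurses through \<open>frechet_derivative\<close>; uniqueness of
  the derivative lets an explicit formula take its place, and the closure inductions below rely on
  this form.\<close>

lemma C_diff_SucI:
  assumes "\<And>x. (f has_derivative f' x) (at x)" "\<And>v. C_diff n (\<lambda>x. f' x v)"
  shows "C_diff (Suc n) f"
proof -
  have "frechet_derivative f (at x) = f' x" for x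
    using assms(1) by (metis frechet_derivative_at)
  then show ?thesis
    using assms by (auto simp: differentiable_on_def differentiable_def intro: has_derivative_at_withinI)
qed

lemma C_diff_Suc_has_derivative:
  assumes "C_diff (Suc n) f"
  shows "(f has_derivative frechet_derivative f (at x)) (at x)"
  using assms by (simp add: differentiable_on_def frechet_derivative_works)

lemma C_diff_const: "C_diff n (\<lambda>x. c)"
proof (induction n arbitrary: c)
  case (Suc n)
  show ?case
    by (rule C_diff_SucI[where f' = "\<lambda>x v. 0"]) (auto intro: Suc)
qed simp

lemma C_diff_add: "C_diff n f \<Longrightarrow> C_diff n g \<Longrightarrow> C_diff n (\<lambda>x. f x + g x)"
proof (induction n arbitrary: f g)
  case (Suc n)
  show ?case
    by (rule C_diff_SucI[OF has_derivative_add[OF C_diff_Suc_has_derivative[OF Suc.prems(1)]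
            C_diff_Suc_has_derivative[OF Suc.prems(2)]]])
      (use Suc in simp)
qed (auto intro: continuous_intros)

lemma C_diff_mult: "C_diff n f \<Longrightarrow> C_diff n g \<Longrightarrow> C_diff n (\<lambda>x. f x * g x)"
proof (induction n arbitrary: f g)
  case (Suc n)
  show ?case
    by (rule C_diff_SucI[OF has_derivative_mult[OF C_diff_Suc_has_derivative[OF Suc.prems(1)]
            C_diff_Suc_has_derivative[OF Suc.prems(2)]]])
      (use Suc C_diff_SucD[OF Suc.prems(1)] C_diff_SucD[OF Suc.prems(2)] in
        \<open>auto intro!: C_diff_add\<close>)
qed (auto intro: continuous_intros)

lemma C_diff_bounded_linear:
  assumes "bounded_linear f"
  shows "C_diff n f"
proof (cases n)
  case 0
  then show ?thesis using assms by (simp add: linear_continuous_on)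
next
  case (Suc m)
  then show ?thesis
    using C_diff_SucI[of f "\<lambda>_. f" m, OF bounded_linear_imp_has_derivative[OF assms] C_diff_const]
    by (simp only:)
qed

text \<open>The derivative is \<open>g'\<close> composed with \<open>f\<close>, times a directional
  derivative of \<open>f\<close>. The induction therefore generalises over \<open>g\<close>: its
  hypothesis is applied to \<open>g'\<close>.\<close>

lemma C_diff_compose:
  fixes g :: "real \<Rightarrow> real"
  shows "C_diff n g \<Longrightarrow> C_diff n f \<Longrightarrow> C_diff n (\<lambda>x. g (f x))"
proof (induction n arbitrary: f g)
  case 0
  then show ?case by (simp add: continuous_on_compose2)
next
  case (Suc n)
  have lin: "frechet_derivative g (at y) v = frechet_derivative g (at y) 1 * v" for y v
  proof -
    have "linear (frechet_derivative g (at y))"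
      using C_diff_Suc_has_derivative[OF Suc.prems(1)] has_derivative_linear by blast
    from linear_scale[OF this, of v 1] show ?thesis by simp
  qed
  have "((\<lambda>x. g (f x)) has_derivative
      (\<lambda>v. frechet_derivative g (at (f x)) 1 * frechet_derivative f (at x) v)) (at x)" for x
    by (rule has_derivative_eq_rhs[OF has_derivative_compose[OF C_diff_Suc_has_derivative[OF Suc.prems(2)]
        C_diff_Suc_has_derivative[OF Suc.prems(1)]]]) (rule ext, rule lin)
  then show ?case
  proof (rule C_diff_SucI)
    show "C_diff n (\<lambda>x. frechet_derivative g (at (f x)) 1 * frechet_derivative f (at x) v)" for v
      by (rule C_diff_mult, rule Suc.IH) (use Suc.prems C_diff_SucD[OF Suc.prems(2)] in auto)
  qed
qed

lemma C_diff_real_SucI: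
  fixes g :: "real \<Rightarrow> real"
  assumes "\<And>x. (g has_real_derivative g' x) (at x)" "C_diff n g'"
  shows "C_diff (Suc n) g"
  by (rule C_diff_SucI[where f' = "\<lambda>x v. g' x * v"])
    (use assms in \<open>auto simp: has_field_derivative_def intro: C_diff_mult C_diff_const\<close>)

lemma C_diff_exp: "C_diff n (exp :: real \<Rightarrow> real)"
proof (induction n)
  case (Suc n)
  then show ?case by (intro C_diff_real_SucI[of exp exp]) (auto intro: DERIV_exp)
qed (auto intro: continuous_intros)

text \<open>Not a case of \<open>C_diff_compose\<close>, since \<open>inverse\<close> is not smooth
  on the whole line. The derivative of \<open>1 / f\<close> is \<open>- f' / f^2\<close> and again
  contains \<open>inverse (f x)\<close>, which is covered by the induction hypothesis at the lower
  order.\<close>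

lemma C_diff_inverse: "C_diff n f \<Longrightarrow> (\<And>x. f x \<noteq> 0) \<Longrightarrow> C_diff n (\<lambda>x. inverse (f x))"
proof (induction n)
  case 0
  then show ?case by (auto intro: continuous_intros)
next
  case (Suc n)
  let ?f' = "\<lambda>x. frechet_derivative f (at x)"
  have inv: "C_diff n (\<lambda>x. inverse (f x))"
    using Suc C_diff_SucD by blast
  have "((\<lambda>x. inverse (f x)) has_derivative (\<lambda>v. (- 1) * (inverse (f x) * ?f' x v * inverse (f x)))) (at x)" for x
    using Deriv.has_derivative_inverse[OF Suc.prems(2) C_diff_Suc_has_derivative[OF Suc.prems(1)]] by simp
  then show ?case
    by (rule C_diff_SucI, intro C_diff_mult C_diff_const inv)
      (use Suc.prems in \<open>auto simp del: mult_minus1 mult_minus1_right mult_minus_left\<close>)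
qed

lemma smooth_const [simp]: "smooth (\<lambda>x. c)"
  and smooth_add: "smooth f \<Longrightarrow> smooth g \<Longrightarrow> smooth (\<lambda>x. f x + g x)"
  and smooth_mult: "smooth f \<Longrightarrow> smooth g \<Longrightarrow> smooth (\<lambda>x. f x * g x)"
  and smooth_inverse: "smooth f \<Longrightarrow> (\<And>x. f x \<noteq> 0) \<Longrightarrow> smooth (\<lambda>x. inverse (f x))"
  and smooth_bounded_linear: "bounded_linear f \<Longrightarrow> smooth f"
  by (simp_all add: smooth_def C_diff_const C_diff_add C_diff_mult C_diff_inverse C_diff_bounded_linear)

lemma smooth_compose:
  fixes g :: "real \<Rightarrow> real"
  shows "smooth g \<Longrightarrow> smooth f \<Longrightarrow> smooth (\<lambda>x. g (f x))"
  by (simp add: smooth_def C_diff_compose)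

lemma smooth_exp: "smooth f \<Longrightarrow> smooth (\<lambda>x. exp (f x))"
  using smooth_compose[of exp f] C_diff_exp by (auto simp: smooth_def)

lemma smooth_minus: "smooth f \<Longrightarrow> smooth (\<lambda>x. - f x)"
  using smooth_mult[of "\<lambda>x. - 1" f] by simp

lemma smooth_diff: "smooth f \<Longrightarrow> smooth g \<Longrightarrow> smooth (\<lambda>x. f x - g x)"
  using smooth_add[of f "\<lambda>x. - g x"] smooth_minus[of g] by simp

lemma smooth_divide_const: "smooth f \<Longrightarrow> smooth (\<lambda>x. f x / c)"
  using smooth_mult[of f "\<lambda>x. inverse c"] by (simp add: field_simps)

lemma smooth_power: "smooth f \<Longrightarrow> smooth (\<lambda>x. f x ^ n)"
  by (induction n) (auto intro: smooth_mult)

lemma smooth_sum: "(\<And>i. i \<in> I \<Longrightarrow> smooth (f i)) \<Longrightarrow> smooth (\<lambda>x. \<Sum>i\<in>I. f i x)"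
  by (induction I rule: infinite_finite_induct) (auto intro: smooth_add)

lemma smooth_has_derivative:
  "smooth f \<Longrightarrow> (f has_derivative frechet_derivative f (at x)) (at x)"
  using C_diff_Suc_has_derivative[of 0 f] unfolding smooth_def by blast

lemma smooth_continuous_on: "smooth f \<Longrightarrow> continuous_on A f"
  using C_diff_continuous[of 0 f] continuous_on_subset[of UNIV f A] unfolding smooth_def by blast

lemma smooth_frechet: "smooth f \<Longrightarrow> smooth (\<lambda>x. frechet_derivative f (at x) v)"
  unfolding smooth_def by (metis C_diff.simps(2))

section \<open>Flat exponentials and a smooth step function\<close>

text \<open>The functions \<open>p (1 / x) exp (- 1 / x)\<close>, extended by 0, are closed under differentiation.\<close>

definition exp_flat :: "real poly \<Rightarrow> real \<Rightarrow> real" where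
  "exp_flat p x = (if x > 0 then poly p (inverse x) * exp (- inverse x) else 0)"

lemma poly_exp_minus_tendsto_0: "((\<lambda>x::real. poly p x * exp (- x)) \<longlongrightarrow> 0) at_top"
proof -
  have "((\<lambda>x::real. \<Sum>i\<le>degree p. coeff p i * (x ^ i / exp x)) \<longlongrightarrow> (\<Sum>i\<le>degree p. coeff p i * 0)) at_top"
    by (intro tendsto_sum tendsto_mult tendsto_const tendsto_power_div_exp_0)
  then show ?thesis
    by (simp add: poly_altdef exp_minus divide_inverse sum_distrib_right mult.assoc)
qed

text \<open>With \<open>y = 1 / x\<close>, the derivative of \<open>p y * exp (- y)\<close> in
  \<open>x\<close> is \<open>y^2 * (p y - p' y) * exp (- y)\<close>, and \<open>[:0, 0, 1:]\<close>
  is the polynomial \<open>y^2\<close>. At 0 the right difference quotient is again of this shape,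
  with \<open>[:0, 1:] * p\<close>, and tends to 0.\<close>

lemma exp_flat_DERIV:
  "(exp_flat p has_real_derivative exp_flat ([:0, 0, 1:] * (p - pderiv p)) x) (at x)"
proof -
  consider "x > 0" | "x < 0" | "x = 0" by linarith
  then show ?thesis
  proof cases
    case 1
    then have x: "x \<noteq> 0" by simp
    have "((\<lambda>x. poly p (inverse x) * exp (- inverse x)) has_real_derivative
        exp_flat ([:0, 0, 1:] * (p - pderiv p)) x) (at x)"
      by (rule DERIV_cong[OF DERIV_mult[OF DERIV_chain'[OF DERIV_inverse[OF x] poly_DERIV]
          DERIV_chain'[OF DERIV_minus[OF DERIV_inverse[OF x]] DERIV_exp]]])
        (use 1 in \<open>simp add: exp_flat_def algebra_simps\<close>)
    then show ?thesis
      by (rule has_field_derivative_transform_within_open[OF _ open_greaterThan[of 0]])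
        (use 1 in \<open>simp_all add: exp_flat_def\<close>)
  next
    case 2
    have "((\<lambda>x. 0) has_real_derivative exp_flat ([:0, 0, 1:] * (p - pderiv p)) x) (at x)"
      using 2 by (auto simp: exp_flat_def)
    then show ?thesis
      by (rule has_field_derivative_transform_within_open[OF _ open_lessThan[of 0]])
        (use 2 in \<open>auto simp: exp_flat_def\<close>)
  next
    case 3
    have "((\<lambda>y. exp_flat p y / y) \<longlongrightarrow> 0) (at_left 0)"
      by (rule tendsto_eventually) (auto simp: exp_flat_def eventually_at_filter)
    moreover have "((\<lambda>y. exp_flat p y / y) \<longlongrightarrow> 0) (at_right 0)"
    proof (rule Lim_transform_eventually)
      show "((\<lambda>y::real. poly ([:0,1:] * p) (inverse y) * exp (- inverse y)) \<longlongrightarrow> 0) (at_right 0)"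
        by (rule filterlim_compose[OF poly_exp_minus_tendsto_0 filterlim_inverse_at_top_right])
      show "\<forall>\<^sub>F y in at_right 0. poly ([:0,1:] * p) (inverse y) * exp (- inverse y) = exp_flat p y / y"
        by (auto simp: exp_flat_def eventually_at_filter field_simps)
    qed
    ultimately have "((\<lambda>y. exp_flat p y / y) \<longlongrightarrow> 0) (at 0)"
      by (rule filterlim_split_at)
    then show ?thesis
      using 3 by (simp add: has_field_derivative_iff exp_flat_def)
  qed
qed

lemma smooth_exp_flat: "smooth (exp_flat p)"
proof -
  have "C_diff n (exp_flat p)" for n
  proof (induction n arbitrary: p)
    case 0
    show ?case
      using DERIV_isCont[OF exp_flat_DERIV] by (simp add: continuous_at_imp_continuous_on)
  next
    case (Suc n)
    show ?case by (rule C_diff_real_SucI[OF exp_flat_DERIV Suc])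
  qed
  then show ?thesis by (simp add: smooth_def)
qed

text \<open>The function is \<open>h x / (h x + h (1 - x))\<close> with
  \<open>h x = exp (- 1 / x)\<close> for positive \<open>x\<close> and 0 otherwise; the denominator
  is positive because \<open>x\<close> or \<open>1 - x\<close> is. \<open>S'\<close> is returned
  along with \<open>S\<close>, since the barriers use its sign and its vanishing off the unit
  interval.\<close>

lemma smooth_step_exists:
  obtains S S' :: "real \<Rightarrow> real" where "smooth S" "\<And>x. (S has_real_derivative S' x) (at x)"
    "\<And>x. S' x \<ge> 0" "\<And>x. x \<le> 0 \<Longrightarrow> S x = 0" "\<And>x. x \<ge> 1 \<Longrightarrow> S x = 1"
    "\<And>x. x \<le> 0 \<Longrightarrow> S' x = 0" "\<And>x. x \<ge> 1 \<Longrightarrow> S' x = 0" "\<And>x. 0 \<le> S x" "\<And>x. S x \<le> 1"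
proof -
  define h h' where "h = exp_flat 1" and "h' = exp_flat [:0, 0, 1:]"
  have h_DERIV: "(h has_real_derivative h' x) (at x)" for x
    using exp_flat_DERIV[of 1 x] by (simp add: h_def h'_def pderiv_1)
  have nonneg: "h x \<ge> 0" "h' x \<ge> 0" for x by (auto simp: h_def h'_def exp_flat_def)
  have zero: "h x = 0" "h' x = 0" if "x \<le> 0" for x using that by (auto simp: h_def h'_def exp_flat_def)
  have "h x > 0" if "x > 0" for x using that by (simp add: h_def exp_flat_def)
  then have pos: "h x + h (1 - x) > 0" for x
    using nonneg(1)[of x] nonneg(1)[of "1 - x"] by (cases "x > 0") (auto intro: add_pos_nonneg add_nonneg_pos)
  have sm: "smooth h" by (simp add: h_def smooth_exp_flat)
  define S S' where "S x = h x * inverse (h x + h (1 - x))"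
    and "S' x = (h' x * h (1 - x) + h x * h' (1 - x)) / (h x + h (1 - x))\<^sup>2" for x
  show thesis
  proof
    have "smooth (\<lambda>x. h (1 - x))"
      by (rule smooth_compose[OF sm smooth_diff[OF smooth_const smooth_bounded_linear[OF bounded_linear_ident]]])
    moreover have "h x + h (1 - x) \<noteq> 0" for x using pos[of x] by simp
    ultimately show "smooth S"
      unfolding S_def[abs_def] by (intro smooth_mult[OF sm smooth_inverse[OF smooth_add[OF sm]]])
    show "(S has_real_derivative S' x) (at x)" for x
    proof -
      have nz: "h x + h (1 - x) \<noteq> 0" using pos[of x] by simp
      have "((\<lambda>x. 1 - x) has_real_derivative - 1) (at x)"
        by (auto intro!: derivative_eq_intros)
      from DERIV_chain'[OF this h_DERIV]
      have h1: "((\<lambda>x. h (1 - x)) has_real_derivative - h' (1 - x)) (at x)"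
        by (simp add: mult.commute)
      have "((\<lambda>x. h x / (h x + h (1 - x))) has_real_derivative
         (h' x * (h x + h (1 - x)) - h x * (h' x + - h' (1 - x)))
           / ((h x + h (1 - x)) * (h x + h (1 - x)))) (at x)"
        by (rule DERIV_divide[OF h_DERIV DERIV_add[OF h_DERIV h1] nz])
      moreover have "S = (\<lambda>x. h x / (h x + h (1 - x)))"
        by (simp add: S_def[abs_def] divide_inverse)
      moreover have "h' x * (h x + h (1 - x)) - h x * (h' x + - h' (1 - x))
          = h' x * h (1 - x) + h x * h' (1 - x)"
        by (simp add: algebra_simps)
      ultimately show ?thesis by (simp add: S'_def power2_eq_square)
    qed
    show "S' x \<ge> 0" for x using nonneg by (simp add: S'_def)
    show "0 \<le> S x" for x using nonneg[of x] pos[of x] by (simp add: S_def)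
    show "S x \<le> 1" for x using nonneg[of "1 - x"] pos[of x] by (simp add: S_def field_simps)
    show "S x = 0" "S' x = 0" if "x \<le> 0" for x using zero[OF that] by (auto simp: S_def S'_def)
    show "S x = 1" "S' x = 0" if "x \<ge> 1" for x
      using zero[of "1 - x"] that pos[of x] by (auto simp: S_def S'_def)
  qed
qed

section \<open>Couplings and test functions\<close>

text \<open>The almost-everywhere form of having support in the closed ball of radius
  \<open>r\<close>, which is what integral estimates consume; \<open>confined_iff_support\<close>
  translates.\<close>

definition confined :: "'a::euclidean_space measure \<Rightarrow> real \<Rightarrow> bool" where
  "confined \<mu> r \<longleftrightarrow> prob_space \<mu> \<and> sets \<mu> = sets borel \<and> (AE x in \<mu>. norm x \<le> r)"

text \<open>The complement of the support is a union of open null sets, and by Lindelof countably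
  many of them already cover it.\<close>

lemma AE_measure_support:
  fixes \<mu> :: "'a::euclidean_space measure"
  assumes sets: "sets \<mu> = sets borel"
  shows "AE x in \<mu>. x \<in> measure_support \<mu>"
proof -
  define \<F> where "\<F> = {U. open U \<and> emeasure \<mu> U = 0}"
  obtain \<F>' where F': "\<F>' \<subseteq> \<F>" "countable \<F>'" "\<Union>\<F>' = \<Union>\<F>"
    using Lindelof[of \<F>] unfolding \<F>_def by auto
  have "\<Union>\<F>' \<in> null_sets \<mu>"
  proof (rule null_sets_UN'[of \<F>' "\<lambda>U. U" \<mu>, simplified])
    show "countable \<F>'" by fact
    show "\<And>U. U \<in> \<F>' \<Longrightarrow> U \<in> null_sets \<mu>"
      using F'(1) sets unfolding \<F>_def null_sets_def by auto
  qed
  then have "AE x in \<mu>. x \<notin> \<Union>\<F>'"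
    by (rule AE_not_in)
  moreover have "x \<in> measure_support \<mu>" if "x \<notin> \<Union>\<F>" for x
    using that unfolding measure_support_def \<F>_def by (auto simp: zero_less_iff_neq_zero)
  ultimately show ?thesis
    unfolding F'(3) by (auto elim: eventually_mono)
qed

lemma measure_support_subset:
  fixes \<mu> :: "'a::euclidean_space measure"
  assumes sets: "sets \<mu> = sets borel" and "closed A" "AE x in \<mu>. x \<in> A"
  shows "measure_support \<mu> \<subseteq> A"
proof
  fix x assume x: "x \<in> measure_support \<mu>"
  show "x \<in> A"
  proof (rule ccontr)
    assume "x \<notin> A"
    then have "emeasure \<mu> (- A) > 0"
      using x \<open>closed A\<close> unfolding measure_support_def by auto
    moreover have "- A \<in> sets \<mu>"
      using \<open>closed A\<close> sets by auto
    moreover have "{x \<in> space \<mu>. x \<notin> A} = - A"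
      using sets_eq_imp_space_eq[OF sets] by auto
    ultimately show False
      using assms(3) by (simp add: AE_iff_measurable[of "- A"])
  qed
qed

lemma confined_iff_support:
  assumes "\<mu> \<in> P2"
  shows "confined \<mu> r \<longleftrightarrow> measure_support \<mu> \<subseteq> cball 0 r"
proof
  assume "confined \<mu> r"
  then show "measure_support \<mu> \<subseteq> cball 0 r"
    using measure_support_subset[of \<mu> "cball 0 r"] by (simp add: confined_def)
next
  assume sub: "measure_support \<mu> \<subseteq> cball 0 r"
  have "AE x in \<mu>. x \<in> measure_support \<mu>"
    using assms AE_measure_support[of \<mu>] by (simp add: P2_def)
  then have "AE x in \<mu>. norm x \<le> r"
    by eventually_elim (use sub in auto)
  then show "confined \<mu> r"
    using assms by (simp add: confined_def P2_def)
qed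

lemma confined_in_P2:
  fixes \<mu> :: "'a::euclidean_space measure"
  assumes "confined \<mu> r"
  shows "\<mu> \<in> P2"
proof -
  interpret prob_space \<mu> using assms by (simp add: confined_def)
  have [measurable_cong]: "sets \<mu> = sets borel" and AE: "AE x in \<mu>. norm x \<le> r"
    using assms by (simp_all add: confined_def)
  have "integrable \<mu> (\<lambda>x. (norm x)\<^sup>2)"
    by (rule integrable_const_bound[of _ "r\<^sup>2"]) (use AE in \<open>auto elim!: eventually_mono intro: power_mono\<close>)
  then show ?thesis
    using assms by (simp add: P2_def confined_def)
qed

lemma confined_radius_nonneg:
  assumes "confined \<mu> r"
  shows "r \<ge> 0"
proof -
  interpret prob_space \<mu> using assms by (simp add: confined_def)
  have "AE x in \<mu>. norm x \<le> r"
    using assms by (simp add: confined_def)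
  then have "AE x in \<mu>. 0 \<le> r"
    by eventually_elim (rule order_trans[OF norm_ge_zero])
  then show ?thesis by simp
qed

lemma confined_mono: "confined \<mu> r \<Longrightarrow> r \<le> r' \<Longrightarrow> confined \<mu> r'"
  unfolding confined_def by (auto elim!: eventually_mono)

section \<open>Couplings and the Wasserstein distance\<close>

lemma couplings_integrable_dist:
  fixes \<mu> \<nu> :: "'a::euclidean_space measure"
  assumes "\<mu> \<in> P2" "\<nu> \<in> P2" "\<gamma> \<in> couplings \<mu> \<nu>"
  shows "integrable \<gamma> (\<lambda>(x, y). (dist x y)\<^sup>2)"
proof -
  have [measurable_cong]: "sets \<gamma> = sets (borel \<Otimes>\<^sub>M borel)" and d: "distr \<gamma> borel fst = \<mu>" "distr \<gamma> borel snd = \<nu>"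
    using assms(3) by (auto simp: couplings_def)
  have "integrable (distr \<gamma> borel fst) (\<lambda>x. (norm x)\<^sup>2)" "integrable (distr \<gamma> borel snd) (\<lambda>x. (norm x)\<^sup>2)"
    using assms(1,2) by (simp_all add: d P2_def)
  then have "integrable \<gamma> (\<lambda>z. (norm (fst z))\<^sup>2)" "integrable \<gamma> (\<lambda>z. (norm (snd z))\<^sup>2)"
    by (simp_all add: integrable_distr_eq)
  then have "integrable \<gamma> (\<lambda>z. 2 * (norm (fst z))\<^sup>2 + 2 * (norm (snd z))\<^sup>2)"
    by simp
  then show ?thesis
  proof (rule Bochner_Integration.integrable_bound)
    show "(\<lambda>(x, y). (dist x y)\<^sup>2) \<in> borel_measurable \<gamma>" by measurable
    have "(dist x y)\<^sup>2 \<le> 2 * (norm x)\<^sup>2 + 2 * (norm y)\<^sup>2" for x y :: 'a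
    proof -
      have "(dist x y)\<^sup>2 \<le> (norm x + norm y)\<^sup>2"
        by (simp add: dist_norm norm_triangle_ineq4 power_mono)
      also have "\<dots> \<le> 2 * (norm x)\<^sup>2 + 2 * (norm y)\<^sup>2"
        using sum_squares_bound[of "norm x" "norm y"] by (simp add: power2_sum)
      finally show ?thesis .
    qed
    then show "AE z in \<gamma>. norm (case z of (x, y) \<Rightarrow> (dist x y)\<^sup>2) \<le> norm (2 * (norm (fst z))\<^sup>2 + 2 * (norm (snd z))\<^sup>2)"
      by (auto simp: split_beta)
  qed
qed

text \<open>The product measure is a coupling. Nonemptiness is what makes the infimum in
  \<open>wasserstein2\<close> a greatest lower bound.\<close>

lemma couplings_nonempty:
  assumes "\<mu> \<in> P2" "\<nu> \<in> P2"
  shows "couplings \<mu> \<nu> \<noteq> {}"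
proof -
  interpret M: prob_space \<mu> using assms by (simp add: P2_def)
  interpret N: prob_space \<nu> using assms by (simp add: P2_def)
  interpret MN: pair_prob_space \<mu> \<nu> ..
  have s: "sets \<mu> = sets borel" "sets \<nu> = sets borel" using assms by (simp_all add: P2_def)
  have "distr (\<mu> \<Otimes>\<^sub>M \<nu>) borel fst = distr (\<mu> \<Otimes>\<^sub>M \<nu>) \<mu> fst"
    by (rule distr_cong) (simp_all add: s)
  moreover have "distr (\<mu> \<Otimes>\<^sub>M \<nu>) borel snd = distr (\<mu> \<Otimes>\<^sub>M \<nu>) \<nu> snd"
    by (rule distr_cong) (simp_all add: s)
  moreover have "distr (\<mu> \<Otimes>\<^sub>M \<nu>) \<mu> fst = \<mu>" "distr (\<mu> \<Otimes>\<^sub>M \<nu>) \<nu> snd = \<nu>"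
  proof -
    show "distr (\<mu> \<Otimes>\<^sub>M \<nu>) \<mu> fst = \<mu>" by (rule N.distr_pair_fst)
    show "distr (\<mu> \<Otimes>\<^sub>M \<nu>) \<nu> snd = \<nu>"
    proof (rule measure_eqI)
      fix A assume A: "A \<in> sets (distr (\<mu> \<Otimes>\<^sub>M \<nu>) \<nu> snd)"
      then have "snd -` A \<inter> space (\<mu> \<Otimes>\<^sub>M \<nu>) = space \<mu> \<times> A"
        using sets.sets_into_space[of A \<nu>] by (auto simp: space_pair_measure)
      with A show "emeasure (distr (\<mu> \<Otimes>\<^sub>M \<nu>) \<nu> snd) A = emeasure \<nu> A"
        by (simp add: emeasure_distr N.emeasure_pair_measure_Times M.emeasure_space_1)
    qed simp
  qed
  ultimately have "\<mu> \<Otimes>\<^sub>M \<nu> \<in> couplings \<mu> \<nu>"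
    unfolding couplings_def using MN.prob_space_axioms s sets_pair_measure_cong[OF s] by auto
  then show ?thesis by auto
qed

lemma coupling_cost_nonneg: "0 \<le> integral\<^sup>L \<gamma> (\<lambda>(x, y). (dist x y)\<^sup>2)"
  by (rule Bochner_Integration.integral_nonneg) auto

lemma wasserstein2_le:
  assumes "\<gamma> \<in> couplings \<mu> \<nu>"
  shows "wasserstein2 \<mu> \<nu> \<le> sqrt (integral\<^sup>L \<gamma> (\<lambda>(x, y). (dist x y)\<^sup>2))"
  unfolding wasserstein2_def
  by (intro real_sqrt_le_mono cINF_lower[OF _ assms] bdd_belowI2[of _ 0] coupling_cost_nonneg)

lemma wasserstein2_nonneg:
  assumes "\<mu> \<in> P2" "\<nu> \<in> P2"
  shows "0 \<le> wasserstein2 \<mu> \<nu>"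
  unfolding wasserstein2_def
  by (intro real_sqrt_ge_zero cINF_greatest couplings_nonempty assms coupling_cost_nonneg)

text \<open>Near-optimal couplings stand in for optimal ones; the error \<open>e\<close> is later
  absorbed or sent to 0, so attainment of the infimum never matters.\<close>

lemma wasserstein2_approx:
  assumes "\<mu> \<in> P2" "\<nu> \<in> P2" "e > 0"
  obtains \<gamma> where "\<gamma> \<in> couplings \<mu> \<nu>"
    "integral\<^sup>L \<gamma> (\<lambda>(x, y). (dist x y)\<^sup>2) < (wasserstein2 \<mu> \<nu>)\<^sup>2 + e"
proof -
  let ?c = "\<lambda>\<gamma>. integral\<^sup>L \<gamma> (\<lambda>(x, y). (dist x y)\<^sup>2)"
  have "0 \<le> (INF \<gamma>\<in>couplings \<mu> \<nu>. ?c \<gamma>)"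
    by (intro cINF_greatest couplings_nonempty assms coupling_cost_nonneg)
  then have "(INF \<gamma>\<in>couplings \<mu> \<nu>. ?c \<gamma>) < (wasserstein2 \<mu> \<nu>)\<^sup>2 + e"
    using \<open>e > 0\<close> by (simp add: wasserstein2_def)
  then show thesis
    using that couplings_nonempty[OF assms(1,2)]
    by (subst (asm) cINF_less_iff) (auto intro!: bdd_belowI2[of _ 0] coupling_cost_nonneg)
qed

text \<open>The mixed bound is tailored to bounded uniformly continuous functions: \<open>a\<close>
  is the modulus of continuity for nearby points, and the quadratic term pays for distant ones, as
  in Chebyshev's inequality.\<close>

lemma coupling_integral_diff:
  fixes \<mu> \<nu> :: "'a::euclidean_space measure" and f g :: "'a \<Rightarrow> real"
  assumes "\<mu> \<in> P2" "\<nu> \<in> P2" "\<gamma> \<in> couplings \<mu> \<nu>" "integrable \<mu> f" "integrable \<nu> g"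
    and le: "\<And>x y. \<bar>f x - g y\<bar> \<le> a + c * (dist x y)\<^sup>2"
  shows "\<bar>(\<integral>x. f x \<partial>\<mu>) - (\<integral>y. g y \<partial>\<nu>)\<bar> \<le> a + c * integral\<^sup>L \<gamma> (\<lambda>(x, y). (dist x y)\<^sup>2)"
proof -
  interpret prob_space \<gamma> using assms(3) by (simp add: couplings_def)
  have [measurable_cong]: "sets \<gamma> = sets (borel \<Otimes>\<^sub>M borel)" and d: "distr \<gamma> borel fst = \<mu>" "distr \<gamma> borel snd = \<nu>"
    using assms(3) by (auto simp: couplings_def)
  have s: "sets \<mu> = sets borel" "sets \<nu> = sets borel" using assms(1,2) by (simp_all add: P2_def)
  have [measurable]: "f \<in> borel_measurable borel" "g \<in> borel_measurable borel"
    using borel_measurable_integrable[OF assms(4)] borel_measurable_integrable[OF assms(5)]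
    unfolding measurable_cong_sets[OF s(1) refl] measurable_cong_sets[OF s(2) refl] .
  have i: "integrable \<gamma> (\<lambda>z. f (fst z))" "integrable \<gamma> (\<lambda>z. g (snd z))"
    using assms(4,5) unfolding d[symmetric] by (simp_all add: integrable_distr_eq)
  have I: "integrable \<gamma> (\<lambda>z. (dist (fst z) (snd z))\<^sup>2)"
    using couplings_integrable_dist[OF assms(1-3)] unfolding split_beta .
  have "(\<integral>x. f x \<partial>\<mu>) - (\<integral>y. g y \<partial>\<nu>) = (\<integral>z. f (fst z) - g (snd z) \<partial>\<gamma>)"
    using i unfolding d[symmetric] by (simp add: integral_distr)
  also have "\<bar>\<dots>\<bar> \<le> (\<integral>z. \<bar>f (fst z) - g (snd z)\<bar> \<partial>\<gamma>)"
    by (rule integral_abs_bound)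
  also have "\<dots> \<le> (\<integral>z. a + c * (dist (fst z) (snd z))\<^sup>2 \<partial>\<gamma>)"
    using i I le by (intro integral_mono) auto
  also have "\<dots> = a + c * integral\<^sup>L \<gamma> (\<lambda>(x, y). (dist x y)\<^sup>2)"
    using I by (simp add: prob_space case_prod_unfold)
  finally show ?thesis .
qed

section \<open>Test functions along continuous curves of measures\<close>

lemma compact_support_continuous:
  fixes \<phi> :: "'a::euclidean_space \<Rightarrow> real"
  assumes "continuous_on UNIV \<phi>" "compact (closure {z. \<phi> z \<noteq> 0})"
  obtains M where "M \<ge> 0" "\<And>z. \<bar>\<phi> z\<bar> \<le> M" "uniformly_continuous_on UNIV \<phi>"
proof -
  let ?K = "closure {z. \<phi> z \<noteq> 0}"
  have zero: "\<phi> z = 0" if "z \<notin> ?K" for z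
    using that closure_subset[of "{z. \<phi> z \<noteq> 0}"] by blast
  have "compact (\<phi> ` ?K)"
    by (rule compact_continuous_image[OF continuous_on_subset[OF assms(1)] assms(2)]) simp
  then obtain M where M: "\<forall>y\<in>?K. norm (\<phi> y) \<le> M"
    using compact_imp_bounded[of "\<phi> ` ?K"] by (auto simp: bounded_iff)
  have bd: "\<bar>\<phi> z\<bar> \<le> max M 0" for z
  proof (cases "z \<in> ?K")
    case True
    then have "\<bar>\<phi> z\<bar> \<le> M" using M by simp
    then show ?thesis by simp
  next
    case False
    then have "\<phi> z = 0" by (rule zero)
    then show ?thesis by simp
  qed
  obtain r where r: "\<And>z. z \<in> ?K \<Longrightarrow> norm z \<le> r"
    using compact_imp_bounded[OF assms(2)] unfolding bounded_iff by blast
  \<comment> \<open>The ball of radius \<open>r + 1\<close> contains the unit neighbourhood of the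
    support. Two points at distance less than 1 therefore either both lie in this ball or both lie
    outside the support.\<close>
  have uc: "uniformly_continuous_on (cball 0 (r + 1)) \<phi>"
    by (rule compact_uniformly_continuous[OF continuous_on_subset[OF assms(1)]]) auto
  have "uniformly_continuous_on UNIV \<phi>"
    unfolding uniformly_continuous_on_def
  proof (intro allI impI)
    fix e :: real assume "e > 0"
    from uc[unfolded uniformly_continuous_on_def, rule_format, OF this] obtain d where d: "d > 0"
      "\<And>x x'. x \<in> cball 0 (r + 1) \<Longrightarrow> x' \<in> cball 0 (r + 1) \<Longrightarrow> dist x' x < d \<Longrightarrow> dist (\<phi> x') (\<phi> x) < e"
      by blast
    have "dist (\<phi> x') (\<phi> x) < e" if "dist x' x < min d 1" for x x'
    proof (cases "x \<in> cball 0 (r + 1) \<and> x' \<in> cball 0 (r + 1)")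
      case True
      then show ?thesis using d that by simp
    next
      case False
      have "norm x \<le> norm x' + dist x' x" "norm x' \<le> norm x + dist x' x"
        using norm_triangle_ineq2[of x x'] norm_triangle_ineq2[of x' x]
        unfolding dist_norm by (simp_all add: norm_minus_commute[of x' x])
      then have "\<not> norm x \<le> r" "\<not> norm x' \<le> r" using False that by auto
      then have "x \<notin> ?K" "x' \<notin> ?K" using r by blast+
      then have "\<phi> x = 0" "\<phi> x' = 0" by (auto intro: zero)
      then show ?thesis using \<open>e > 0\<close> by simp
    qed
    then show "\<exists>d>0. \<forall>x\<in>UNIV. \<forall>x'\<in>UNIV. dist x' x < d \<longrightarrow> dist (\<phi> x') (\<phi> x) < e"
      using \<open>d > 0\<close> by (intro exI[of _ "min d 1"]) simp
  qed
  then show thesis by (intro that[of "max M 0"] bd) simp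
qed

lemma test_function_smooth: "\<phi> \<in> test_functions \<Longrightarrow> smooth \<phi>"
  by (simp add: test_functions_def smooth_def)

lemma test_function_props:
  assumes "\<phi> \<in> test_functions"
  obtains M where "M \<ge> 0" "\<And>z. \<bar>\<phi> z\<bar> \<le> M" "uniformly_continuous_on UNIV \<phi>"
  using compact_support_continuous[of \<phi> thesis] assms smooth_continuous_on[OF test_function_smooth[OF assms]]
  by (auto simp: test_functions_def)

lemma integrable_test_function:
  assumes "\<mu> \<in> P2" "\<phi> \<in> test_functions"
  shows "integrable \<mu> (\<lambda>x. \<phi> (t, x))"
proof -
  interpret prob_space \<mu> using assms by (simp add: P2_def)
  have [measurable_cong]: "sets \<mu> = sets borel" using assms by (simp add: P2_def)
  obtain M where M: "\<And>z. \<bar>\<phi> z\<bar> \<le> M" using test_function_props[OF assms(2)] by metis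
  have "continuous_on UNIV (\<lambda>x. \<phi> (t, x))"
    by (rule continuous_on_compose2[OF smooth_continuous_on[OF test_function_smooth[OF assms(2)]], of UNIV])
      (auto intro: continuous_intros)
  then have [measurable]: "(\<lambda>x. \<phi> (t, x)) \<in> borel_measurable borel"
    by (rule borel_measurable_continuous_onI)
  show ?thesis by (rule integrable_const_bound[of _ M]) (use M in auto)
qed

text \<open>Wasserstein convergence implies weak convergence. Uniform continuity of
  \<open>\<phi>\<close> on space-time handles the explicit dependence on time together with the
  coupled points.\<close>

lemma P2_continuous_curve_test_function:
  assumes cv: "P2_continuous_curve T \<mu>" and \<phi>: "\<phi> \<in> test_functions"
  shows "continuous_on {0..T} (\<lambda>t. \<integral>x. \<phi> (t, x) \<partial>\<mu> t)"
  unfolding continuous_on_def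
proof (intro ballI tendstoI)
  fix t e :: real assume t: "t \<in> {0..T}" and e: "0 < e"
  obtain M where M: "M \<ge> 0" "\<And>z. \<bar>\<phi> z\<bar> \<le> M" and uc: "uniformly_continuous_on UNIV \<phi>"
    using test_function_props[OF \<phi>] by metis
  obtain d where d: "d > 0" "\<And>z z'. dist z' z < d \<Longrightarrow> dist (\<phi> z') (\<phi> z) < e / 3"
    using uc e unfolding uniformly_continuous_on_def by (metis UNIV_I divide_pos_pos zero_less_numeral)
  \<comment> \<open>Chosen so that \<open>2 * M = c * (d / 2)^2\<close>: the trivial bound
    \<open>2 * M\<close> on the difference is then dominated by the quadratic term as soon as the
    points are at least \<open>d / 2\<close> apart.\<close>
  define c where "c = 8 * M / d\<^sup>2"
  have c0: "c \<ge> 0" using M by (simp add: c_def)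
  \<comment> \<open>Distances below \<open>w\<close> make the quadratic term smaller than
    \<open>e / 3\<close>; the summand 1 guards against \<open>c = 0\<close>.\<close>
  define w where "w = sqrt (e / (3 * (c + 1)))"
  have w: "w > 0" "w\<^sup>2 * c < e / 3"
  proof -
    show "w > 0" using e c0 by (simp add: w_def)
    have "w\<^sup>2 * c = (e / 3) * (c / (c + 1))" using e c0 by (simp add: w_def field_simps)
    also have "\<dots> < (e / 3) * 1" using e c0 by (intro mult_strict_left_mono) auto
    finally show "w\<^sup>2 * c < e / 3" by simp
  qed
  have lim: "((\<lambda>s. wasserstein2 (\<mu> s) (\<mu> t)) \<longlongrightarrow> 0) (at t within {0..T})"
    using cv t by (simp add: P2_continuous_curve_def)
  have "\<forall>\<^sub>F s in at t within {0..T}. dist (wasserstein2 (\<mu> s) (\<mu> t)) 0 < w"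
    by (rule tendstoD[OF lim w(1)])
  moreover have "\<forall>\<^sub>F s in at t within {0..T}. dist s t < d / 2"
    using d(1) by (intro tendstoD tendsto_ident_at) simp
  moreover have "\<forall>\<^sub>F s in at t within {0..T}. s \<in> {0..T}"
    by (auto simp: eventually_at_filter)
  ultimately show "\<forall>\<^sub>F s in at t within {0..T}. dist (\<integral>x. \<phi> (s, x) \<partial>\<mu> s) (\<integral>x. \<phi> (t, x) \<partial>\<mu> t) < e"
  proof eventually_elim
    case (elim s)
    have P2: "\<mu> s \<in> P2" "\<mu> t \<in> P2" using cv t elim by (auto simp: P2_continuous_curve_def)
    have W: "(wasserstein2 (\<mu> s) (\<mu> t))\<^sup>2 < w\<^sup>2"
      using elim(1) wasserstein2_nonneg[OF P2] by (intro power_strict_mono) auto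
    obtain \<gamma> where \<gamma>: "\<gamma> \<in> couplings (\<mu> s) (\<mu> t)"
      "integral\<^sup>L \<gamma> (\<lambda>(x, y). (dist x y)\<^sup>2) < (wasserstein2 (\<mu> s) (\<mu> t))\<^sup>2 + (w\<^sup>2 - (wasserstein2 (\<mu> s) (\<mu> t))\<^sup>2)"
      using wasserstein2_approx[OF P2, of "w\<^sup>2 - (wasserstein2 (\<mu> s) (\<mu> t))\<^sup>2"] W by (metis diff_gt_0_iff_gt)
    have bnd: "\<bar>\<phi> (s, x) - \<phi> (t, y)\<bar> \<le> e / 3 + c * (dist x y)\<^sup>2" for x y
    proof (cases "dist x y < d / 2")
      case True
      have "dist (s, x) (t, y) \<le> dist s t + dist x y"
        unfolding dist_Pair_Pair by (rule sqrt_sum_squares_le_sum) auto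
      with True elim have "dist (s, x) (t, y) < d" by simp
      then have "dist (\<phi> (s, x)) (\<phi> (t, y)) < e / 3" by (rule d(2))
      moreover have "0 \<le> c * (dist x y)\<^sup>2" using c0 by simp
      ultimately show ?thesis unfolding dist_real_def by linarith
    next
      case False
      have "\<bar>\<phi> (s, x) - \<phi> (t, y)\<bar> \<le> 2 * M"
        using M(2)[of "(s, x)"] M(2)[of "(t, y)"] by linarith
      also have "2 * M = c * (d / 2)\<^sup>2" using d(1) by (simp add: c_def power2_eq_square field_simps)
      also have "\<dots> \<le> c * (dist x y)\<^sup>2"
        using False d(1) c0 by (intro mult_left_mono power_mono) auto
      finally show ?thesis using e by linarith
    qed
    have "\<bar>(\<integral>x. \<phi> (s, x) \<partial>\<mu> s) - (\<integral>x. \<phi> (t, x) \<partial>\<mu> t)\<bar>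
        \<le> e / 3 + c * integral\<^sup>L \<gamma> (\<lambda>(x, y). (dist x y)\<^sup>2)"
      by (rule coupling_integral_diff[OF P2 \<gamma>(1) integrable_test_function[OF P2(1) \<phi>]
            integrable_test_function[OF P2(2) \<phi>] bnd])
    also have "\<dots> \<le> e / 3 + c * w\<^sup>2" using \<gamma>(2) c0 by (intro add_left_mono mult_left_mono) auto
    also have "\<dots> < e" using w(2) e by (simp add: mult.commute)
    finally show ?case by (simp add: dist_real_def)
  qed
qed

section \<open>The weak formulation as an inequality for barriers\<close>

definition velocity ::
    "('d::finite, 'k::finite) param measure \<Rightarrow> (real^'d \<Rightarrow> real^'d) \<Rightarrow> (real^'d) measure \<Rightarrow> real^'d \<Rightarrow> real^'d" where
  "velocity \<rho> F \<mu> x = attention_field \<rho> \<mu> x + F x"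

text \<open>Reading the integrand as a directional derivative in space-time allows barriers to be
  differentiated without coordinates.\<close>

lemma transport_integrand_eq:
  fixes \<phi> :: "real \<times> (real^'d::finite) \<Rightarrow> real"
  assumes "\<phi> differentiable (at (t, x))"
  shows "transport_integrand \<rho> F \<mu> \<phi> t x = frechet_derivative \<phi> (at (t, x)) (1, velocity \<rho> F (\<mu> t) x)"
proof -
  let ?D = "frechet_derivative \<phi> (at (t, x))"
  have lin: "linear ?D" using assms by (rule linear_frechet_derivative)
  have grad: "space_gradient \<phi> t x \<bullet> v = ?D (0, v)" for v
  proof -
    have "(0, v) = (\<Sum>i\<in>UNIV. v $ i *\<^sub>R (0::real, axis i (1::real)))"
      by (auto simp: prod_eq_iff fst_sum snd_sum basis_expansion scalar_mult_eq_scaleR[symmetric])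
    then have "?D (0, v) = (\<Sum>i\<in>UNIV. v $ i * ?D (0, axis i 1))"
      by (simp add: linear_sum[OF lin] linear_scale[OF lin] del: scaleR_Pair)
    then show ?thesis
      by (simp add: space_gradient_def inner_vec_def mult.commute)
  qed
  have "(1::real, velocity \<rho> F (\<mu> t) x) = (1, 0) + (0, attention_field \<rho> (\<mu> t) x) + (0, F x)"
    by (simp add: velocity_def)
  then show ?thesis
    unfolding transport_integrand_def time_derivative_def grad
    by (simp only: linear_add[OF lin])
qed

lemma smooth_differentiable: "smooth f \<Longrightarrow> f differentiable (at x)"
  using smooth_has_derivative differentiable_def by blast

lemma smooth_fst: "smooth (fst :: real \<times> 'b::euclidean_space \<Rightarrow> real)"
  by (rule smooth_bounded_linear[OF bounded_linear_fst])

lemma time_cutoff_test_function: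
  fixes \<phi> :: "real \<times> (real^'d::finite) \<Rightarrow> real"
  assumes "\<phi> \<in> test_functions" "smooth \<eta>"
  shows "(\<lambda>z. \<eta> (fst z) * \<phi> z) \<in> test_functions"
proof -
  have "smooth (\<lambda>z. \<eta> (fst z) * \<phi> z)"
    by (intro smooth_mult smooth_compose[OF assms(2) smooth_fst] test_function_smooth assms)
  moreover have "closure {z. \<eta> (fst z) * \<phi> z \<noteq> 0} \<subseteq> closure {z. \<phi> z \<noteq> 0}"
    by (rule closure_mono) auto
  then have "compact (closure {z. \<eta> (fst z) * \<phi> z \<noteq> 0})"
    using assms(1) compact_Int_closed[OF _ closed_closure] unfolding test_functions_def
    by (metis (mono_tags, lifting) inf.absorb_iff2 mem_Collect_eq)
  ultimately show ?thesis by (simp add: test_functions_def smooth_def)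
qed

lemma smooth_DERIV_continuous:
  assumes "smooth S" "\<And>x. (S has_real_derivative S' x) (at x)"
  shows "continuous_on UNIV S'"
proof -
  have "frechet_derivative S (at x) 1 = S' x" for x
    using frechet_derivative_at[OF assms(2)[unfolded has_field_derivative_def]] by (metis mult.right_neutral)
  then have "S' = (\<lambda>x. frechet_derivative S (at x) 1)" by auto
  then show ?thesis using smooth_continuous_on[OF smooth_frechet[OF assms(1)]] by simp
qed

text \<open>The product rule for \<open>\<eta> t * \<phi> (t, x)\<close>; the boundary terms vanish
  because \<open>\<eta>\<close> is 0 at both ends. In effect \<open>G\<close> is the distributional
  derivative of \<open>g\<close>.\<close>

lemma weak_solution_time_test:
  fixes \<phi> :: "real \<times> (real^'d::finite) \<Rightarrow> real" and \<rho> :: "('d, 'k::finite) param measure"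
  assumes w: "weak_solution T \<rho> F \<mu>\<^sub>0 \<mu>" and \<phi>: "\<phi> \<in> test_functions"
    and \<eta>: "smooth \<eta>" "\<And>x. (\<eta> has_real_derivative \<eta>' x) (at x)" "\<eta> 0 = 0" "\<eta> T = 0"
  defines "G \<equiv> \<lambda>t. \<integral>x. transport_integrand \<rho> F \<mu> \<phi> t x \<partial>\<mu> t"
    and "g \<equiv> \<lambda>t. \<integral>x. \<phi> (t, x) \<partial>\<mu> t"
  shows "set_integrable lborel {0..T} (\<lambda>t. \<eta>' t * g t + \<eta> t * G t)"
    and "(LINT t:{0..T}|lborel. \<eta>' t * g t + \<eta> t * G t) = 0"
proof -
  let ?\<psi> = "\<lambda>z. \<eta> (fst z) * \<phi> z"
  have P2: "\<mu> t \<in> P2" if "t \<in> {0..T}" for t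
    using w that by (auto simp: weak_solution_def P2_continuous_curve_def)
  have int: "integrable (\<mu> t) (transport_integrand \<rho> F \<mu> \<phi> t)" if "t \<in> {0..T}" for t
    using w \<phi> that by (auto simp: weak_solution_def)
  have psi: "?\<psi> \<in> test_functions" by (rule time_cutoff_test_function[OF \<phi> \<eta>(1)])
  have eq: "transport_integrand \<rho> F \<mu> ?\<psi> t x = \<eta>' t * \<phi> (t, x) + \<eta> t * transport_integrand \<rho> F \<mu> \<phi> t x" for t x
  proof -
    have e1: "((\<lambda>z::real \<times> (real^'d). \<eta> (fst z)) has_derivative (\<lambda>v. \<eta>' t * fst v)) (at (t, x))"
      by (rule has_derivative_compose[where g = \<eta>, OF bounded_linear_imp_has_derivative[OF bounded_linear_fst]])
        (use \<eta>(2)[of t] in \<open>simp add: has_field_derivative_def\<close>)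
    have "(?\<psi> has_derivative (\<lambda>v. \<eta> (fst (t, x)) * frechet_derivative \<phi> (at (t, x)) v + \<eta>' t * fst v * \<phi> (t, x))) (at (t, x))"
      by (rule has_derivative_mult[OF e1 smooth_has_derivative[OF test_function_smooth[OF \<phi>]]])
    from frechet_derivative_at[OF this, symmetric] show ?thesis
      using transport_integrand_eq[OF smooth_differentiable[OF test_function_smooth[OF \<phi>]], where t=t and x=x and \<rho>=\<rho> and F=F and \<mu>=\<mu>]
        transport_integrand_eq[OF smooth_differentiable[OF test_function_smooth[OF psi]], where t=t and x=x and \<rho>=\<rho> and F=F and \<mu>=\<mu>]
      by simp
  qed
  have eqG: "(\<integral>x. transport_integrand \<rho> F \<mu> ?\<psi> t x \<partial>\<mu> t) = \<eta>' t * g t + \<eta> t * G t" if "t \<in> {0..T}" for t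
    unfolding eq g_def G_def using int[OF that] integrable_test_function[OF P2[OF that] \<phi>] by simp
  have si: "set_integrable lborel {0..T} (\<lambda>t. \<integral>x. transport_integrand \<rho> F \<mu> ?\<psi> t x \<partial>\<mu> t)"
    and se: "(\<integral>x. ?\<psi> (T, x) \<partial>\<mu> T) - (\<integral>x. ?\<psi> (0, x) \<partial>\<mu>\<^sub>0)
      = (LINT t:{0..T}|lborel. (\<integral>x. transport_integrand \<rho> F \<mu> ?\<psi> t x \<partial>\<mu> t))"
    using w[unfolded weak_solution_def, THEN conjunct2, THEN conjunct2, THEN conjunct2, THEN conjunct2,
        rule_format, OF psi] by simp_all
  show "set_integrable lborel {0..T} (\<lambda>t. \<eta>' t * g t + \<eta> t * G t)"
    using si by (rule set_integrable_cong[THEN iffD1, rotated 3]) (auto simp: eqG)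
  have "(LINT t:{0..T}|lborel. \<eta>' t * g t + \<eta> t * G t)
      = (LINT t:{0..T}|lborel. (\<integral>x. transport_integrand \<rho> F \<mu> ?\<psi> t x \<partial>\<mu> t))"
    by (rule set_lebesgue_integral_cong) (auto simp: eqG)
  then show "(LINT t:{0..T}|lborel. \<eta>' t * g t + \<eta> t * G t) = 0"
    using se \<eta>(3,4) by simp
qed

text \<open>The weak formulation only sees the times 0 and \<open>T\<close>. Multiplying the test function by a plateau
  in time that rises just after \<open>s\<close> and falls just before \<open>t\<close> localises it to \<open>[s, t]\<close>.\<close>

lemma weak_solution_monotone:
  fixes \<phi> :: "real \<times> (real^'d::finite) \<Rightarrow> real" and \<rho> :: "('d, 'k::finite) param measure"
  assumes w: "weak_solution T \<rho> F \<mu>\<^sub>0 \<mu>" and \<phi>: "\<phi> \<in> test_functions"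
    and st: "0 \<le> s" "s \<le> t" "t \<le> T"
    and nonneg: "\<And>\<tau>. s \<le> \<tau> \<Longrightarrow> \<tau> \<le> t \<Longrightarrow> 0 \<le> (\<integral>x. transport_integrand \<rho> F \<mu> \<phi> \<tau> x \<partial>\<mu> \<tau>)"
  shows "(\<integral>x. \<phi> (s, x) \<partial>\<mu> s) \<le> (\<integral>x. \<phi> (t, x) \<partial>\<mu> t)"
proof (rule ccontr)
  define g where "g t = (\<integral>x. \<phi> (t, x) \<partial>\<mu> t)" for t
  define G where "G t = (\<integral>x. transport_integrand \<rho> F \<mu> \<phi> t x \<partial>\<mu> t)" for t
  assume "\<not> ?thesis"
  then have less: "g t < g s" by (simp add: g_def)
  then have "s < t" using st by (cases "s = t") auto
  \<comment> \<open>A third of the assumed drop, so that lowering \<open>g s\<close> and raising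
    \<open>g t\<close> by \<open>m\<close> still leaves a drop of \<open>m\<close>.\<close>
  define m where "m = (g s - g t) / 3"
  have m: "m > 0" using less by (simp add: m_def)
  have "continuous_on {0..T} g"
    unfolding g_def using P2_continuous_curve_test_function[OF _ \<phi>] w by (simp add: weak_solution_def)
  then have cont: "\<exists>d>0. \<forall>y\<in>{0..T}. dist y x < d \<longrightarrow> dist (g y) (g x) < m" if "x \<in> {0..T}" for x
    using that m unfolding continuous_on_iff by blast
  obtain d1 where d1: "d1 > 0" "\<And>y. y \<in> {0..T} \<Longrightarrow> dist y s < d1 \<Longrightarrow> dist (g y) (g s) < m"
    using cont[of s] st by auto
  obtain d2 where d2: "d2 > 0" "\<And>y. y \<in> {0..T} \<Longrightarrow> dist y t < d2 \<Longrightarrow> dist (g y) (g t) < m"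
    using cont[of t] st by auto
  \<comment> \<open>The ramps of length \<open>d\<close> must stay where \<open>g\<close> is within
    \<open>m\<close> of \<open>g s\<close> or \<open>g t\<close>; \<open>d <= t - s\<close> keeps
    the falling ramp to the right of the rising one.\<close>
  define d where "d = min (min (d1 / 2) (d2 / 2)) (t - s)"
  have d: "d > 0" "d < d1" "d < d2" "d \<le> t - s"
    using d1(1) d2(1) \<open>s < t\<close> by (auto simp: d_def min_def)
  obtain S S' :: "real \<Rightarrow> real" where S: "smooth S" "\<And>x. (S has_real_derivative S' x) (at x)"
    "\<And>x. S' x \<ge> 0" "\<And>x. x \<le> 0 \<Longrightarrow> S x = 0" "\<And>x. x \<ge> 1 \<Longrightarrow> S x = 1"
    "\<And>x. x \<le> 0 \<Longrightarrow> S' x = 0" "\<And>x. x \<ge> 1 \<Longrightarrow> S' x = 0" "\<And>x. 0 \<le> S x" "\<And>x. S x \<le> 1"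
    by (rule smooth_step_exists, rule that; assumption)
  have S_mono: "S x \<le> S y" if "x \<le> y" for x y
    by (rule DERIV_nonneg_imp_nondecreasing[OF that]) (use S(2,3) in blast)
  \<comment> \<open>\<open>l\<close> rises from 0 to 1 on \<open>[s, s + d]\<close> and
    \<open>r\<close> on \<open>[t - d, t]\<close>, so \<open>l - r\<close> is the plateau. Both have
    the same values at 0 and at \<open>T\<close>, as the time test requires.\<close>
  define l r where "l x = S ((x - s) / d)" and "r x = S ((x - (t - d)) / d)" for x
  define l' r' where "l' x = S' ((x - s) / d) / d" and "r' x = S' ((x - (t - d)) / d) / d" for x
  have aff: "((\<lambda>x. (x - a) / d) has_real_derivative 1 / d) (at x)" for a x
    using d(1) by (auto intro!: derivative_eq_intros)
  have l': "(l has_real_derivative l' x) (at x)" and r': "(r has_real_derivative r' x) (at x)" for x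
    unfolding l_def[abs_def] r_def[abs_def] l'_def r'_def
    using DERIV_chain'[OF aff S(2)] by simp_all
  have sm_aff: "smooth (\<lambda>x::real. (x - a) / d)" for a
    by (intro smooth_divide_const smooth_diff smooth_const smooth_bounded_linear bounded_linear_ident)
  have sm: "smooth l" "smooth r"
    unfolding l_def[abs_def] r_def[abs_def] by (rule smooth_compose[OF S(1) sm_aff])+
  have cl: "continuous_on UNIV l'" "continuous_on UNIV r'"
    using smooth_DERIV_continuous[OF sm(1) l'] smooth_DERIV_continuous[OF sm(2) r'] .
  have at0: "l 0 = 0" "r 0 = 0" and atT: "l T = 1" "r T = 1"
    using st d S(4,5) by (auto simp: l_def r_def divide_nonpos_pos field_simps)
  have I: "set_integrable lborel {0..T} (\<lambda>x. (l' x - r' x) * g x + (l x - r x) * G x)"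
    and Z: "(LINT x:{0..T}|lborel. (l' x - r' x) * g x + (l x - r x) * G x) = 0"
    unfolding g_def G_def
    by (rule weak_solution_time_test[OF w \<phi> smooth_diff[OF sm] DERIV_diff[OF l' r']]; simp add: at0 atT)+
  have J: "set_integrable lborel {0..T} (\<lambda>x. l' x * (g s - m) - r' x * (g t + m))"
    by (intro borel_integrable_atLeastAtMost' continuous_intros continuous_on_subset[OF cl(1)]
        continuous_on_subset[OF cl(2)]) auto
  \<comment> \<open>The comparison integrand is an exact derivative with integral
    \<open>m > 0\<close>, whereas the larger integrand of the weak formulation has integral
    0.\<close>
  have FTC: "(LINT x:{0..T}|lborel. l' x * (g s - m) - r' x * (g t + m)) = (g s - m) - (g t + m)"
  proof -
    have "(\<integral>x. (l' x * (g s - m) - r' x * (g t + m)) * indicator {0..T} x \<partial>lborel)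
        = (l T * (g s - m) - r T * (g t + m)) - (l 0 * (g s - m) - r 0 * (g t + m))"
    proof (rule integral_FTC_Icc_real)
      show "0 \<le> T" using st by simp
      show "((\<lambda>x. l x * (g s - m) - r x * (g t + m)) has_real_derivative
          l' x * (g s - m) - r' x * (g t + m)) (at x)" for x
        by (intro DERIV_diff DERIV_cmult_right l' r')
      have "isCont l' x" "isCont r' x" for x using cl by (simp_all add: continuous_on_eq_continuous_at)
      then show "isCont (\<lambda>x. l' x * (g s - m) - r' x * (g t + m)) x" for x
        by (intro continuous_intros) auto
    qed
    then show ?thesis
      by (simp add: set_lebesgue_integral_def at0 atT mult.commute)
  qed
  \<comment> \<open>\<open>l'\<close> is supported near \<open>s\<close>, where
    \<open>g x > g s - m\<close>, and \<open>r'\<close> near \<open>t\<close>, where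
    \<open>g x < g t + m\<close>. The remaining term is nonnegative: \<open>l >= r\<close> on
    \<open>[s, t]\<close> by monotonicity of \<open>S\<close>, and \<open>l = r\<close>
    elsewhere.\<close>
  have le: "l' x * (g s - m) - r' x * (g t + m) \<le> (l' x - r' x) * g x + (l x - r x) * G x"
    if x: "x \<in> {0..T}" for x
  proof -
    have "l' x * (g s - m) \<le> l' x * g x"
    proof (cases "s < x \<and> x < s + d")
      case True
      then have "dist (g x) (g s) < m" using d by (intro d1(2) x) (auto simp: dist_real_def)
      moreover have "l' x \<ge> 0" using S(3) d by (simp add: l'_def)
      ultimately show ?thesis by (intro mult_left_mono) (auto simp: dist_real_def)
    next
      case False
      then have "(x - s) / d \<le> 0 \<or> (x - s) / d \<ge> 1" using d by (auto simp: field_simps)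
      then have "l' x = 0" using S(6,7) by (auto simp: l'_def)
      then show ?thesis by simp
    qed
    moreover have "r' x * g x \<le> r' x * (g t + m)"
    proof (cases "t - d < x \<and> x < t")
      case True
      then have "dist (g x) (g t) < m" using d by (intro d2(2) x) (auto simp: dist_real_def)
      moreover have "r' x \<ge> 0" using S(3) d by (simp add: r'_def)
      ultimately show ?thesis by (intro mult_left_mono) (auto simp: dist_real_def)
    next
      case False
      then have "(x - (t - d)) / d \<le> 0 \<or> (x - (t - d)) / d \<ge> 1" using d by (auto simp: field_simps)
      then have "r' x = 0" using S(6,7) by (auto simp: r'_def)
      then show ?thesis by simp
    qed
    moreover have "0 \<le> (l x - r x) * G x"
    proof (cases "s \<le> x \<and> x \<le> t")
      case True
      have "r x \<le> l x" unfolding l_def r_def using d by (intro S_mono divide_right_mono) auto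
      moreover have "0 \<le> G x" using nonneg True by (simp add: G_def)
      ultimately show ?thesis by simp
    next
      case False
      then consider "x < s" | "t < x" by linarith
      then have "l x = r x"
      proof cases
        case 1
        then show ?thesis using d S(4) by (simp add: l_def r_def divide_nonpos_pos)
      next
        case 2
        then show ?thesis using d S(5) by (simp add: l_def r_def field_simps)
      qed
      then show ?thesis by simp
    qed
    ultimately show ?thesis by (simp add: algebra_simps)
  qed
  have "(LINT x:{0..T}|lborel. l' x * (g s - m) - r' x * (g t + m))
      \<le> (LINT x:{0..T}|lborel. (l' x - r' x) * g x + (l x - r x) * G x)"
    by (rule set_integral_mono[OF J I le])
  then have "(g s - m) - (g t + m) \<le> 0" unfolding FTC Z .
  then show False using m unfolding m_def by (simp add: field_simps)
qed

text \<open>A smooth cutoff in time that is 1 around \<open>[0, T]\<close> turns \<open>f\<close>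
  into a test function and leaves its derivatives there unchanged. The sign condition may fail on a
  null set of \<open>\<mu> \<tau>\<close>, which is essential since barriers are controlled only
  where there is mass.\<close>

lemma weak_solution_barrier:
  fixes f :: "real \<times> (real^'d::finite) \<Rightarrow> real" and \<rho> :: "('d, 'k::finite) param measure"
  assumes w: "weak_solution T \<rho> F \<mu>\<^sub>0 \<mu>" and f: "smooth f"
    and supp: "\<And>t x. - 1 \<le> t \<Longrightarrow> t \<le> T + 1 \<Longrightarrow> f (t, x) \<noteq> 0 \<Longrightarrow> norm x \<le> M"
    and st: "0 \<le> s" "s \<le> t" "t \<le> T"
    and nonneg: "\<And>\<tau>. s \<le> \<tau> \<Longrightarrow> \<tau> \<le> t \<Longrightarrow>
      AE x in \<mu> \<tau>. 0 \<le> frechet_derivative f (at (\<tau>, x)) (1, velocity \<rho> F (\<mu> \<tau>) x)"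
  shows "(\<integral>x. f (s, x) \<partial>\<mu> s) \<le> (\<integral>x. f (t, x) \<partial>\<mu> t)"
proof -
  obtain S S' :: "real \<Rightarrow> real" where S: "smooth S" "\<And>x. x \<le> 0 \<Longrightarrow> S x = 0" "\<And>x. x \<ge> 1 \<Longrightarrow> S x = 1"
    by (rule smooth_step_exists, rule that; assumption)
  \<comment> \<open>Equal to 1 on \<open>[- 1/2, T + 1/2]\<close> and to 0 outside
    \<open>[- 1, T + 1]\<close>.\<close>
  define \<eta> where "\<eta> t = S (2 * t + 2) * S (2 * (T - t) + 2)" for t
  define \<phi> where "\<phi> = (\<lambda>z. \<eta> (fst z) * f z)"
  have "smooth (\<lambda>t::real. 2 * t + 2)" "smooth (\<lambda>t::real. 2 * (T - t) + 2)"
    by (intro smooth_add smooth_diff smooth_mult smooth_const smooth_bounded_linear[OF bounded_linear_ident])+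
  then have "smooth \<eta>"
    unfolding \<eta>_def[abs_def] by (intro smooth_mult smooth_compose[OF S(1)])
  then have sm: "smooth \<phi>"
    unfolding \<phi>_def by (intro smooth_mult f smooth_compose[OF _ smooth_fst])
  have "{z. \<phi> z \<noteq> 0} \<subseteq> {- 1..T + 1} \<times> cball 0 M"
  proof
    fix z assume "z \<in> {z. \<phi> z \<noteq> 0}"
    moreover obtain t x where z: "z = (t, x)" by fastforce
    ultimately have nz: "\<phi> (t, x) \<noteq> 0" by simp
    then have "\<not> 2 * t + 2 \<le> 0" "\<not> 2 * (T - t) + 2 \<le> 0"
      using S(2) by (auto simp: \<phi>_def \<eta>_def)
    then have t: "- 1 \<le> t" "t \<le> T + 1" by auto
    then have "norm x \<le> M" using supp[of t x] nz by (auto simp: \<phi>_def)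
    then show "z \<in> {- 1..T + 1} \<times> cball 0 M" using t z by simp
  qed
  then have "closure {z. \<phi> z \<noteq> 0} \<subseteq> {- 1..T + 1} \<times> cball 0 M"
    by (intro closure_minimal closed_Times) auto
  moreover have "compact ({- 1..T + 1} \<times> cball 0 M :: (real \<times> (real^'d)) set)"
    by (intro compact_Times) auto
  ultimately have "compact (closure {z. \<phi> z \<noteq> 0})"
    using compact_Int_closed[OF _ closed_closure] by (metis inf.absorb_iff2)
  with sm have test: "\<phi> \<in> test_functions"
    by (simp add: test_functions_def smooth_def)
  have \<phi>_eq: "\<phi> z = f z" if "fst z \<in> {- 1 / 2<..<T + 1 / 2}" for z
    using that S(3) by (simp add: \<phi>_def \<eta>_def)
  have D: "frechet_derivative \<phi> (at (\<tau>, x)) = frechet_derivative f (at (\<tau>, x))" if "0 \<le> \<tau>" "\<tau> \<le> T" for \<tau> x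
  proof -
    have "(\<phi> has_derivative frechet_derivative f (at (\<tau>, x))) (at (\<tau>, x))"
      by (rule has_derivative_transform_within_open[OF smooth_has_derivative[OF f]
            open_Times[OF open_greaterThanLessThan[of "- 1 / 2" "T + 1 / 2"] open_UNIV]])
        (use that \<phi>_eq in auto)
    then show ?thesis by (rule frechet_derivative_at[symmetric])
  qed
  have "(\<integral>x. \<phi> (s, x) \<partial>\<mu> s) \<le> (\<integral>x. \<phi> (t, x) \<partial>\<mu> t)"
  proof (rule weak_solution_monotone[OF w test st])
    fix \<tau> assume \<tau>: "s \<le> \<tau>" "\<tau> \<le> t"
    show "0 \<le> (\<integral>x. transport_integrand \<rho> F \<mu> \<phi> \<tau> x \<partial>\<mu> \<tau>)"
      using nonneg[OF \<tau>] D[of \<tau>] \<tau> st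
      by (intro integral_nonneg_AE) (simp add: transport_integrand_eq[OF smooth_differentiable[OF sm]])
  qed
  then show ?thesis using \<phi>_eq st by simp
qed

section \<open>Estimates for the attention field\<close>

text \<open>The norm of a matrix is here the Frobenius norm, which dominates the operator norm by
  Cauchy-Schwarz in each row.\<close>

lemma norm_matrix_vector_mult_le:
  fixes A :: "real^'n^'m"
  shows "norm (A *v x) \<le> norm A * norm x"
proof -
  have "norm (A *v x) = L2_set (\<lambda>i. norm ((A *v x) $ i)) UNIV"
    by (simp add: norm_vec_def)
  also have "\<dots> \<le> L2_set (\<lambda>i. norm (A $ i) * norm x) UNIV"
  proof (rule L2_set_mono)
    fix i
    have "(A *v x) $ i = A $ i \<bullet> x"
      by (simp add: matrix_vector_mult_def inner_vec_def)
    then show "norm ((A *v x) $ i) \<le> norm (A $ i) * norm x"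
      using Cauchy_Schwarz_ineq2[of "A $ i" x] by simp
  qed simp
  also have "\<dots> = norm A * norm x"
    by (subst L2_set_left_distrib[symmetric]) (simp_all add: norm_vec_def)
  finally show ?thesis .
qed

lemma continuous_on_matrix_vector_mult [continuous_intros]:
  fixes A :: "'a::topological_space \<Rightarrow> real^'n^'m"
  assumes "continuous_on S A" "continuous_on S b"
  shows "continuous_on S (\<lambda>x. A x *v b x)"
  unfolding matrix_vector_mult_def by (intro continuous_intros assms)

lemma integral_norm_bound_AE:
  fixes f :: "'a \<Rightarrow> 'b::{banach, second_countable_topology}"
  assumes "integrable M f" "integrable M g" "AE x in M. norm (f x) \<le> g x"
  shows "norm (\<integral>x. f x \<partial>M) \<le> (\<integral>x. g x \<partial>M)"
  using integral_norm_bound[of M f] integral_mono_AE[OF integrable_norm[OF assms(1)] assms(2,3)]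
  by linarith

lemma exp_diff_le:
  fixes s t :: real
  assumes "s \<le> m" "t \<le> m"
  shows "\<bar>exp s - exp t\<bar> \<le> exp m * \<bar>s - t\<bar>"
proof -
  have main: "exp s - exp t \<le> exp m * (s - t)" if "t \<le> s" "s \<le> m" for s t :: real
  proof -
    have "exp s * (1 + (t - s)) \<le> exp s * exp (t - s)"
      by (intro mult_left_mono exp_ge_add_one_self) auto
    then have "exp s - exp t \<le> exp s * (s - t)"
      by (simp add: exp_diff algebra_simps)
    also have "\<dots> \<le> exp m * (s - t)" using that by (intro mult_right_mono) auto
    finally show ?thesis .
  qed
  show ?thesis
    using main[of t s] main[of s t] assms by (cases "t \<le> s") auto
qed

definition attention_exponent :: "('d::finite, 'k::finite) param \<Rightarrow> real^'d \<Rightarrow> real^'d \<Rightarrow> real" where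
  "attention_exponent = (\<lambda>(Q, K, V) x y. 1 / sqrt (real CARD('d)) * ((Q *v x) \<bullet> (K *v y)))"

lemma attention_weight_eq: "attention_weight \<theta> x y = exp (attention_exponent \<theta> x y)"
  by (simp add: attention_weight_def attention_exponent_def split: prod.split)

lemma attention_weight_pos: "attention_weight \<theta> x y > 0"
  by (simp add: attention_weight_eq)

lemma scaled_bilinear_le:
  fixes Q K :: "real^'d::finite^'k::finite"
  assumes "norm Q \<le> D" "norm K \<le> D"
  shows "\<bar>1 / sqrt (real CARD('d)) * ((Q *v x) \<bullet> (K *v y))\<bar> \<le> D\<^sup>2 * (norm x * norm y)"
proof -
  have "0 \<le> D" using assms(1) norm_ge_zero order_trans by blast
  have "\<bar>1 / sqrt (real CARD('d)) * ((Q *v x) \<bullet> (K *v y))\<bar> = 1 / sqrt (real CARD('d)) * \<bar>(Q *v x) \<bullet> (K *v y)\<bar>"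
    by (simp add: abs_mult)
  also have "\<dots> \<le> 1 * \<bar>(Q *v x) \<bullet> (K *v y)\<bar>"
  proof (rule mult_right_mono)
    have "1 \<le> real CARD('d)" by (simp add: Suc_leI)
    then show "1 / sqrt (real CARD('d)) \<le> 1" by (simp add: real_le_rsqrt)
  qed simp
  also have "\<dots> \<le> norm (Q *v x) * norm (K *v y)"
    using Cauchy_Schwarz_ineq2 by simp
  also have "\<dots> \<le> (norm Q * norm x) * (norm K * norm y)"
    by (intro mult_mono norm_matrix_vector_mult_le) auto
  also have "\<dots> \<le> (D * norm x) * (D * norm y)"
    using assms \<open>0 \<le> D\<close> by (intro mult_mono) auto
  finally show ?thesis by (simp add: power2_eq_square mult_ac)
qed

lemma param_norm_le:
  fixes Q K :: "real^'d::finite^'k::finite"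
  assumes "norm (Q, K, V) \<le> D"
  shows "norm Q \<le> D" "norm K \<le> D" "norm V \<le> D"
  using assms norm_fst_le[of Q "(K, V)"] norm_snd_le[of "(K, V)" Q] norm_fst_le[of K V] norm_snd_le[of V K]
  by linarith+

lemma attention_exponent_le:
  assumes "norm \<theta> \<le> D"
  shows "\<bar>attention_exponent \<theta> x y\<bar> \<le> D\<^sup>2 * (norm x * norm y)"
  using assms scaled_bilinear_le[OF param_norm_le(1,2)]
  by (auto simp: attention_exponent_def split: prod.split)

lemma attention_exponent_diff:
  "attention_exponent \<theta> x y - attention_exponent \<theta> x' y'
    = attention_exponent \<theta> (x - x') y + attention_exponent \<theta> x' (y - y')"
  by (auto simp: attention_exponent_def matrix_vector_mult_diff_distrib inner_diff_left inner_diff_right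
      diff_divide_distrib split: prod.split)

lemma attention_exponent_diff_le:
  assumes \<theta>: "norm \<theta> \<le> D" and "norm y \<le> R" "norm x' \<le> R"
  shows "\<bar>attention_exponent \<theta> x y - attention_exponent \<theta> x' y'\<bar> \<le> D\<^sup>2 * R * (norm (x - x') + norm (y - y'))"
proof -
  have "\<bar>attention_exponent \<theta> x y - attention_exponent \<theta> x' y'\<bar>
      \<le> \<bar>attention_exponent \<theta> (x - x') y\<bar> + \<bar>attention_exponent \<theta> x' (y - y')\<bar>"
    unfolding attention_exponent_diff by (rule abs_triangle_ineq)
  also have "\<dots> \<le> D\<^sup>2 * (norm (x - x') * norm y) + D\<^sup>2 * (norm x' * norm (y - y'))"
    by (intro add_mono attention_exponent_le \<theta>)
  also have "\<dots> \<le> D\<^sup>2 * (norm (x - x') * R) + D\<^sup>2 * (R * norm (y - y'))"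
    using assms by (intro add_mono mult_left_mono mult_right_mono) auto
  finally show ?thesis by (simp add: algebra_simps)
qed

lemma value_matrix_le:
  assumes "norm \<theta> \<le> D"
  shows "norm (value_matrix \<theta> *v y) \<le> D * norm y"
proof -
  obtain Q K V where \<theta>: "\<theta> = (Q, K, V)" by (cases \<theta>)
  have "norm V \<le> D" using param_norm_le(3) assms unfolding \<theta> .
  then show ?thesis
    using norm_matrix_vector_mult_le[of V y] mult_right_mono[of "norm V" D "norm y"]
    by (simp add: \<theta> value_matrix_def)
qed

lemma attention_continuous:
  "continuous_on UNIV (\<lambda>z. attention_weight (fst z :: ('d::finite, 'k::finite) param) x (snd z))"
  "continuous_on UNIV (\<lambda>z. value_matrix (fst z :: ('d::finite, 'k::finite) param) *v snd z)"
  by (auto simp: attention_weight_def value_matrix_def split_beta intro!: continuous_intros)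

lemma attention_measurable [measurable]:
  "(\<lambda>y. attention_weight \<theta> x y) \<in> borel_measurable borel"
  "(\<lambda>y. value_matrix \<theta> *v y) \<in> borel_measurable borel"
  by (intro borel_measurable_continuous_onI continuous_on_compose2[OF attention_continuous(1), of UNIV "\<lambda>y. (\<theta>, y)", simplified]
      continuous_on_compose2[OF attention_continuous(2), of UNIV "\<lambda>y. (\<theta>, y)", simplified] continuous_intros)+

context
  fixes \<mu> :: "(real^'d::finite) measure" and \<theta> :: "('d, 'k::finite) param" and R D :: real
  assumes conf: "confined \<mu> R" and \<theta>: "norm \<theta> \<le> D"
begin

lemma D_nonneg: "0 \<le> D"
  using \<theta> norm_ge_zero order_trans by blast

lemma confined_attention_weight:
  "AE y in \<mu>. attention_weight \<theta> x y \<le> exp (D\<^sup>2 * norm x * R) \<and> exp (- (D\<^sup>2 * norm x * R)) \<le> attention_weight \<theta> x y"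
proof -
  have "AE y in \<mu>. norm y \<le> R" using conf by (simp add: confined_def)
  then show ?thesis
  proof eventually_elim
    case (elim y)
    have "\<bar>attention_exponent \<theta> x y\<bar> \<le> D\<^sup>2 * (norm x * norm y)"
      by (rule attention_exponent_le[OF \<theta>])
    also have "\<dots> \<le> D\<^sup>2 * (norm x * R)" using elim by (intro mult_left_mono) auto
    finally show ?case by (auto simp: attention_weight_eq mult.assoc)
  qed
qed

lemma confined_value: "AE y in \<mu>. norm (value_matrix \<theta> *v y) \<le> D * R"
proof -
  have "AE y in \<mu>. norm y \<le> R" using conf by (simp add: confined_def)
  then show ?thesis
    by eventually_elim (rule order_trans[OF value_matrix_le[OF \<theta>] mult_left_mono[OF _ D_nonneg]])
qed

text \<open>On the ball the weights lie between two positive constants depending on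
  \<open>x\<close>. The last bound weighs the estimate \<open>D * R\<close> of the values by the
  same weights as the normalisation, so that those constants cancel in the quotient.\<close>

lemma confined_integrable:
  "integrable \<mu> (attention_weight \<theta> x)"
  "integrable \<mu> (\<lambda>y. attention_weight \<theta> x y *\<^sub>R (value_matrix \<theta> *v y))"
  "(\<integral>y. attention_weight \<theta> x y \<partial>\<mu>) \<ge> exp (- (D\<^sup>2 * norm x * R))"
  "norm (\<integral>y. attention_weight \<theta> x y *\<^sub>R (value_matrix \<theta> *v y) \<partial>\<mu>) \<le> D * R * (\<integral>y. attention_weight \<theta> x y \<partial>\<mu>)"
proof -
  interpret prob_space \<mu> using conf by (simp add: confined_def)
  have [measurable_cong]: "sets \<mu> = sets borel" using conf by (simp add: confined_def)
  show i1: "integrable \<mu> (attention_weight \<theta> x)"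
    by (rule integrable_const_bound[of _ "exp (D\<^sup>2 * norm x * R)"])
      (use confined_attention_weight[of x] in \<open>auto elim!: eventually_mono simp: abs_of_pos[OF attention_weight_pos]\<close>)
  show i2: "integrable \<mu> (\<lambda>y. attention_weight \<theta> x y *\<^sub>R (value_matrix \<theta> *v y))"
  proof (rule Bochner_Integration.integrable_bound[of _ "\<lambda>y. (D * R) * attention_weight \<theta> x y"])
    show "AE y in \<mu>. norm (attention_weight \<theta> x y *\<^sub>R (value_matrix \<theta> *v y)) \<le> norm (D * R * attention_weight \<theta> x y)"
      using confined_value
    proof eventually_elim
      case (elim y)
      then have "norm (attention_weight \<theta> x y *\<^sub>R (value_matrix \<theta> *v y)) \<le> attention_weight \<theta> x y * (D * R)"
        using attention_weight_pos[of \<theta> x y] by (simp add: mult_left_mono)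
      then show ?case by (simp add: mult.commute)
    qed
  qed (use i1 in auto)
  have "(\<integral>y. exp (- (D\<^sup>2 * norm x * R)) \<partial>\<mu>) \<le> (\<integral>y. attention_weight \<theta> x y \<partial>\<mu>)"
    by (rule integral_mono_AE[OF _ i1]) (use confined_attention_weight[of x] in \<open>auto elim!: eventually_mono\<close>)
  then show "(\<integral>y. attention_weight \<theta> x y \<partial>\<mu>) \<ge> exp (- (D\<^sup>2 * norm x * R))"
    by (simp add: prob_space)
  have "norm (\<integral>y. attention_weight \<theta> x y *\<^sub>R (value_matrix \<theta> *v y) \<partial>\<mu>) \<le> (\<integral>y. D * R * attention_weight \<theta> x y \<partial>\<mu>)"
  proof (rule integral_norm_bound_AE[OF i2])
    show "AE y in \<mu>. norm (attention_weight \<theta> x y *\<^sub>R (value_matrix \<theta> *v y)) \<le> D * R * attention_weight \<theta> x y"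
      using confined_value
    proof eventually_elim
      case (elim y)
      show ?case
        using elim attention_weight_pos[of \<theta> x y] by (simp add: mult.commute[of "D * R"] mult_left_mono)
    qed
  qed (use i1 in simp)
  then show "norm (\<integral>y. attention_weight \<theta> x y *\<^sub>R (value_matrix \<theta> *v y) \<partial>\<mu>) \<le> D * R * (\<integral>y. attention_weight \<theta> x y \<partial>\<mu>)"
    using i1 by simp
qed

end

lemma attention_eq:
  "attention x \<mu> \<theta> = (1 / (\<integral>y. attention_weight \<theta> x y \<partial>\<mu>)) *\<^sub>R
     (\<integral>y. attention_weight \<theta> x y *\<^sub>R (value_matrix \<theta> *v y) \<partial>\<mu>)"
proof -
  have "attention_kernel \<theta> \<mu> x y *\<^sub>R (value_matrix \<theta> *v y) = (1 / (\<integral>y. attention_weight \<theta> x y \<partial>\<mu>)) *\<^sub>R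
     (attention_weight \<theta> x y *\<^sub>R (value_matrix \<theta> *v y))" for y
    by (simp add: attention_kernel_def)
  then show ?thesis by (simp only: attention_def integral_scaleR_right)
qed

text \<open>Attention is a weighted mean of vectors \<open>V y\<close> of norm at most
  \<open>D * R\<close>. That the bound does not depend on \<open>x\<close> is the source of the
  linear growth of the velocity.\<close>

lemma attention_norm_le:
  assumes "confined \<mu> R" "norm \<theta> \<le> D"
  shows "norm (attention x \<mu> \<theta>) \<le> D * R"
proof -
  have "0 < (\<integral>y. attention_weight \<theta> x y \<partial>\<mu>)"
    using confined_integrable(3)[OF assms, of x] exp_gt_zero order_less_le_trans by blast
  then show ?thesis
    using confined_integrable(4)[OF assms, of x] by (simp add: attention_eq field_simps)
qed

text \<open>With \<open>E = exp (D^2 R^2)\<close>, one factor \<open>E\<close> bounds the weights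
  and the other the inverse of the normalisation. The numerator contributes
  \<open>D^3 R^2 + D\<close>, and the normalisation \<open>D^2 R\<close> times the bound
  \<open>D R\<close> of the mean.\<close>

definition attention_lipschitz_const :: "real \<Rightarrow> real \<Rightarrow> real" where
  "attention_lipschitz_const D R = (exp (D\<^sup>2 * R\<^sup>2))\<^sup>2 * (2 * D ^ 3 * R\<^sup>2 + D)"

text \<open>The difference equals \<open>1 / Z\<close> times
  \<open>(N - N') + ((Z' - Z) / Z') N'\<close>. The bound on \<open>N'\<close> cancels the second
  denominator, so only one lower bound on a normalisation enters the Lipschitz constant.\<close>

lemma quotient_diff_le:
  fixes N N' :: "'a::real_normed_vector"
  assumes "0 < Z" "0 < Z'" "norm N' \<le> c * Z'"
  shows "norm ((1 / Z) *\<^sub>R N - (1 / Z') *\<^sub>R N') \<le> (1 / Z) * (norm (N - N') + c * \<bar>Z - Z'\<bar>)"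
proof -
  have "(1 / Z) *\<^sub>R N - (1 / Z') *\<^sub>R N' = (1 / Z) *\<^sub>R ((N - N') + ((Z' - Z) / Z') *\<^sub>R N')"
    using assms by (simp add: algebra_simps diff_divide_distrib)
  also have "norm \<dots> \<le> (1 / Z) * (norm (N - N') + \<bar>Z - Z'\<bar> / Z' * norm N')"
    using assms norm_triangle_ineq[of "N - N'" "((Z' - Z) / Z') *\<^sub>R N'"]
    by (simp add: divide_right_mono abs_minus_commute)
  also have "\<dots> \<le> (1 / Z) * (norm (N - N') + c * \<bar>Z - Z'\<bar>)"
  proof -
    have "\<bar>Z - Z'\<bar> / Z' * norm N' \<le> \<bar>Z - Z'\<bar> / Z' * (c * Z')"
      using assms by (intro mult_left_mono) auto
    also have "\<dots> = c * \<bar>Z - Z'\<bar>" using assms by simp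
    finally show ?thesis using assms by (intro mult_left_mono add_left_mono) auto
  qed
  finally show ?thesis .
qed

text \<open>All four integrals are moved to the coupling, where numerators and normalisations are
  compared at paired points of the ball. This yields the first-order transport cost, which is at
  most the quadratic one.\<close>

lemma attention_lipschitz:
  assumes \<mu>: "confined \<mu> R" and \<mu>': "confined \<mu>' R" and \<gamma>: "\<gamma> \<in> couplings \<mu> \<mu>'"
    and \<theta>: "norm \<theta> \<le> D" and x: "norm x \<le> R" "norm x' \<le> R"
    and int: "integrable \<gamma> (\<lambda>(y, y'). dist y y')"
  shows "norm (attention x \<mu> \<theta> - attention x' \<mu>' \<theta>)
    \<le> attention_lipschitz_const D R * (norm (x - x') + (\<integral>(y, y'). dist y y' \<partial>\<gamma>))"
proof -
  interpret prob_space \<gamma> using \<gamma> by (simp add: couplings_def)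
  have [measurable_cong]: "sets \<gamma> = sets (borel \<Otimes>\<^sub>M borel)"
    and d: "distr \<gamma> borel fst = \<mu>" "distr \<gamma> borel snd = \<mu>'"
    using \<gamma> by (auto simp: couplings_def)
  define E where "E = exp (D\<^sup>2 * R\<^sup>2)"
  have D: "0 \<le> D" by (rule D_nonneg[OF \<mu> \<theta>])
  have R: "0 \<le> R" by (rule confined_radius_nonneg[OF \<mu>])
  have E: "E \<ge> 1" unfolding E_def by simp
  have int': "integrable \<gamma> (\<lambda>z. dist (fst z) (snd z))"
    using int by (simp add: case_prod_unfold)
  define I where "I = (\<integral>z. dist (fst z) (snd z) \<partial>\<gamma>)"
  let ?a = "\<lambda>z. attention_weight \<theta> x (fst z)" and ?a' = "\<lambda>z. attention_weight \<theta> x' (snd z)"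
  let ?v = "\<lambda>z. value_matrix \<theta> *v fst z" and ?v' = "\<lambda>z. value_matrix \<theta> *v snd z"
  have ae: "AE z in \<gamma>. norm (fst z) \<le> R \<and> norm (snd z) \<le> R"
  proof -
    have "AE y in distr \<gamma> borel fst. norm y \<le> R" "AE y in distr \<gamma> borel snd. norm y \<le> R"
      using \<mu> \<mu>' unfolding d confined_def by simp_all
    then have "AE z in \<gamma>. norm (fst z) \<le> R" "AE z in \<gamma>. norm (snd z) \<le> R"
      by (simp_all add: AE_distr_iff)
    then show ?thesis by eventually_elim simp
  qed
  let ?Z = "\<integral>y. attention_weight \<theta> x y \<partial>\<mu>" and ?Z' = "\<integral>y. attention_weight \<theta> x' y \<partial>\<mu>'"
  let ?N = "\<integral>y. attention_weight \<theta> x y *\<^sub>R (value_matrix \<theta> *v y) \<partial>\<mu>"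
  let ?N' = "\<integral>y. attention_weight \<theta> x' y *\<^sub>R (value_matrix \<theta> *v y) \<partial>\<mu>'"
  have Z: "?Z = (\<integral>z. ?a z \<partial>\<gamma>)" "?N = (\<integral>z. ?a z *\<^sub>R ?v z \<partial>\<gamma>)"
    "?Z' = (\<integral>z. ?a' z \<partial>\<gamma>)" "?N' = (\<integral>z. ?a' z *\<^sub>R ?v' z \<partial>\<gamma>)"
    unfolding d[symmetric] by (simp_all add: integral_distr)
  have i: "integrable \<gamma> ?a" "integrable \<gamma> (\<lambda>z. ?a z *\<^sub>R ?v z)" "integrable \<gamma> ?a'" "integrable \<gamma> (\<lambda>z. ?a' z *\<^sub>R ?v' z)"
    using confined_integrable(1,2)[OF \<mu> \<theta>, of x, folded d] confined_integrable(1,2)[OF \<mu>' \<theta>, of x', folded d]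
    by (simp_all add: integrable_distr_eq)
  have pt: "\<bar>?a z - ?a' z\<bar> \<le> E * (D\<^sup>2 * R) * (norm (x - x') + dist (fst z) (snd z)) \<and>
     norm (?a z *\<^sub>R ?v z - ?a' z *\<^sub>R ?v' z) \<le> E * (D ^ 3 * R\<^sup>2 + D) * (norm (x - x') + dist (fst z) (snd z))"
    if z: "norm (fst z) \<le> R \<and> norm (snd z) \<le> R" for z
  proof -
    let ?\<delta> = "norm (x - x') + dist (fst z) (snd z)"
    have s: "\<bar>attention_exponent \<theta> x (fst z)\<bar> \<le> D\<^sup>2 * R\<^sup>2" "\<bar>attention_exponent \<theta> x' (snd z)\<bar> \<le> D\<^sup>2 * R\<^sup>2"
      using x z R unfolding power2_eq_square[of R]
      by (auto intro!: order_trans[OF attention_exponent_le[OF \<theta>]] mult_left_mono mult_mono)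
    have "\<bar>?a z - ?a' z\<bar> \<le> E * \<bar>attention_exponent \<theta> x (fst z) - attention_exponent \<theta> x' (snd z)\<bar>"
      unfolding attention_weight_eq E_def using s by (intro exp_diff_le) auto
    also have "\<dots> \<le> E * (D\<^sup>2 * R * ?\<delta>)"
      using attention_exponent_diff_le[OF \<theta>, of "fst z" R x' x "snd z"] z x E
      by (intro mult_left_mono) (auto simp: dist_norm)
    finally have 1: "\<bar>?a z - ?a' z\<bar> \<le> E * (D\<^sup>2 * R) * ?\<delta>" by (simp add: mult_ac)
    have a': "0 < ?a' z" "?a' z \<le> E" using s by (auto simp: attention_weight_eq E_def)
    have v: "norm (?v z) \<le> D * R"
      using value_matrix_le[OF \<theta>, of "fst z"] mult_left_mono[of "norm (fst z)" R D] z D by linarith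
    have vv: "norm (?v z - ?v' z) \<le> D * dist (fst z) (snd z)"
      using value_matrix_le[OF \<theta>, of "fst z - snd z"] by (simp add: matrix_vector_mult_diff_distrib dist_norm)
    have "norm (?a z *\<^sub>R ?v z - ?a' z *\<^sub>R ?v' z) = norm ((?a z - ?a' z) *\<^sub>R ?v z + ?a' z *\<^sub>R (?v z - ?v' z))"
      by (simp add: algebra_simps)
    also have "\<dots> \<le> \<bar>?a z - ?a' z\<bar> * norm (?v z) + ?a' z * norm (?v z - ?v' z)"
      using norm_triangle_ineq[of "(?a z - ?a' z) *\<^sub>R ?v z" "?a' z *\<^sub>R (?v z - ?v' z)"] a' by simp
    also have "\<dots> \<le> (E * (D\<^sup>2 * R) * ?\<delta>) * (D * R) + E * (D * dist (fst z) (snd z))"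
      using 1 v vv a' E R by (intro add_mono mult_mono) auto
    also have "\<dots> \<le> (E * (D\<^sup>2 * R) * ?\<delta>) * (D * R) + E * (D * ?\<delta>)"
      using E D by (intro add_left_mono mult_left_mono) auto
    also have "\<dots> = E * (D ^ 3 * R\<^sup>2 + D) * ?\<delta>"
      by (simp add: algebra_simps power2_eq_square power3_eq_cube)
    finally show ?thesis using 1 by simp
  qed
  have ptZ: "AE z in \<gamma>. norm (?a z - ?a' z) \<le> E * (D\<^sup>2 * R) * (norm (x - x') + dist (fst z) (snd z))"
    using ae by eventually_elim (use pt in \<open>unfold real_norm_def, blast\<close>)
  have ptN: "AE z in \<gamma>. norm (?a z *\<^sub>R ?v z - ?a' z *\<^sub>R ?v' z)
      \<le> E * (D ^ 3 * R\<^sup>2 + D) * (norm (x - x') + dist (fst z) (snd z))"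
    using ae by eventually_elim (use pt in blast)
  have bound: "(\<integral>z. c * (norm (x - x') + dist (fst z) (snd z)) \<partial>\<gamma>) = c * (norm (x - x') + I)" for c
    using int' by (simp add: I_def prob_space)
  have Zd: "\<bar>?Z - ?Z'\<bar> \<le> E * (D\<^sup>2 * R) * (norm (x - x') + I)"
  proof -
    have "?Z - ?Z' = (\<integral>z. ?a z - ?a' z \<partial>\<gamma>)" unfolding Z using i by simp
    moreover have "norm (\<integral>z. ?a z - ?a' z \<partial>\<gamma>) \<le> (\<integral>z. E * (D\<^sup>2 * R) * (norm (x - x') + dist (fst z) (snd z)) \<partial>\<gamma>)"
      by (rule integral_norm_bound_AE[OF _ _ ptZ]) (use i int' in simp_all)
    ultimately show ?thesis unfolding bound by simp
  qed
  have Nd: "norm (?N - ?N') \<le> E * (D ^ 3 * R\<^sup>2 + D) * (norm (x - x') + I)"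
  proof -
    have "?N - ?N' = (\<integral>z. ?a z *\<^sub>R ?v z - ?a' z *\<^sub>R ?v' z \<partial>\<gamma>)" unfolding Z using i by simp
    moreover have "norm (\<integral>z. ?a z *\<^sub>R ?v z - ?a' z *\<^sub>R ?v' z \<partial>\<gamma>)
       \<le> (\<integral>z. E * (D ^ 3 * R\<^sup>2 + D) * (norm (x - x') + dist (fst z) (snd z)) \<partial>\<gamma>)"
      by (rule integral_norm_bound_AE[OF _ _ ptN]) (use i int' in simp_all)
    ultimately show ?thesis unfolding bound by simp
  qed
  \<comment> \<open>For \<open>norm x <= R\<close> every exponent is at least
    \<open>- D^2 R^2\<close>, and \<open>\<mu>\<close> has mass 1.\<close>
  have Zlow: "1 / E \<le> ?Z"
  proof -
    have "exp (- (D\<^sup>2 * R\<^sup>2)) \<le> exp (- (D\<^sup>2 * norm x * R))"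
      using x R by (simp add: power2_eq_square[of R] mult.assoc mult_left_mono mult_right_mono)
    from order_trans[OF this confined_integrable(3)[OF \<mu> \<theta>, of x]] show ?thesis
      by (simp add: E_def exp_minus divide_inverse)
  qed
  have Z0: "0 < ?Z" using Zlow E order_less_le_trans[of 0 "1 / E" ?Z] by simp
  have Z0': "0 < ?Z'"
    using confined_integrable(3)[OF \<mu>' \<theta>, of x'] exp_gt_zero order_less_le_trans by blast
  have I0: "0 \<le> I" unfolding I_def by (rule Bochner_Integration.integral_nonneg) simp
  have ZE: "1 / ?Z \<le> E" using Zlow Z0 E by (simp add: field_simps)
  have "norm (attention x \<mu> \<theta> - attention x' \<mu>' \<theta>) \<le> (1 / ?Z) * (norm (?N - ?N') + (D * R) * \<bar>?Z - ?Z'\<bar>)"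
    unfolding attention_eq by (rule quotient_diff_le[OF Z0 Z0' confined_integrable(4)[OF \<mu>' \<theta>]])
  also have "\<dots> \<le> E * (E * (D ^ 3 * R\<^sup>2 + D) * (norm (x - x') + I) + (D * R) * (E * (D\<^sup>2 * R) * (norm (x - x') + I)))"
    using ZE Nd Zd D R E by (intro mult_mono add_mono) auto
  also have "\<dots> = attention_lipschitz_const D R * (norm (x - x') + I)"
    unfolding attention_lipschitz_const_def E_def[symmetric]
    by (simp add: algebra_simps power2_eq_square power3_eq_cube)
  finally show ?thesis by (simp add: I_def case_prod_unfold)
qed

text \<open>\<open>D^2 * L\<close> is the Lipschitz constant of a perceptron whose two matrices have
  operator norm at most \<open>D\<close> and whose activation is \<open>L\<close>-Lipschitz.\<close>

locale transformer_field =
  fixes \<Theta> :: "('d::finite, 'k::finite) param set" and D L :: real and F :: "real^'d \<Rightarrow> real^'d"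
    and \<rho> :: "('d, 'k) param measure"
  assumes D_bound: "\<And>\<theta>. \<theta> \<in> \<Theta> \<Longrightarrow> norm \<theta> \<le> D"
    and \<rho>: "\<rho> \<in> prob_measures_on \<Theta>"
    and L_nonneg: "0 \<le> L"
    and F_lipschitz: "\<And>x y. norm (F x - F y) \<le> D\<^sup>2 * L * norm (x - y)"
begin

lemma prob_\<rho>: "prob_space \<rho>" and sets_\<rho>: "sets \<rho> = sets (restrict_space borel \<Theta>)"
  using \<rho> by (auto simp: prob_measures_on_def)

lemma space_\<rho>: "space \<rho> = \<Theta>"
  using sets_eq_imp_space_eq[OF sets_\<rho>] by (simp add: space_restrict_space)

lemma D_ge_0: "0 \<le> D"
proof -
  have "space \<rho> \<noteq> {}" using prob_\<rho> by (rule prob_space.not_empty)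
  then show ?thesis using D_bound norm_ge_zero order_trans unfolding space_\<rho> by blast
qed

lemma F_norm_le: "norm (F x) \<le> norm (F 0) + D\<^sup>2 * L * norm x"
  using F_lipschitz[of x 0] norm_triangle_sub[of "F x" "F 0"] by simp

text \<open>Numerator and normalisation are parameter integrals of functions that are jointly
  continuous in \<open>(\<theta>, y)\<close>. As \<open>\<rho>\<close> lives on the subspace
  \<open>\<Theta>\<close>, measurability passes through the inclusion into the full parameter
  space.\<close>

lemma attention_measurable_param:
  assumes \<mu>: "confined \<mu> R"
  shows "attention x \<mu> \<in> borel_measurable \<rho>"
proof -
  interpret prob_space \<mu> using \<mu> by (simp add: confined_def)
  have "sets \<mu> = sets borel" using \<mu> by (simp add: confined_def)
  have id1: "(\<lambda>\<theta>. \<theta>) \<in> measurable \<rho> borel"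
    unfolding measurable_cong_sets[OF sets_\<rho> refl] by (rule measurable_restrict_space1) simp
  have id2: "(\<lambda>y. y) \<in> measurable \<mu> borel"
    unfolding measurable_cong_sets[OF \<open>sets \<mu> = sets borel\<close> refl] by simp
  have pair: "(\<lambda>z. (fst z, snd z)) \<in> measurable (\<rho> \<Otimes>\<^sub>M \<mu>) borel"
    using measurable_Pair[OF measurable_compose[OF measurable_fst id1] measurable_compose[OF measurable_snd id2]]
    by (simp only: borel_prod)
  have w: "(\<lambda>z. attention_weight (fst z) x (snd z)) \<in> borel_measurable (\<rho> \<Otimes>\<^sub>M \<mu>)"
    using measurable_compose[OF pair borel_measurable_continuous_onI[OF attention_continuous(1)]] by simp
  have v: "(\<lambda>z. value_matrix (fst z) *v snd z) \<in> borel_measurable (\<rho> \<Otimes>\<^sub>M \<mu>)"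
    using measurable_compose[OF pair borel_measurable_continuous_onI[OF attention_continuous(2)]] by simp
  have "(\<lambda>\<theta>. \<integral>y. attention_weight \<theta> x y \<partial>\<mu>) \<in> borel_measurable \<rho>"
    "(\<lambda>\<theta>. \<integral>y. attention_weight \<theta> x y *\<^sub>R (value_matrix \<theta> *v y) \<partial>\<mu>) \<in> borel_measurable \<rho>"
    using w borel_measurable_scaleR[OF w v]
    by (auto intro!: borel_measurable_lebesgue_integral simp: case_prod_unfold)
  then show ?thesis unfolding attention_eq[abs_def] by measurable
qed

lemma attention_integrable:
  assumes \<mu>: "confined \<mu> R"
  shows "integrable \<rho> (attention x \<mu>)"
proof -
  interpret prob_space \<rho> by (rule prob_\<rho>)
  show ?thesis
    by (rule integrable_const_bound[of _ "D * R"])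
      (use attention_norm_le[OF \<mu> D_bound] space_\<rho> attention_measurable_param[OF \<mu>] in auto)
qed

lemma confined_attention_field_defined:
  assumes \<mu>: "confined \<mu> R"
  shows "attention_field_defined \<rho> \<mu>"
  unfolding attention_field_defined_def
proof (intro allI conjI ballI)
  fix x \<theta> assume "\<theta> \<in> space \<rho>"
  then have \<theta>: "norm \<theta> \<le> D" using D_bound space_\<rho> by simp
  show "integrable \<mu> (attention_weight \<theta> x)" by (rule confined_integrable(1)[OF \<mu> \<theta>])
  show "integrable \<mu> (\<lambda>y. attention_kernel \<theta> \<mu> x y *\<^sub>R (value_matrix \<theta> *v y))"
    using integrable_scaleR_right[OF confined_integrable(2)[OF \<mu> \<theta>, of x], of "1 / (\<integral>y. attention_weight \<theta> x y \<partial>\<mu>)"]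
    by (simp add: attention_kernel_def)
qed (rule attention_integrable[OF \<mu>])

lemma attention_field_norm_le:
  assumes \<mu>: "confined \<mu> R"
  shows "norm (attention_field \<rho> \<mu> x) \<le> D * R"
proof -
  interpret prob_space \<rho> by (rule prob_\<rho>)
  have "norm (attention_field \<rho> \<mu> x) \<le> (\<integral>\<theta>. D * R \<partial>\<rho>)"
    unfolding attention_field_def
    by (rule integral_norm_bound_AE[OF attention_integrable[OF \<mu>]])
      (use attention_norm_le[OF \<mu> D_bound] space_\<rho> in auto)
  then show ?thesis by (simp add: prob_space)
qed

lemma velocity_norm_le:
  assumes \<mu>: "confined \<mu> R"
  shows "norm (velocity \<rho> F \<mu> x) \<le> D * R + norm (F 0) + D\<^sup>2 * L * norm x"
  using attention_field_norm_le[OF \<mu>, of x] F_norm_le[of x]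
    norm_triangle_ineq[of "attention_field \<rho> \<mu> x" "F x"]
  by (simp add: velocity_def)

definition Lip :: "real \<Rightarrow> real" where
  "Lip R = attention_lipschitz_const D R + D\<^sup>2 * L"

lemma Lip_nonneg: "0 \<le> Lip R"
  using D_ge_0 L_nonneg by (simp add: Lip_def attention_lipschitz_const_def)

text \<open>The estimate for one parameter is uniform over \<open>\<Theta>\<close>, so averaging
  against the probability measure \<open>\<rho>\<close> preserves its constant.\<close>

lemma velocity_lipschitz:
  assumes \<mu>: "confined \<mu> R" and \<mu>': "confined \<mu>' R" and \<gamma>: "\<gamma> \<in> couplings \<mu> \<mu>'"
    and x: "norm x \<le> R" "norm x' \<le> R"
    and int: "integrable \<gamma> (\<lambda>(y, y'). dist y y')"
  shows "norm (velocity \<rho> F \<mu> x - velocity \<rho> F \<mu>' x')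
    \<le> Lip R * (norm (x - x') + (\<integral>(y, y'). dist y y' \<partial>\<gamma>))"
proof -
  interpret prob_space \<rho> by (rule prob_\<rho>)
  let ?I = "\<integral>(y, y'). dist y y' \<partial>\<gamma>"
  have I: "0 \<le> ?I" by (rule Bochner_Integration.integral_nonneg) auto
  have "norm (attention_field \<rho> \<mu> x - attention_field \<rho> \<mu>' x') = norm (\<integral>\<theta>. attention x \<mu> \<theta> - attention x' \<mu>' \<theta> \<partial>\<rho>)"
    unfolding attention_field_def using attention_integrable[OF \<mu>] attention_integrable[OF \<mu>'] by simp
  also have "\<dots> \<le> (\<integral>\<theta>. attention_lipschitz_const D R * (norm (x - x') + ?I) \<partial>\<rho>)"
    by (rule integral_norm_bound_AE)
      (use attention_integrable[OF \<mu>] attention_integrable[OF \<mu>'] attention_lipschitz[OF \<mu> \<mu>' \<gamma> D_bound x int] space_\<rho> in auto)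
  also have "\<dots> = attention_lipschitz_const D R * (norm (x - x') + ?I)" by (simp add: prob_space)
  finally have 1: "norm (attention_field \<rho> \<mu> x - attention_field \<rho> \<mu>' x') \<le> attention_lipschitz_const D R * (norm (x - x') + ?I)" .
  have "norm (F x - F x') \<le> D\<^sup>2 * L * (norm (x - x') + ?I)"
    using F_lipschitz[of x x'] mult_left_mono[of "norm (x - x')" "norm (x - x') + ?I" "D\<^sup>2 * L"] I L_nonneg by auto
  then show ?thesis
    using 1 norm_triangle_ineq[of "attention_field \<rho> \<mu> x - attention_field \<rho> \<mu>' x'" "F x - F x'"]
    by (simp add: velocity_def Lip_def algebra_simps)
qed

end

section \<open>Confinement\<close>

lemma smooth_norm_squared:
  fixes u :: "'a::euclidean_space \<Rightarrow> 'b::euclidean_space"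
  assumes "\<And>i. i \<in> Basis \<Longrightarrow> smooth (\<lambda>z. u z \<bullet> i)"
  shows "smooth (\<lambda>z. (norm (u z))\<^sup>2)"
proof -
  have "(norm (u z))\<^sup>2 = (\<Sum>i\<in>Basis. (u z \<bullet> i) ^ 2)" for z
    unfolding power2_norm_eq_inner by (subst euclidean_inner) (simp add: power2_eq_square)
  then show ?thesis
    using smooth_sum[OF smooth_power[OF assms]] by simp
qed

lemma has_derivative_step_compose:
  assumes S: "\<And>x. (S has_real_derivative S' x) (at x)" and f: "(f has_derivative f') (at z)"
  shows "((\<lambda>z. S (f z)) has_derivative (\<lambda>v. S' (f z) * f' v)) (at z)"
  using has_derivative_compose[OF f, of S "\<lambda>v. S' (f z) * v"] S[of "f z"]
  by (simp add: has_field_derivative_def)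

lemma has_derivative_fst_compose:
  fixes k :: "real \<Rightarrow> 'b::real_normed_vector"
  assumes "(k has_vector_derivative k') (at t)"
  shows "((\<lambda>z. k (fst z)) has_derivative (\<lambda>v. fst v *\<^sub>R k')) (at (t, x))"
  by (rule has_derivative_compose[where g = k, OF bounded_linear_imp_has_derivative[OF bounded_linear_fst]])
    (use assms in \<open>simp add: has_vector_derivative_def\<close>)

lemma AE_eq_1_of_integral_ge_1:
  fixes f :: "'a \<Rightarrow> real"
  assumes "prob_space M" "integrable M f" "\<And>x. f x \<le> 1" "1 \<le> (\<integral>x. f x \<partial>M)"
  shows "AE x in M. f x = 1"
proof -
  interpret prob_space M by fact
  have "(\<integral>x. 1 - f x \<partial>M) = 1 - (\<integral>x. f x \<partial>M)"
    using assms(2) by (simp add: prob_space)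
  moreover have "0 \<le> (\<integral>x. 1 - f x \<partial>M)"
    using assms(3) by (intro integral_nonneg_AE) simp
  ultimately have "(\<integral>x. 1 - f x \<partial>M) = 0" using assms(4) by simp
  then have "AE x in M. 1 - f x = 0"
    using assms(2,3) by (subst (asm) integral_nonneg_eq_0_iff_AE) auto
  then show ?thesis by eventually_elim simp
qed

section \<open>Radial barriers and growth of the support\<close>

context transformer_field
begin

lemma weak_solution_prob:
  assumes "weak_solution T \<rho> F \<mu>\<^sub>0 \<mu>" "t \<in> {0..T}"
  shows "\<mu> t \<in> P2" "prob_space (\<mu> t)" "sets (\<mu> t) = sets borel"
  using assms by (auto simp: weak_solution_def P2_continuous_curve_def P2_def)

text \<open>The barrier \<open>S (1 - (|x|^2 - k) / \<epsilon>)\<close> is 1 for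
  \<open>|x|^2 <= k\<close> and 0 for \<open>|x|^2 >= k + \<epsilon>\<close>, and its derivative
  lives in the shell between; \<open>outward\<close> says that no mass in the shell outruns
  \<open>k\<close>. The integral starts at 1 and cannot decrease, so the barrier is 1 almost
  everywhere at the end. Squared radii keep it smooth at the origin.\<close>

lemma radial_barrier:
  assumes w: "weak_solution T \<rho> F \<mu>\<^sub>0 \<mu>" and st: "0 \<le> s" "s \<le> t" "t \<le> T"
    and k: "smooth k" "\<And>\<tau>. (k has_real_derivative k' \<tau>) (at \<tau>)" and \<epsilon>: "\<epsilon> > 0"
    and outward: "\<And>\<tau>. s \<le> \<tau> \<Longrightarrow> \<tau> \<le> t \<Longrightarrow> AE x in \<mu> \<tau>. k \<tau> \<le> (norm x)\<^sup>2 \<longrightarrow> (norm x)\<^sup>2 \<le> k \<tau> + \<epsilon> \<longrightarrow>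
       2 * (x \<bullet> velocity \<rho> F (\<mu> \<tau>) x) \<le> k' \<tau>"
    and start: "AE x in \<mu> s. (norm x)\<^sup>2 \<le> k s"
  shows "AE x in \<mu> t. (norm x)\<^sup>2 \<le> k t + \<epsilon>"
proof -
  obtain S S' :: "real \<Rightarrow> real" where S: "smooth S" "\<And>x. (S has_real_derivative S' x) (at x)"
    "\<And>x. S' x \<ge> 0" "\<And>x. x \<le> 0 \<Longrightarrow> S x = 0" "\<And>x. x \<ge> 1 \<Longrightarrow> S x = 1"
    "\<And>x. x \<le> 0 \<Longrightarrow> S' x = 0" "\<And>x. x \<ge> 1 \<Longrightarrow> S' x = 0" "\<And>x. 0 \<le> S x" "\<And>x. S x \<le> 1"
    by (rule smooth_step_exists, rule that; assumption)
  define q where "q z = 1 - ((norm (snd z))\<^sup>2 - k (fst z)) / \<epsilon>" for z :: "real \<times> (real^'d)"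
  define f where "f z = S (q z)" for z
  have sn: "smooth (\<lambda>z::real \<times> (real^'d). (norm (snd z))\<^sup>2)"
    by (intro smooth_norm_squared smooth_bounded_linear bounded_linear_compose[OF bounded_linear_inner_left bounded_linear_snd])
  have "smooth q"
    unfolding q_def[abs_def]
    by (intro smooth_diff smooth_const smooth_divide_const sn smooth_compose[OF k(1) smooth_fst])
  then have f: "smooth f" unfolding f_def[abs_def] by (rule smooth_compose[OF S(1)])
  have D: "frechet_derivative f (at (\<tau>, x)) (1, v) = S' (q (\<tau>, x)) * (- (2 * (x \<bullet> v) - k' \<tau>) / \<epsilon>)" for \<tau> x v
  proof -
    have d1: "((\<lambda>z::real \<times> (real^'d). (norm (snd z))\<^sup>2) has_derivative (\<lambda>v. x \<bullet> snd v + snd v \<bullet> x)) (at (\<tau>, x))"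
      using has_derivative_inner[OF bounded_linear_imp_has_derivative[OF bounded_linear_snd]
          bounded_linear_imp_has_derivative[OF bounded_linear_snd], of "(\<tau>, x)" UNIV]
      by (simp add: power2_norm_eq_inner)
    have d2: "((\<lambda>z::real \<times> (real^'d). k (fst z)) has_derivative (\<lambda>v. fst v *\<^sub>R k' \<tau>)) (at (\<tau>, x))"
      using k(2)[of \<tau>] by (intro has_derivative_fst_compose) (simp add: has_real_derivative_iff_has_vector_derivative)
    have "(q has_derivative (\<lambda>v. 0 - (x \<bullet> snd v + snd v \<bullet> x - fst v *\<^sub>R k' \<tau>) * inverse \<epsilon>)) (at (\<tau>, x))"
      unfolding q_def[abs_def] divide_inverse
      by (intro has_derivative_diff has_derivative_const has_derivative_mult_left d1 d2)
    from frechet_derivative_at[OF has_derivative_step_compose[OF S(2) this], symmetric]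
    show ?thesis
      unfolding f_def[abs_def] by (simp add: inner_commute divide_inverse algebra_simps)
  qed
  have "continuous_on {- 1..T + 1} k" by (rule smooth_continuous_on[OF k(1)])
  then have "compact (k ` {- 1..T + 1})" by (rule compact_continuous_image) simp
  then have "bounded (k ` {- 1..T + 1})" by (rule compact_imp_bounded)
  then obtain B where B: "\<And>\<tau>. \<tau> \<in> {- 1..T + 1} \<Longrightarrow> \<bar>k \<tau>\<bar> \<le> B"
    unfolding bounded_iff real_norm_def by blast
  have supp: "norm x \<le> B + \<epsilon> + 1" if "- 1 \<le> \<tau>" "\<tau> \<le> T + 1" "f (\<tau>, x) \<noteq> 0" for \<tau> x
  proof -
    have "\<not> q (\<tau>, x) \<le> 0" using that(3) S(4) by (auto simp: f_def)
    then have "(norm x)\<^sup>2 < k \<tau> + \<epsilon>" using \<epsilon> by (simp add: q_def field_simps)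
    moreover have "\<bar>k \<tau>\<bar> \<le> B" using B that by simp
    moreover have "2 * norm x \<le> (norm x)\<^sup>2 + 1"
      using sum_squares_bound[of "norm x" 1] by simp
    ultimately show ?thesis using norm_ge_zero[of x] by linarith
  qed
  have one: "AE x in \<mu> s. f (s, x) = 1"
    using start by eventually_elim (use S(5) \<epsilon> in \<open>simp add: f_def q_def divide_nonpos_pos\<close>)
  have sT: "s \<in> {0..T}" "t \<in> {0..T}" using st by auto
  interpret s: prob_space "\<mu> s" by (rule weak_solution_prob(2)[OF w sT(1)])
  interpret t: prob_space "\<mu> t" by (rule weak_solution_prob(2)[OF w sT(2)])
  have "continuous_on UNIV (\<lambda>x. f (s, x))"
    by (rule continuous_on_compose2[OF smooth_continuous_on[OF f], of UNIV]) (auto intro: continuous_intros)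
  then have "(\<lambda>x. f (s, x)) \<in> borel_measurable (\<mu> s)"
    unfolding measurable_cong_sets[OF weak_solution_prob(3)[OF w sT(1)] refl]
    by (rule borel_measurable_continuous_onI)
  then have "(\<integral>x. f (s, x) \<partial>\<mu> s) = (\<integral>x. 1 \<partial>\<mu> s)"
    by (intro integral_cong_AE one) simp_all
  then have "1 = (\<integral>x. f (s, x) \<partial>\<mu> s)" by (simp add: s.prob_space)
  also have "\<dots> \<le> (\<integral>x. f (t, x) \<partial>\<mu> t)"
  proof (rule weak_solution_barrier[OF w f supp st])
    fix \<tau> assume \<tau>: "s \<le> \<tau>" "\<tau> \<le> t"
    show "AE x in \<mu> \<tau>. 0 \<le> frechet_derivative f (at (\<tau>, x)) (1, velocity \<rho> F (\<mu> \<tau>) x)"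
      using outward[OF \<tau>]
    proof eventually_elim
      case (elim x)
      show ?case
      proof (cases "k \<tau> \<le> (norm x)\<^sup>2 \<and> (norm x)\<^sup>2 \<le> k \<tau> + \<epsilon>")
        case True
        then have "- (2 * (x \<bullet> velocity \<rho> F (\<mu> \<tau>) x) - k' \<tau>) / \<epsilon> \<ge> 0" using elim \<epsilon> by simp
        then show ?thesis unfolding D by (intro mult_nonneg_nonneg S(3))
      next
        case False
        then have "q (\<tau>, x) \<ge> 1 \<or> q (\<tau>, x) \<le> 0" using \<epsilon> by (auto simp: q_def field_simps)
        then have "S' (q (\<tau>, x)) = 0" using S(6,7) by auto
        then show ?thesis unfolding D by simp
      qed
    qed
  qed
  finally have ge: "1 \<le> (\<integral>x. f (t, x) \<partial>\<mu> t)" .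
  \<comment> \<open>A non-integrable function would have integral 0 by convention, against
    \<open>ge\<close>.\<close>
  have "integrable (\<mu> t) (\<lambda>x. f (t, x))"
  proof (rule ccontr)
    assume "\<not> ?thesis"
    then show False using ge not_integrable_integral_eq by fastforce
  qed
  from AE_eq_1_of_integral_ge_1[OF t.prob_space_axioms this _ ge]
  have "AE x in \<mu> t. f (t, x) = 1" using S(9) by (simp add: f_def)
  then show ?thesis
  proof eventually_elim
    case (elim x)
    then have "\<not> q (t, x) \<le> 0" using S(4) by (auto simp: f_def)
    then show ?case using \<epsilon> by (simp add: q_def field_simps)
  qed
qed

text \<open>Obtained from twice the velocity when measure and point are only known to lie in balls
  of about twice the radius. This slack of 2 pays for the crude bounds in
  \<open>confinement_step\<close> and produces the absorbable \<open>N / 2\<close> in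
  \<open>displacement_bound\<close>.\<close>

definition growth_rate :: real where
  "growth_rate = 4 * D + 2 * norm (F 0) + 4 * (D\<^sup>2 * L)"

lemma growth_rate_nonneg: "0 \<le> growth_rate"
  using D_ge_0 L_nonneg by (simp add: growth_rate_def)

lemma velocity_norm_le_growth:
  assumes "confined \<mu> g" "1 + g \<le> 2 * (1 + h)" "0 \<le> h" "norm x \<le> 2 * h"
  shows "2 * norm (velocity \<rho> F \<mu> x) \<le> growth_rate * (1 + h)"
proof -
  have "norm (velocity \<rho> F \<mu> x) \<le> D * g + norm (F 0) + D\<^sup>2 * L * norm x"
    by (rule velocity_norm_le[OF assms(1)])
  also have "\<dots> \<le> D * (2 * (1 + h)) + norm (F 0) * (1 + h) + D\<^sup>2 * L * (2 * (1 + h))"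
    using assms D_ge_0 L_nonneg by (intro add_mono mult_left_mono) (auto simp: mult_le_cancel_left1)
  finally show ?thesis by (simp add: growth_rate_def algebra_simps)
qed

text \<open>The barrier radius \<open>h \<eta>\<close> solves \<open>h' = C * (1 + h)\<close>,
  starting \<open>\<eta>\<close> above \<open>R\<close>. The crude hypothesis \<open>R + 1\<close>
  suffices to bound the velocity at this rate, because \<open>growth_rate\<close> tolerates a factor
  2. Finally \<open>\<eta>\<close> tends to 0.\<close>

lemma confinement_step:
  assumes w: "weak_solution T \<rho> F \<mu>\<^sub>0 \<mu>" and st: "0 \<le> s" "s \<le> t" "t \<le> T"
    and s: "confined (\<mu> s) R" and g: "\<And>\<tau>. s \<le> \<tau> \<Longrightarrow> \<tau> \<le> t \<Longrightarrow> confined (\<mu> \<tau>) (R + 1)"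
  shows "confined (\<mu> t) ((1 + R) * exp (growth_rate * (t - s)) - 1)"
proof -
  have R: "0 \<le> R" by (rule confined_radius_nonneg[OF s])
  let ?C = growth_rate
  define h where "h \<eta> \<tau> = (1 + R + \<eta>) * exp (?C * (\<tau> - s)) - 1" for \<eta> \<tau>
  have bound: "AE x in \<mu> t. (norm x)\<^sup>2 \<le> (h \<eta> t)\<^sup>2 + 3 * \<eta>\<^sup>2" if \<eta>: "\<eta> > 0" for \<eta>
  proof (rule radial_barrier[OF w st, where k' = "\<lambda>\<tau>. 2 * h \<eta> \<tau> * (?C * (1 + h \<eta> \<tau>))"])
    show "smooth (\<lambda>\<tau>. (h \<eta> \<tau>)\<^sup>2)"
      unfolding h_def
      by (intro smooth_power smooth_diff smooth_const smooth_mult smooth_exp smooth_bounded_linear[OF bounded_linear_ident])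
    show "((\<lambda>\<tau>. (h \<eta> \<tau>)\<^sup>2) has_real_derivative 2 * h \<eta> \<tau> * (?C * (1 + h \<eta> \<tau>))) (at \<tau>)" for \<tau>
      unfolding h_def by (auto intro!: derivative_eq_intros simp: algebra_simps)
    show "0 < 3 * \<eta>\<^sup>2" using \<eta> by simp
    show "AE x in \<mu> s. (norm x)\<^sup>2 \<le> (h \<eta> s)\<^sup>2"
    proof -
      have "AE x in \<mu> s. norm x \<le> R" using s by (simp add: confined_def)
      then show ?thesis
        by eventually_elim (use R \<eta> in \<open>auto simp: h_def intro!: power_mono\<close>)
    qed
    fix \<tau> assume \<tau>: "s \<le> \<tau>" "\<tau> \<le> t"
    have "1 \<le> exp (?C * (\<tau> - s))" using \<tau> growth_rate_nonneg by simp
    then have "(1 + R + \<eta>) * 1 \<le> (1 + R + \<eta>) * exp (?C * (\<tau> - s))"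
      using R \<eta> by (intro mult_left_mono) auto
    then have h: "R + \<eta> \<le> h \<eta> \<tau>" by (simp add: h_def)
    then have "R \<le> h \<eta> \<tau>" using \<eta> by linarith
    with R have h0: "0 \<le> h \<eta> \<tau>" "1 + (R + 1) \<le> 2 * (1 + h \<eta> \<tau>)" by (simp_all add: algebra_simps)
    have "2 * (x \<bullet> velocity \<rho> F (\<mu> \<tau>) x) \<le> 2 * h \<eta> \<tau> * (?C * (1 + h \<eta> \<tau>))"
      if x: "(norm x)\<^sup>2 \<le> (h \<eta> \<tau>)\<^sup>2 + 3 * \<eta>\<^sup>2" for x
    proof -
      \<comment> \<open>The shell width \<open>3 * \<eta>^2\<close> is the largest multiple that
        \<open>\<eta> <= h\<close> keeps inside \<open>norm x <= 2 * h\<close>.\<close>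
      have "\<eta>\<^sup>2 \<le> (h \<eta> \<tau>)\<^sup>2" using h R \<eta> by (intro power_mono) auto
      then have "(norm x)\<^sup>2 \<le> (2 * h \<eta> \<tau>)\<^sup>2" using x by (simp add: power_mult_distrib)
      then have nx: "norm x \<le> 2 * h \<eta> \<tau>" by (rule power2_le_imp_le) (use h0 in simp)
      have v: "2 * norm (velocity \<rho> F (\<mu> \<tau>) x) \<le> ?C * (1 + h \<eta> \<tau>)"
        by (rule velocity_norm_le_growth[OF g[OF \<tau>]]) (fact h0 nx)+
      have "2 * (x \<bullet> velocity \<rho> F (\<mu> \<tau>) x) \<le> norm x * (2 * norm (velocity \<rho> F (\<mu> \<tau>) x))"
        using norm_cauchy_schwarz[of x "velocity \<rho> F (\<mu> \<tau>) x"] by simp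
      also have "\<dots> \<le> (2 * h \<eta> \<tau>) * (?C * (1 + h \<eta> \<tau>))"
        by (rule mult_mono[OF nx v]) (use h0(1) in simp_all)
      finally show ?thesis .
    qed
    then show "AE x in \<mu> \<tau>. (h \<eta> \<tau>)\<^sup>2 \<le> (norm x)\<^sup>2 \<longrightarrow> (norm x)\<^sup>2 \<le> (h \<eta> \<tau>)\<^sup>2 + 3 * \<eta>\<^sup>2 \<longrightarrow>
       2 * (x \<bullet> velocity \<rho> F (\<mu> \<tau>) x) \<le> 2 * h \<eta> \<tau> * (?C * (1 + h \<eta> \<tau>))"
      by simp
  qed
  have "1 \<le> exp (?C * (t - s))" using st growth_rate_nonneg by simp
  then have "1 * 1 \<le> (1 + R) * exp (?C * (t - s))" using R by (intro mult_mono) auto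
  then have h0t: "0 \<le> h 0 t" by (simp add: h_def)
  \<comment> \<open>Along a sequence of \<open>\<eta>\<close> the exceptional null sets can be
    united before passing to the limit.\<close>
  have "AE x in \<mu> t. \<forall>n. (norm x)\<^sup>2 \<le> (h (inverse (real (Suc n))) t)\<^sup>2 + 3 * (inverse (real (Suc n)))\<^sup>2"
    unfolding AE_all_countable by (intro allI bound) simp
  then have "AE x in \<mu> t. norm x \<le> h 0 t"
  proof eventually_elim
    case (elim x)
    have "(\<lambda>n. (h (inverse (real (Suc n))) t)\<^sup>2 + 3 * (inverse (real (Suc n)))\<^sup>2) \<longlonglongrightarrow> (h 0 t)\<^sup>2 + 3 * 0\<^sup>2"
      unfolding h_def by (intro tendsto_intros LIMSEQ_inverse_real_of_nat)
    then have "(norm x)\<^sup>2 \<le> (h 0 t)\<^sup>2 + 3 * 0\<^sup>2"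
      by (rule LIMSEQ_le_const) (use elim in auto)
    then have "(norm x)\<^sup>2 \<le> (h 0 t)\<^sup>2" by simp
    then show ?case by (rule power2_le_imp_le) (rule h0t)
  qed
  moreover have "t \<in> {0..T}" using st by simp
  ultimately show ?thesis
    using weak_solution_prob[OF w] by (simp add: confined_def h_def)
qed

text \<open>Induction over time steps of a fixed length \<open>\<delta>\<close>. Within a step,
  local boundedness alone keeps the mass within one unit of the previous radius;
  \<open>confinement_step\<close> then restores the exact exponential bound, so errors do not
  accumulate.\<close>

lemma weak_solution_confined:
  assumes w: "weak_solution T \<rho> F \<mu>\<^sub>0 \<mu>" and \<mu>\<^sub>0: "confined \<mu>\<^sub>0 R\<^sub>0" and t: "t \<in> {0..T}"
  shows "confined (\<mu> t) ((1 + R\<^sub>0) * exp (growth_rate * t) - 1)"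
proof -
  let ?h = "\<lambda>t. (1 + R\<^sub>0) * exp (growth_rate * t) - 1"
  have R0: "0 \<le> R\<^sub>0" by (rule confined_radius_nonneg[OF \<mu>\<^sub>0])
  have h_mono: "?h s \<le> ?h t" if "s \<le> t" for s t
    using that R0 growth_rate_nonneg by (simp add: mult_left_mono)
  have h_ge: "0 \<le> ?h s" if "0 \<le> s" for s
    using h_mono[OF that] R0 by simp
  \<comment> \<open>One more than the final radius, so that the bound \<open>A\<close> on the
    attention field serves every step.\<close>
  define r where "r = ?h T + 1"
  have r: "r \<ge> 1" using h_ge[of T] t by (simp add: r_def)
  have "bounded ((\<lambda>(t, x). attention_field \<rho> (\<mu> t) x) ` ({0..T} \<times> cball 0 r))"
    using w by (simp add: weak_solution_def)
  then obtain A where A: "\<And>\<tau> x. \<tau> \<in> {0..T} \<Longrightarrow> norm x \<le> r \<Longrightarrow> norm (attention_field \<rho> (\<mu> \<tau>) x) \<le> A"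
    by (fastforce simp: bounded_iff)
  define V where "V = \<bar>A\<bar> + norm (F 0) + D\<^sup>2 * L * r"
  have V: "norm (velocity \<rho> F (\<mu> \<tau>) x) \<le> V" if "\<tau> \<in> {0..T}" "norm x \<le> r" for \<tau> x
  proof -
    have "norm (velocity \<rho> F (\<mu> \<tau>) x) \<le> norm (attention_field \<rho> (\<mu> \<tau>) x) + norm (F x)"
      unfolding velocity_def by (rule norm_triangle_ineq)
    moreover have "D\<^sup>2 * L * norm x \<le> D\<^sup>2 * L * r" using that L_nonneg by (intro mult_left_mono) auto
    ultimately show ?thesis using A[OF that] F_norm_le[of x] by (simp add: V_def)
  qed
  have V0: "0 \<le> V" using L_nonneg r by (simp add: V_def)
  \<comment> \<open>\<open>M\<close> bounds \<open>2 * (x \<bullet> v)\<close> on the ball of radius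
    \<open>r\<close>. In a step of length \<open>1 / (2 * M)\<close> the squared radius grows by at
    most 1/2 and the shell adds 1/2, which fits into \<open>(H + 1)^2 - H^2\<close>.\<close>
  define M where "M = 2 * r * V + 1"
  have M: "M > 0" using V0 r by (simp add: M_def add_nonneg_pos)
  define \<delta> where "\<delta> = 1 / (2 * M)"
  have \<delta>: "\<delta> > 0" using M by (simp add: \<delta>_def)
  have step: "confined (\<mu> t) (?h t)" if st: "0 \<le> s" "s \<le> t" "t \<le> T" "t \<le> s + \<delta>" and s: "confined (\<mu> s) (?h s)" for s t
  proof -
    define H where "H = ?h s"
    have hs: "0 \<le> H" "H + 1 \<le> r" using h_ge[OF st(1)] h_mono[of s T] st by (simp_all add: r_def H_def)
    have crude: "confined (\<mu> \<tau>) (H + 1)" if \<tau>: "s \<le> \<tau>" "\<tau> \<le> t" for \<tau>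
    proof -
      define k where "k u = (H)\<^sup>2 + M * (u - s)" for u
      have k_le: "k u + 1 / 2 \<le> (H + 1)\<^sup>2" if "u \<le> t" for u
      proof -
        have "M * (u - s) \<le> M * \<delta>" using that st M by (intro mult_left_mono) auto
        then have "M * (u - s) \<le> 1 / 2" using M by (simp add: \<delta>_def)
        moreover have "(H + 1)\<^sup>2 = (H)\<^sup>2 + 2 * H + 1" by (simp only: power2_sum) simp
        ultimately show ?thesis using hs(1) unfolding k_def by linarith
      qed
      have "AE x in \<mu> \<tau>. (norm x)\<^sup>2 \<le> k \<tau> + 1 / 2"
      proof (rule radial_barrier[OF w, where s = s and k' = "\<lambda>_. M"])
        show "0 \<le> s" "s \<le> \<tau>" "\<tau> \<le> T" "0 < (1 / 2 :: real)" using st \<tau> by auto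
        show "smooth k" unfolding k_def
          by (intro smooth_add smooth_const smooth_mult smooth_diff smooth_bounded_linear[OF bounded_linear_ident])
        show "(k has_real_derivative M) (at u)" for u
          unfolding k_def by (auto intro!: derivative_eq_intros)
        show "AE x in \<mu> s. (norm x)\<^sup>2 \<le> k s"
        proof -
          have "AE x in \<mu> s. norm x \<le> H" using s by (simp add: confined_def H_def)
          then show ?thesis by eventually_elim (auto simp: k_def intro: power_mono)
        qed
        fix u assume u: "s \<le> u" "u \<le> \<tau>"
        have "2 * (x \<bullet> velocity \<rho> F (\<mu> u) x) \<le> M" if x: "(norm x)\<^sup>2 \<le> k u + 1 / 2" for x
        proof -
          have "(norm x)\<^sup>2 \<le> (H + 1)\<^sup>2" using x k_le[of u] u \<tau> by linarith
          then have "norm x \<le> H + 1" by (rule power2_le_imp_le) (use hs(1) in linarith)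
          then have nx: "norm x \<le> r" using hs by simp
          have "x \<bullet> velocity \<rho> F (\<mu> u) x \<le> norm x * norm (velocity \<rho> F (\<mu> u) x)"
            by (rule norm_cauchy_schwarz)
          also have "\<dots> \<le> r * V" by (rule mult_mono[OF nx V[OF _ nx]]) (use u \<tau> st r in auto)
          finally show ?thesis by (simp add: M_def)
        qed
        then show "AE x in \<mu> u. k u \<le> (norm x)\<^sup>2 \<longrightarrow> (norm x)\<^sup>2 \<le> k u + 1 / 2 \<longrightarrow> 2 * (x \<bullet> velocity \<rho> F (\<mu> u) x) \<le> M"
          by simp
      qed
      then have "AE x in \<mu> \<tau>. norm x \<le> H + 1"
      proof eventually_elim
        case (elim x)
        then have "(norm x)\<^sup>2 \<le> (H + 1)\<^sup>2" using k_le[OF \<tau>(2)] by linarith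
        then show ?case by (rule power2_le_imp_le) (use hs(1) in linarith)
      qed
      moreover have "\<tau> \<in> {0..T}" using \<tau> st by simp
      ultimately show ?thesis
        using weak_solution_prob[OF w] by (simp add: confined_def)
    qed
    have "confined (\<mu> t) ((1 + H) * exp (growth_rate * (t - s)) - 1)"
      by (rule confinement_step[OF w st(1-3) s[folded H_def] crude])
    \<comment> \<open>The bound is a semigroup in time: restarting from the radius at
      \<open>s\<close> gives the same radius at \<open>t\<close>.\<close>
    moreover have "(1 + H) * exp (growth_rate * (t - s)) = (1 + R\<^sub>0) * exp (growth_rate * t)"
      by (simp add: H_def mult.assoc exp_add[symmetric] algebra_simps)
    ultimately show ?thesis by simp
  qed
  have "\<forall>t\<in>{0..T}. t \<le> real n * \<delta> \<longrightarrow> confined (\<mu> t) (?h t)" for n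
  proof (induction n)
    case 0
    have c: "confined (\<mu> 0) (?h 0)" using \<mu>\<^sub>0 w by (simp add: weak_solution_def)
    show ?case
    proof (intro ballI impI)
      fix t assume "t \<in> {0..T}" "t \<le> real 0 * \<delta>"
      then have "t = 0" by simp
      with c show "confined (\<mu> t) (?h t)" by simp
    qed
  next
    case (Suc n)
    show ?case
    proof (intro ballI impI)
      fix t assume t: "t \<in> {0..T}" "t \<le> real (Suc n) * \<delta>"
      define s where "s = max 0 (t - \<delta>)"
      have s: "0 \<le> s" "s \<le> t" "t \<le> s + \<delta>" "s \<le> real n * \<delta>"
        using t \<delta> by (auto simp: s_def max_def algebra_simps)
      then have "confined (\<mu> s) (?h s)" using Suc t by auto
      then show "confined (\<mu> t) (?h t)" using step s t by auto
    qed
  qed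
  moreover obtain n where "t / \<delta> \<le> real n" using real_arch_simple by blast
  then have "t \<le> real n * \<delta>" using \<delta> by (simp add: field_simps)
  ultimately show ?thesis using t by blast
qed

end

section \<open>Ordinary differential equations\<close>

lemma continuous_on_lipschitz_compose:
  fixes f :: "real \<Rightarrow> 'e::real_normed_vector \<Rightarrow> 'e"
  assumes lip: "\<And>t u v. t \<in> S \<Longrightarrow> norm (f t u - f t v) \<le> L * norm (u - v)"
    and cont: "\<And>u. continuous_on S (\<lambda>t. f t u)" and w: "continuous_on S w"
  shows "continuous_on S (\<lambda>t. f t (w t))"
  unfolding continuous_on_def
proof
  fix t assume t: "t \<in> S"
  have "((\<lambda>s. L * norm (w s - w t) + norm (f s (w t) - f t (w t))) \<longlongrightarrow> L * norm (w t - w t) + norm (f t (w t) - f t (w t))) (at t within S)"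
    using w cont[of "w t"] t unfolding continuous_on_def by (intro tendsto_intros) auto
  then have lim: "((\<lambda>s. L * norm (w s - w t) + norm (f s (w t) - f t (w t))) \<longlongrightarrow> 0) (at t within S)"
    by simp
  have "\<forall>\<^sub>F s in at t within S. norm (f s (w s) - f t (w t)) \<le> L * norm (w s - w t) + norm (f s (w t) - f t (w t))"
    unfolding eventually_at_filter
  proof (rule always_eventually, intro allI impI)
    fix s assume "s \<noteq> t" "s \<in> S"
    then have "norm (f s (w s) - f s (w t)) \<le> L * norm (w s - w t)" by (intro lip)
    then show "norm (f s (w s) - f t (w t)) \<le> L * norm (w s - w t) + norm (f s (w t) - f t (w t))"
      using norm_triangle_ineq[of "f s (w s) - f s (w t)" "f s (w t) - f t (w t)"] by simp
  qed
  then have "((\<lambda>s. f s (w s) - f t (w t)) \<longlongrightarrow> 0) (at t within S)"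
    by (rule Lim_null_comparison[OF _ lim])
  then show "((\<lambda>s. f s (w s)) \<longlongrightarrow> f t (w t)) (at t within S)"
    by (simp add: LIM_zero_iff)
qed

text \<open>The unknown of the fixed point problem is \<open>exp (- l t) x t\<close> with \<open>l = 2 L + 1\<close>; this weight makes
  the Picard map a contraction on the whole interval.\<close>

lemma picard_lindelof:
  fixes f :: "real \<Rightarrow> 'e::banach \<Rightarrow> 'e"
  assumes T: "0 \<le> T" and L: "0 \<le> L"
    and lip: "\<And>t u v. t \<in> {0..T} \<Longrightarrow> norm (f t u - f t v) \<le> L * norm (u - v)"
    and cont: "\<And>u. continuous_on {0..T} (\<lambda>t. f t u)"
  shows "\<exists>x. x 0 = x0 \<and> (\<forall>t\<in>{0..T}. (x has_vector_derivative f t (x t)) (at t within {0..T}))"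
proof -
  define l where "l = 2 * L + 1"
  have l: "l > 0" "L / l \<le> 1 / 2" using L by (auto simp: l_def field_simps)
  \<comment> \<open>Clamping time to the interval extends curves constantly to the whole line, so
    that the fixed point can be sought among bounded continuous functions on the reals.\<close>
  define c where "c t = max 0 (min T t)" for t
  have c: "c t \<in> {0..T}" "t \<in> {0..T} \<Longrightarrow> c t = t" for t using T by (auto simp: c_def)
  have c_cont: "continuous_on UNIV c" unfolding c_def by (intro continuous_intros)
  define g where "g v s = f s (exp (l * s) *\<^sub>R apply_bcontfun v s)" for v :: "real \<Rightarrow>\<^sub>C 'e" and s
  have g_cont: "continuous_on {0..T} (g v)" for v
    unfolding g_def by (rule continuous_on_lipschitz_compose[OF lip cont]) (auto intro!: continuous_intros)
  have g_int: "g v integrable_on {0..c t}" for v t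
    using c(1)[of t] by (intro integrable_continuous_real continuous_on_subset[OF g_cont]) auto
  define h where "h v t = exp (- l * t) *\<^sub>R (x0 + integral {0..t} (g v))" for v t
  have h_cont: "continuous_on {0..T} (h v)" for v
    unfolding h_def
    by (intro continuous_intros indefinite_integral_continuous_1 integrable_continuous_real g_cont)
  have hc: "(\<lambda>t. h v (c t)) \<in> bcontfun" for v
  proof -
    have "continuous_on UNIV (\<lambda>t. h v (c t))"
      by (rule continuous_on_compose2[OF h_cont c_cont]) (use c in auto)
    moreover have "bounded (range (\<lambda>t. h v (c t)))"
    proof (rule bounded_subset)
      show "bounded (h v ` {0..T})"
        by (intro compact_imp_bounded compact_continuous_image h_cont) auto
    qed (use c in auto)
    ultimately show ?thesis by (simp add: bcontfun_def)
  qed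
  define \<Psi> where "\<Psi> v = Bcontfun (\<lambda>t. h v (c t))" for v
  have \<Psi>: "apply_bcontfun (\<Psi> v) t = h v (c t)" for v t
    unfolding \<Psi>_def by (subst Bcontfun_inverse[OF hc]) simp
  have "dist (\<Psi> v) (\<Psi> w) \<le> 1 / 2 * dist v w" for v w
  proof (rule dist_bound)
    fix t
    let ?d = "dist v w"
    \<comment> \<open>The integral is at most \<open>L * ?d * exp (l * c t) / l\<close>; the weight
      \<open>exp (- l * c t)\<close> leaves the contraction factor
      \<open>L / l <= 1 / 2\<close>.\<close>
    have I: "((\<lambda>s. (L * ?d) * exp (l * s)) has_integral ((L * ?d) * (exp (l * c t) / l) - (L * ?d) * (exp (l * 0) / l))) {0..c t}"
      using c(1)[of t] l(1)
      by (intro fundamental_theorem_of_calculus)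
        (auto intro!: derivative_eq_intros simp: has_real_derivative_iff_has_vector_derivative[symmetric])
    have "h v (c t) - h w (c t) = exp (- l * c t) *\<^sub>R (integral {0..c t} (g v) - integral {0..c t} (g w))"
      by (simp add: h_def algebra_simps)
    also have "integral {0..c t} (g v) - integral {0..c t} (g w) = integral {0..c t} (\<lambda>s. g v s - g w s)"
      by (rule integral_diff[OF g_int g_int, symmetric])
    also have "norm (exp (- l * c t) *\<^sub>R \<dots>) = exp (- l * c t) * norm (integral {0..c t} (\<lambda>s. g v s - g w s))"
      by simp
    also have "\<dots> \<le> exp (- l * c t) * integral {0..c t} (\<lambda>s. (L * ?d) * exp (l * s))"
    proof (intro mult_left_mono Henstock_Kurzweil_Integration.integral_norm_bound_integral)
      show "(\<lambda>s. g v s - g w s) integrable_on {0..c t}" by (rule integrable_diff[OF g_int g_int])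
      show "(\<lambda>s. (L * ?d) * exp (l * s)) integrable_on {0..c t}" using I by blast
      fix s assume s: "s \<in> {0..c t}"
      then have "norm (g v s - g w s) \<le> L * norm (exp (l * s) *\<^sub>R apply_bcontfun v s - exp (l * s) *\<^sub>R apply_bcontfun w s)"
        unfolding g_def using c(1)[of t] by (intro lip) auto
      also have "\<dots> = L * (exp (l * s) * dist (apply_bcontfun v s) (apply_bcontfun w s))"
        by (simp add: scaleR_diff_right[symmetric] dist_norm)
      also have "\<dots> \<le> L * (exp (l * s) * ?d)"
        using L dist_bounded[of v s w] by (intro mult_left_mono) auto
      finally show "norm (g v s - g w s) \<le> (L * ?d) * exp (l * s)" by (simp add: mult_ac)
    qed simp
    also have "integral {0..c t} (\<lambda>s. (L * ?d) * exp (l * s)) = (L * ?d) * (exp (l * c t) / l) - (L * ?d) * (exp (l * 0) / l)"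
      using I by (rule integral_unique)
    also have "\<dots> \<le> (L * ?d) * (exp (l * c t) / l)"
      using L l by simp
    finally have "dist (h v (c t)) (h w (c t)) \<le> exp (- l * c t) * ((L * ?d) * (exp (l * c t) / l))"
      by (simp add: dist_norm)
    also have "\<dots> = (L / l) * ?d"
      by (simp add: exp_minus field_simps)
    also have "\<dots> \<le> 1 / 2 * ?d" using l(2) by (intro mult_right_mono) auto
    finally show "dist (apply_bcontfun (\<Psi> v) t) (apply_bcontfun (\<Psi> w) t) \<le> 1 / 2 * ?d"
      unfolding \<Psi> .
  qed
  then have "\<exists>!v. \<Psi> v = v"
    by (intro banach_fix_type[of "1 / 2"]) auto
  then obtain v where v: "\<Psi> v = v" by auto
  define x where "x t = x0 + integral {0..t} (g v)" for t
  have x_eq: "exp (l * t) *\<^sub>R apply_bcontfun v t = x t" if t: "t \<in> {0..T}" for t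
  proof -
    have "apply_bcontfun v t = exp (- l * t) *\<^sub>R x t"
      using \<Psi>[of v t] c(2)[OF t] v by (simp add: h_def x_def)
    then show ?thesis by (simp add: exp_minus)
  qed
  show ?thesis
  proof (intro exI[of _ x] conjI ballI)
    show "x 0 = x0" by (simp add: x_def)
    fix t assume t: "t \<in> {0..T}"
    have "((\<lambda>u. integral {0..u} (g v)) has_vector_derivative g v t) (at t within {0..T})"
      by (rule integral_has_vector_derivative[OF g_cont t])
    then have "(x has_vector_derivative (0 + g v t)) (at t within {0..T})"
      unfolding x_def by (intro has_vector_derivative_add has_vector_derivative_const)
    then show "(x has_vector_derivative f t (x t)) (at t within {0..T})"
      using x_eq[OF t] by (simp add: g_def)
  qed
qed

section \<open>Differential inequalities, smooth approximation of curves, derivatives of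
  integrals\<close>

lemma within_DERIV_nonpos_le:
  fixes \<phi> :: "real \<Rightarrow> real"
  assumes D: "\<And>t. t \<in> {0..T} \<Longrightarrow> (\<phi> has_real_derivative \<phi>' t) (at t within {0..T})"
    and le: "\<And>t. t \<in> {0..T} \<Longrightarrow> \<phi>' t \<le> 0" and t: "t \<in> {0..T}"
  shows "\<phi> t \<le> \<phi> 0"
proof (cases "t = 0")
  case False
  with t have t0: "0 < t" by simp
  show ?thesis
  proof (rule DERIV_nonpos_imp_decreasing_open[OF less_imp_le[OF t0]])
    fix s assume s: "0 < s" "s < t"
    then have "(\<phi> has_real_derivative \<phi>' s) (at s)"
      using D[of s] t at_within_Icc_at[of 0 s T] by auto
    then show "\<exists>y. (\<phi> has_real_derivative y) (at s) \<and> y \<le> 0"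
      using le[of s] s t by auto
  next
    have "continuous_on {0..T} \<phi>" using DERIV_continuous_on D by blast
    then show "continuous_on {0..t} \<phi>" by (rule continuous_on_subset) (use t in auto)
  qed
qed simp

lemma within_vector_derivative_bound:
  fixes x :: "real \<Rightarrow> 'e::real_normed_vector"
  assumes D: "\<And>t. t \<in> {0..T} \<Longrightarrow> (x has_vector_derivative x' t) (at t within {0..T})"
    and le: "\<And>t. t \<in> {0..T} \<Longrightarrow> norm (x' t) \<le> B" and t: "s \<in> {0..T}" "t \<in> {0..T}"
  shows "norm (x t - x s) \<le> B * norm (t - s)"
proof (rule differentiable_bound[OF _ _ _ t(2,1)])
  show "convex {0..T}" by simp
  show "(x has_derivative (\<lambda>h. h *\<^sub>R x' u)) (at u within {0..T})" if "u \<in> {0..T}" for u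
    using D[OF that] by (simp add: has_vector_derivative_def)
  show "onorm (\<lambda>h. h *\<^sub>R x' u) \<le> B" if "u \<in> {0..T}" for u
    by (rule onorm_le) (use le[OF that] in \<open>simp add: mult.commute[of B] mult_left_mono\<close>)
qed

text \<open>Gronwall in differential form: the weight turns a derivative bound by \<open>c\<close>
  times the function into monotonicity. The square avoids the kink of the norm at 0.\<close>

lemma has_real_derivative_weighted_norm:
  fixes u :: "real \<Rightarrow> 'b::real_inner"
  assumes "(u has_vector_derivative u') (at t within S)"
  shows "((\<lambda>t. exp (- c * t) * (norm (u t))\<^sup>2) has_real_derivative
    exp (- c * t) * (2 * (u t \<bullet> u') - c * (norm (u t))\<^sup>2)) (at t within S)"
proof -
  have "((\<lambda>t. u t \<bullet> u t) has_vector_derivative (u t \<bullet> u' + u' \<bullet> u t)) (at t within S)"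
    by (rule bounded_bilinear.has_vector_derivative[OF bounded_bilinear_inner assms assms])
  then have "((\<lambda>t. (norm (u t))\<^sup>2) has_real_derivative 2 * (u t \<bullet> u')) (at t within S)"
    by (simp add: has_real_derivative_iff_has_vector_derivative power2_norm_eq_inner inner_commute)
  moreover have "((\<lambda>t. exp (- c * t)) has_real_derivative - c * exp (- c * t)) (at t within S)"
    by (auto intro!: derivative_eq_intros)
  ultimately have "((\<lambda>t. exp (- c * t) * (norm (u t))\<^sup>2) has_real_derivative
      (- c * exp (- c * t)) * (norm (u t))\<^sup>2 + (2 * (u t \<bullet> u')) * exp (- c * t)) (at t within S)"
    by (rule DERIV_mult[rotated])
  then show ?thesis by (rule DERIV_cong) (simp add: algebra_simps)
qed

lemma trajectory_lipschitz:
  fixes x y :: "real \<Rightarrow> 'e::real_inner"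
  assumes x: "\<And>t. t \<in> {0..T} \<Longrightarrow> (x has_vector_derivative b t (x t)) (at t within {0..T})"
    and y: "\<And>t. t \<in> {0..T} \<Longrightarrow> (y has_vector_derivative b t (y t)) (at t within {0..T})"
    and lip: "\<And>t u v. t \<in> {0..T} \<Longrightarrow> norm (b t u - b t v) \<le> L * norm (u - v)" and t: "t \<in> {0..T}"
  shows "norm (x t - y t) \<le> exp (L * t) * norm (x 0 - y 0)"
proof -
  have "exp (- (2 * L) * t) * (norm (x t - y t))\<^sup>2 \<le> exp (- (2 * L) * 0) * (norm (x 0 - y 0))\<^sup>2"
  proof (rule within_DERIV_nonpos_le[OF has_real_derivative_weighted_norm[OF has_vector_derivative_diff[OF x y]] _ t])
    fix t assume t: "t \<in> {0..T}"
    have "(x t - y t) \<bullet> (b t (x t) - b t (y t)) \<le> norm (x t - y t) * norm (b t (x t) - b t (y t))"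
      by (rule norm_cauchy_schwarz)
    also have "\<dots> \<le> norm (x t - y t) * (L * norm (x t - y t))"
      by (intro mult_left_mono lip t) simp
    finally show "exp (- (2 * L) * t) * (2 * ((x t - y t) \<bullet> (b t (x t) - b t (y t))) - 2 * L * (norm (x t - y t))\<^sup>2) \<le> 0"
      by (intro mult_nonneg_nonpos) (auto simp: power2_eq_square algebra_simps)
  qed auto
  then have "(norm (x t - y t))\<^sup>2 \<le> exp (2 * L * t) * (norm (x 0 - y 0))\<^sup>2"
    by (simp add: exp_minus field_simps)
  also have "\<dots> = (exp (L * t) * norm (x 0 - y 0))\<^sup>2"
    by (simp add: power_mult_distrib exp_double[symmetric] mult.assoc)
  finally show ?thesis by (rule power2_le_imp_le) simp
qed

lemma real_polynomial_antiderivative: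
  assumes "real_polynomial_function (g :: real \<Rightarrow> real)"
  obtains G where "smooth G" "\<And>t. (G has_real_derivative g t) (at t)" "G 0 = 0"
proof -
  obtain a n where g: "g = (\<lambda>t. \<Sum>i\<le>n. a i * t ^ i)"
    using assms unfolding real_polynomial_function_iff_sum by blast
  define G where "G t = (\<Sum>i\<le>n. a i * (t ^ Suc i / real (Suc i)))" for t :: real
  have 1: "((\<lambda>t. t ^ Suc i / real (Suc i)) has_real_derivative t ^ i) (at t)" for i t
  proof -
    have "((\<lambda>t. t ^ Suc i / real (Suc i)) has_real_derivative (real (Suc i) * t ^ (Suc i - Suc 0)) / real (Suc i)) (at t)"
      by (rule DERIV_cdivide[OF DERIV_pow])
    then show ?thesis by (simp del: power_Suc of_nat_Suc)
  qed
  show thesis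
  proof
    show "smooth G"
      unfolding G_def[abs_def]
      by (intro smooth_sum smooth_mult smooth_const smooth_divide_const smooth_power smooth_bounded_linear[OF bounded_linear_ident])
    show "(G has_real_derivative g t) (at t)" for t
      unfolding G_def[abs_def] g by (intro DERIV_sum DERIV_cmult 1)
    show "G 0 = 0" by (simp add: G_def)
  qed
qed

text \<open>The derivative is approximated by a polynomial (Stone-Weierstrass) and then integrated.
  Approximating the curve itself would not control its velocity.\<close>

lemma smooth_curve_approximation:
  fixes x :: "real \<Rightarrow> 'b::euclidean_space"
  assumes T: "0 \<le> T" and x: "\<And>t. t \<in> {0..T} \<Longrightarrow> (x has_vector_derivative v t) (at t within {0..T})"
    and v: "continuous_on {0..T} v" and e: "e > 0"
  obtains Z Z' where "Z 0 = x 0" "\<And>t. (Z has_vector_derivative Z' t) (at t)"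
    "\<And>i. smooth (\<lambda>t. Z t \<bullet> i)"
    "\<And>t. t \<in> {0..T} \<Longrightarrow> norm (Z t - x t) \<le> e" "\<And>t. t \<in> {0..T} \<Longrightarrow> norm (Z' t - v t) \<le> e"
proof -
  \<comment> \<open>Makes both the velocity error \<open>d\<close> and the accumulated position
    error \<open>d * T\<close> at most \<open>e\<close>.\<close>
  define d where "d = e / (1 + T)"
  have d: "d > 0" "d * T \<le> e" "d \<le> e" using e T by (auto simp: d_def field_simps)
  obtain p where p: "polynomial_function p" "\<And>t. t \<in> {0..T} \<Longrightarrow> norm (v t - p t) < d"
    using Stone_Weierstrass_polynomial_function[OF compact_Icc v d(1)] by blast
  have "\<exists>G. smooth G \<and> (\<forall>t. (G has_real_derivative p t \<bullet> i) (at t)) \<and> G 0 = 0" for i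
  proof -
    have "real_polynomial_function ((\<lambda>y. y \<bullet> i) \<circ> p)"
      using p(1) bounded_linear_inner_left[of i] unfolding polynomial_function_def by blast
    from real_polynomial_antiderivative[OF this] show ?thesis by (auto simp: o_def)
  qed
  then obtain G where G: "\<And>i. smooth (G i)" "\<And>i t. (G i has_real_derivative p t \<bullet> i) (at t)" "\<And>i. G i 0 = 0"
    by metis
  define Z where "Z t = x 0 + (\<Sum>i\<in>Basis. G i t *\<^sub>R i)" for t
  have Z: "(Z has_vector_derivative p t) (at t)" for t
  proof -
    have "(Z has_vector_derivative 0 + (\<Sum>i\<in>Basis. (p t \<bullet> i) *\<^sub>R i)) (at t)"
      unfolding Z_def
    proof (intro has_vector_derivative_add has_vector_derivative_const has_vector_derivative_sum)
      show "((\<lambda>t. G i t *\<^sub>R i) has_vector_derivative (p t \<bullet> i) *\<^sub>R i) (at t)" for i :: 'b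
        using has_vector_derivative_scaleR[OF G(2) has_vector_derivative_const[of i]] by simp
    qed
    then show ?thesis by (simp add: euclidean_representation)
  qed
  have pv: "norm (p t - v t) \<le> d" if "t \<in> {0..T}" for t
    using p(2)[OF that] by (simp add: norm_minus_commute)
  have Z0: "Z 0 = x 0" by (simp add: Z_def G(3))
  show thesis
  proof
    show "Z 0 = x 0" by fact
    show "(Z has_vector_derivative p t) (at t)" for t by (rule Z)
    show "smooth (\<lambda>t. Z t \<bullet> i)" for i
      unfolding Z_def inner_add_left inner_sum_left inner_scaleR_left
      by (intro smooth_add smooth_const smooth_sum smooth_mult G(1))
    show "norm (p t - v t) \<le> e" if "t \<in> {0..T}" for t using pv[OF that] d by simp
    show "norm (Z t - x t) \<le> e" if t: "t \<in> {0..T}" for t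
    proof -
      have "norm ((Z t - x t) - (Z 0 - x 0)) \<le> d * norm (t - 0)"
        by (rule within_vector_derivative_bound[OF has_vector_derivative_diff[OF has_vector_derivative_at_within[OF Z] x] pv _ t])
          (use t in auto)
      also have "\<dots> \<le> d * T" using t d by (intro mult_left_mono) auto
      finally show ?thesis using Z0 d by simp
    qed
  qed
qed

text \<open>Dominated convergence along sequences: the bound \<open>K\<close> on \<open>f'\<close>
  over the whole interval bounds all difference quotients by the mean value inequality.\<close>

lemma has_real_derivative_integral:
  fixes f :: "real \<Rightarrow> 'a \<Rightarrow> real"
  assumes M: "finite_measure M" and t: "t \<in> {0..T}"
    and int: "\<And>t. t \<in> {0..T} \<Longrightarrow> integrable M (f t)"
    and meas: "f' t \<in> borel_measurable M"
    and D: "AE z in M. \<forall>t\<in>{0..T}. ((\<lambda>s. f s z) has_real_derivative f' t z) (at t within {0..T}) \<and> \<bar>f' t z\<bar> \<le> K"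
  shows "((\<lambda>s. \<integral>z. f s z \<partial>M) has_real_derivative (\<integral>z. f' t z \<partial>M)) (at t within {0..T})"
  unfolding has_field_derivative_iff tendsto_at_iff_sequentially
proof (intro allI impI)
  interpret finite_measure M by fact
  fix X :: "nat \<Rightarrow> real" assume X: "\<forall>i. X i \<in> {0..T} - {t}" "X \<longlonglongrightarrow> t"
  have "(\<lambda>n. \<integral>z. (f (X n) z - f t z) / (X n - t) \<partial>M) \<longlonglongrightarrow> (\<integral>z. f' t z \<partial>M)"
  proof (rule integral_dominated_convergence[where w = "\<lambda>_. K"])
    show "(\<lambda>z. (f (X n) z - f t z) / (X n - t)) \<in> borel_measurable M" for n
      using int[OF t] int[of "X n"] X(1) by (auto intro!: borel_measurable_divide borel_measurable_diff)
    show "AE z in M. (\<lambda>n. (f (X n) z - f t z) / (X n - t)) \<longlonglongrightarrow> f' t z"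
      using D
    proof eventually_elim
      case (elim z)
      then have "((\<lambda>s. (f s z - f t z) / (s - t)) \<longlongrightarrow> f' t z) (at t within {0..T})"
        using t by (auto simp: has_field_derivative_iff)
      then show ?case
        using X unfolding tendsto_at_iff_sequentially by (auto simp: o_def)
    qed
    show "AE z in M. norm ((f (X n) z - f t z) / (X n - t)) \<le> K" for n
      using D
    proof eventually_elim
      case (elim z)
      have "norm (f (X n) z - f t z) \<le> K * norm (X n - t)"
        by (rule within_vector_derivative_bound[of T "\<lambda>s. f s z" "\<lambda>s. f' s z"])
          (use elim X(1) t in \<open>auto simp: has_real_derivative_iff_has_vector_derivative\<close>)
      then show ?case using X(1) by (simp add: field_simps)
    qed
  qed (use meas in auto)
  moreover have "(\<integral>z. (f (X n) z - f t z) / (X n - t) \<partial>M) = ((\<integral>z. f (X n) z \<partial>M) - (\<integral>z. f t z \<partial>M)) / (X n - t)" for n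
  proof -
    have "integrable M (f (X n))" using int X(1) by simp
    then have "(\<integral>z. f (X n) z - f t z \<partial>M) = (\<integral>z. f (X n) z \<partial>M) - (\<integral>z. f t z \<partial>M)"
      using int[OF t] by (rule Bochner_Integration.integral_diff)
    then show ?thesis by simp
  qed
  ultimately show "((\<lambda>s. ((\<integral>z. f s z \<partial>M) - (\<integral>z. f t z \<partial>M)) / (s - t)) \<circ> X) \<longlonglongrightarrow> (\<integral>z. f' t z \<partial>M)"
    by (simp only: o_def)
qed

section \<open>Weak solutions are transported by the flow\<close>

text \<open>The variance is nonnegative.\<close>

lemma (in prob_space) expectation_le_sqrt:
  fixes f :: "'a \<Rightarrow> real"
  assumes "f \<in> borel_measurable M" "integrable M (\<lambda>x. (f x)\<^sup>2)"
  shows "integrable M f" "expectation f \<le> sqrt (expectation (\<lambda>x. (f x)\<^sup>2))"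
proof -
  show f: "integrable M f" by (rule square_integrable_imp_integrable[OF assms])
  have "(expectation f)\<^sup>2 \<le> expectation (\<lambda>x. (f x)\<^sup>2)"
    using variance_eq[OF f assms(2)] variance_positive[of f] by simp
  then show "expectation f \<le> sqrt (expectation (\<lambda>x. (f x)\<^sup>2))"
    by (rule real_le_rsqrt)
qed

lemma couplings_dist_le_sqrt:
  fixes \<mu> \<nu> :: "'a::euclidean_space measure"
  assumes "\<mu> \<in> P2" "\<nu> \<in> P2" "\<gamma> \<in> couplings \<mu> \<nu>"
  shows "integrable \<gamma> (\<lambda>(x, y). dist x y)"
    and "(\<integral>(x, y). dist x y \<partial>\<gamma>) \<le> sqrt (\<integral>(x, y). (dist x y)\<^sup>2 \<partial>\<gamma>)"
proof -
  interpret prob_space \<gamma> using assms(3) by (simp add: couplings_def)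
  have [measurable_cong]: "sets \<gamma> = sets (borel \<Otimes>\<^sub>M borel)" using assms(3) by (simp add: couplings_def)
  have m: "(\<lambda>(x, y). dist x y) \<in> borel_measurable \<gamma>" by measurable
  have eq: "((case z of (x, y) \<Rightarrow> dist x y)\<^sup>2) = (case z of (x, y) \<Rightarrow> (dist x y)\<^sup>2)" for z :: "'a \<times> 'a"
    by (simp split: prod.split)
  show "integrable \<gamma> (\<lambda>(x, y). dist x y)"
    and "(\<integral>(x, y). dist x y \<partial>\<gamma>) \<le> sqrt (\<integral>(x, y). (dist x y)\<^sup>2 \<partial>\<gamma>)"
    using expectation_le_sqrt[OF m, unfolded eq, OF couplings_integrable_dist[OF assms]] by auto
qed

text \<open>Two random variables on one probability space couple their laws. The couplings written
  down from here on (diagonal, pushed along flows, displaced) all arise in this way.\<close>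

lemma (in prob_space) joint_distr_coupling:
  fixes X Y :: "'a \<Rightarrow> 'b::euclidean_space"
  assumes X: "X \<in> measurable M borel" and Y: "Y \<in> measurable M borel"
  shows "distr M (borel \<Otimes>\<^sub>M borel) (\<lambda>\<omega>. (X \<omega>, Y \<omega>)) \<in> couplings (distr M borel X) (distr M borel Y)"
    and "(\<integral>(x, y). (dist x y)\<^sup>2 \<partial>distr M (borel \<Otimes>\<^sub>M borel) (\<lambda>\<omega>. (X \<omega>, Y \<omega>))) = (\<integral>\<omega>. (dist (X \<omega>) (Y \<omega>))\<^sup>2 \<partial>M)"
proof -
  note [measurable] = X Y
  have "distr (distr M (borel \<Otimes>\<^sub>M borel) (\<lambda>\<omega>. (X \<omega>, Y \<omega>))) borel fst = distr M borel X"
    "distr (distr M (borel \<Otimes>\<^sub>M borel) (\<lambda>\<omega>. (X \<omega>, Y \<omega>))) borel snd = distr M borel Y"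
    by (simp_all add: distr_distr o_def)
  then show "distr M (borel \<Otimes>\<^sub>M borel) (\<lambda>\<omega>. (X \<omega>, Y \<omega>)) \<in> couplings (distr M borel X) (distr M borel Y)"
    by (auto simp: couplings_def intro!: prob_space_distr)
  show "(\<integral>(x, y). (dist x y)\<^sup>2 \<partial>distr M (borel \<Otimes>\<^sub>M borel) (\<lambda>\<omega>. (X \<omega>, Y \<omega>))) = (\<integral>\<omega>. (dist (X \<omega>) (Y \<omega>))\<^sup>2 \<partial>M)"
    by (subst integral_distr) simp_all
qed

text \<open>Inner regularity extends the inequality to all Borel sets; since both total masses are
  1, the inequality on the complement is the reverse one.\<close>

lemma measure_eqI_compact:
  fixes M N :: "'a::euclidean_space measure"
  assumes M: "prob_space M" "sets M = sets borel" and N: "prob_space N" "sets N = sets borel"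
    and le: "\<And>K. compact K \<Longrightarrow> measure N K \<le> measure M K"
  shows "M = N"
proof -
  interpret M: prob_space M by fact
  interpret N: prob_space N by fact
  have sp: "space M = UNIV" "space N = UNIV"
    using sets_eq_imp_space_eq[OF M(2)] sets_eq_imp_space_eq[OF N(2)] by simp_all
  have 1: "measure N B \<le> measure M B" if B: "B \<in> sets borel" for B
  proof -
    have "emeasure N B = (SUP K \<in> {K. K \<subseteq> B \<and> compact K}. emeasure N K)"
      by (rule inner_regular) (use N B in auto)
    also have "\<dots> \<le> emeasure M B"
    proof (rule SUP_least)
      fix K assume "K \<in> {K. K \<subseteq> B \<and> compact K}"
      then have K: "K \<subseteq> B" "compact K" by auto
      have "emeasure N K \<le> emeasure M K"
        using le[OF K(2)] by (simp add: N.emeasure_eq_measure M.emeasure_eq_measure)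
      also have "\<dots> \<le> emeasure M B" using K(1) B M(2) by (intro emeasure_mono) auto
      finally show "emeasure N K \<le> emeasure M B" .
    qed
    finally show ?thesis by (simp add: N.emeasure_eq_measure M.emeasure_eq_measure)
  qed
  show ?thesis
  proof (rule measure_eqI)
    fix B assume "B \<in> sets M"
    then have B: "B \<in> sets borel" using M(2) by simp
    then have B': "UNIV - B \<in> sets borel" by auto
    have "measure M (UNIV - B) = 1 - measure M B" "measure N (UNIV - B) = 1 - measure N B"
      using M.prob_compl[of B] N.prob_compl[of B] B M(2) N(2) sp by auto
    with 1[OF B] 1[OF B'] show "emeasure M B = emeasure N B"
      by (simp add: M.emeasure_eq_measure N.emeasure_eq_measure)
  qed (use M N in simp)
qed

text \<open>Reduces the derivative of a barrier in the direction \<open>(1, v)\<close> to calculus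
  in one variable.\<close>

lemma frechet_derivative_along_line:
  fixes f :: "real \<times> 'b::euclidean_space \<Rightarrow> real"
  assumes "f differentiable (at (t, x))"
  shows "((\<lambda>s. f (s, x + (s - t) *\<^sub>R v)) has_real_derivative frechet_derivative f (at (t, x)) (1, v)) (at t)"
proof -
  let ?D = "frechet_derivative f (at (t, x))"
  have D: "(f has_derivative ?D) (at (t, x))" using assms by (simp add: frechet_derivative_works)
  have "((\<lambda>s. (s, x + (s - t) *\<^sub>R v)) has_derivative (\<lambda>h. (h, h *\<^sub>R v))) (at t)"
    by (auto intro!: derivative_eq_intros)
  from has_derivative_compose[OF this, of f ?D] D
  have "((\<lambda>s. f (s, x + (s - t) *\<^sub>R v)) has_derivative (\<lambda>h. ?D (h, h *\<^sub>R v))) (at t)" by simp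
  moreover have "?D (h, h *\<^sub>R v) = ?D (1, v) * h" for h
    using linear_scale[OF has_derivative_linear[OF D], of h "(1, v)"] by simp
  ultimately show ?thesis by (simp add: has_field_derivative_def)
qed

lemma closest_point_cball:
  fixes x y :: "'a::euclidean_space"
  assumes "0 \<le> R"
  shows "norm (closest_point (cball 0 R) x) \<le> R"
    and "norm (closest_point (cball 0 R) x - closest_point (cball 0 R) y) \<le> norm (x - y)"
proof -
  have ne: "cball (0::'a) R \<noteq> {}" using assms by simp
  show "norm (closest_point (cball 0 R) x) \<le> R"
    using closest_point_in_set[OF closed_cball ne, of x] by simp
  show "norm (closest_point (cball 0 R) x - closest_point (cball 0 R) y) \<le> norm (x - y)"
    using closest_point_lipschitz[OF convex_cball closed_cball ne, of x y] by (simp add: dist_norm)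
qed

definition is_flow :: "real \<Rightarrow> (real \<Rightarrow> 'b \<Rightarrow> 'b) \<Rightarrow> (real \<Rightarrow> 'b \<Rightarrow> 'b::real_normed_vector) \<Rightarrow> bool" where
  "is_flow T b X \<longleftrightarrow> (\<forall>x. X 0 x = x \<and>
     (\<forall>t\<in>{0..T}. ((\<lambda>s. X s x) has_vector_derivative b t (X t x)) (at t within {0..T})))"

section \<open>The projected velocity, its flow and the transport of mass\<close>

context transformer_field
begin

text \<open>Projecting onto the ball that carries the measures makes the velocity globally Lipschitz
  without changing it where there is mass.\<close>

definition drift :: "(real \<Rightarrow> (real^'d) measure) \<Rightarrow> real \<Rightarrow> real \<Rightarrow> real^'d \<Rightarrow> real^'d" where
  "drift \<mu> R t x = velocity \<rho> F (\<mu> t) (closest_point (cball 0 R) x)"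

lemma drift_eq: "norm x \<le> R \<Longrightarrow> drift \<mu> R t x = velocity \<rho> F (\<mu> t) x"
  by (simp add: drift_def closest_point_self)

lemma velocity_lipschitz_cost:
  assumes \<mu>: "confined \<mu> R" and \<mu>': "confined \<mu>' R" and \<gamma>: "\<gamma> \<in> couplings \<mu> \<mu>'"
    and x: "norm x \<le> R" "norm x' \<le> R"
  shows "norm (velocity \<rho> F \<mu> x - velocity \<rho> F \<mu>' x')
    \<le> Lip R * (norm (x - x') + sqrt (\<integral>(y, y'). (dist y y')\<^sup>2 \<partial>\<gamma>))"
proof -
  note d = couplings_dist_le_sqrt[OF confined_in_P2[OF \<mu>] confined_in_P2[OF \<mu>'] \<gamma>]
  show ?thesis
    using velocity_lipschitz[OF \<mu> \<mu>' \<gamma> x d(1)] mult_left_mono[OF add_left_mono[OF d(2), of "norm (x - x')"] Lip_nonneg[of R]]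
    by linarith
qed

lemma drift_lipschitz_cost:
  assumes "confined (\<mu> s) R" "confined (\<mu>' t) R" "\<gamma> \<in> couplings (\<mu> s) (\<mu>' t)"
  shows "norm (drift \<mu> R s x - drift \<mu>' R t x')
    \<le> Lip R * (norm (x - x') + sqrt (\<integral>(y, y'). (dist y y')\<^sup>2 \<partial>\<gamma>))"
proof -
  have R: "0 \<le> R" by (rule confined_radius_nonneg[OF assms(1)])
  show ?thesis
    unfolding drift_def
    using velocity_lipschitz_cost[OF assms closest_point_cball(1)[OF R, of x] closest_point_cball(1)[OF R, of x']]
      mult_left_mono[OF add_right_mono[OF closest_point_cball(2)[OF R, of x x']] Lip_nonneg[of R]]
    by (rule order_trans)
qed

text \<open>The case of the diagonal coupling of \<open>\<mu> t\<close> with itself, whose cost is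
  0.\<close>

lemma drift_lipschitz:
  assumes \<mu>: "confined (\<mu> t) R"
  shows "norm (drift \<mu> R t x - drift \<mu> R t x') \<le> Lip R * norm (x - x')"
proof -
  interpret prob_space "\<mu> t" using \<mu> by (simp add: confined_def)
  have s: "sets (\<mu> t) = sets borel" using \<mu> by (simp add: confined_def)
  have id: "(\<lambda>x. x) \<in> measurable (\<mu> t) borel" by (simp add: measurable_cong_sets[OF s refl])
  have d: "distr (\<mu> t) borel (\<lambda>x. x) = \<mu> t" using s by (intro distr_id2) simp
  have "norm (drift \<mu> R t x - drift \<mu> R t x') \<le> Lip R * (norm (x - x') +
      sqrt (\<integral>(y, y'). (dist y y')\<^sup>2 \<partial>distr (\<mu> t) (borel \<Otimes>\<^sub>M borel) (\<lambda>x. (x, x))))"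
    using joint_distr_coupling(1)[OF id id] unfolding d by (intro drift_lipschitz_cost \<mu>)
  then show ?thesis unfolding joint_distr_coupling(2)[OF id id] by simp
qed

lemma drift_norm_le:
  assumes \<mu>: "confined (\<mu> t) R"
  shows "norm (drift \<mu> R t x) \<le> D * R + norm (F 0) + D\<^sup>2 * L * R"
proof -
  have "D\<^sup>2 * L * norm (closest_point (cball 0 R) x) \<le> D\<^sup>2 * L * R"
    using closest_point_cball(1)[OF confined_radius_nonneg[OF \<mu>]] L_nonneg by (intro mult_left_mono) auto
  then show ?thesis
    unfolding drift_def using velocity_norm_le[OF \<mu>, of "closest_point (cball 0 R) x"] by linarith
qed

text \<open>Couplings with cost within \<open>1 / (n + 1)\<close> of the squared distance bound the
  change of drift by \<open>Lip R\<close> times the Wasserstein distance in the limit; continuity of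
  the curve does the rest.\<close>

lemma drift_continuous_time:
  assumes cv: "P2_continuous_curve T \<mu>" and conf: "\<And>t. t \<in> {0..T} \<Longrightarrow> confined (\<mu> t) R"
  shows "continuous_on {0..T} (\<lambda>t. drift \<mu> R t x)"
  unfolding continuous_on_def
proof
  fix t assume t: "t \<in> {0..T}"
  have lim: "((\<lambda>s. Lip R * wasserstein2 (\<mu> s) (\<mu> t)) \<longlongrightarrow> 0) (at t within {0..T})"
    using cv t by (intro tendsto_mult_right_zero) (auto simp: P2_continuous_curve_def)
  have "norm (drift \<mu> R s x - drift \<mu> R t x) \<le> Lip R * wasserstein2 (\<mu> s) (\<mu> t)" if s: "s \<in> {0..T}" for s
  proof -
    let ?w = "wasserstein2 (\<mu> s) (\<mu> t)"
    note P2 = confined_in_P2[OF conf[OF s]] confined_in_P2[OF conf[OF t]]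
    have le: "norm (drift \<mu> R s x - drift \<mu> R t x) \<le> Lip R * sqrt (?w\<^sup>2 + inverse (real (Suc n)))" for n
    proof -
      obtain \<gamma> where \<gamma>: "\<gamma> \<in> couplings (\<mu> s) (\<mu> t)"
        "(\<integral>(x, y). (dist x y)\<^sup>2 \<partial>\<gamma>) < ?w\<^sup>2 + inverse (real (Suc n))"
        using wasserstein2_approx[OF P2, of "inverse (real (Suc n))"] by auto
      have "norm (drift \<mu> R s x - drift \<mu> R t x) \<le> Lip R * (norm (x - x) + sqrt (\<integral>(x, y). (dist x y)\<^sup>2 \<partial>\<gamma>))"
        by (intro drift_lipschitz_cost conf s t \<gamma>(1))
      also have "\<dots> \<le> Lip R * sqrt (?w\<^sup>2 + inverse (real (Suc n)))"
        using \<gamma>(2) Lip_nonneg by (intro mult_left_mono) auto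
      finally show ?thesis .
    qed
    have "(\<lambda>n. Lip R * sqrt (?w\<^sup>2 + inverse (real (Suc n)))) \<longlonglongrightarrow> Lip R * sqrt (?w\<^sup>2 + 0)"
      by (intro tendsto_intros LIMSEQ_inverse_real_of_nat)
    then have "norm (drift \<mu> R s x - drift \<mu> R t x) \<le> Lip R * sqrt (?w\<^sup>2 + 0)"
      by (rule LIMSEQ_le_const) (use le in auto)
    then show ?thesis using wasserstein2_nonneg[OF P2] by simp
  qed
  then have "\<forall>\<^sub>F s in at t within {0..T}. norm (drift \<mu> R s x - drift \<mu> R t x) \<le> Lip R * wasserstein2 (\<mu> s) (\<mu> t)"
    by (auto simp: eventually_at_filter)
  then have "((\<lambda>s. drift \<mu> R s x - drift \<mu> R t x) \<longlongrightarrow> 0) (at t within {0..T})"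
    by (rule Lim_null_comparison[OF _ lim])
  then show "((\<lambda>s. drift \<mu> R s x) \<longlongrightarrow> drift \<mu> R t x) (at t within {0..T})"
    by (simp add: LIM_zero_iff)
qed

lemma drift_flow_exists:
  assumes "0 \<le> T" "P2_continuous_curve T \<mu>" "\<And>t. t \<in> {0..T} \<Longrightarrow> confined (\<mu> t) R"
  obtains X where "is_flow T (drift \<mu> R) X"
proof -
  have "\<exists>\<xi>. \<xi> 0 = x \<and> (\<forall>t\<in>{0..T}. (\<xi> has_vector_derivative drift \<mu> R t (\<xi> t)) (at t within {0..T}))" for x
    by (rule picard_lindelof[OF assms(1) Lip_nonneg drift_lipschitz[OF assms(3)] drift_continuous_time[OF assms(2,3)]])
  then obtain \<Xi> where "\<forall>x. \<Xi> x 0 = x \<and> (\<forall>t\<in>{0..T}. (\<Xi> x has_vector_derivative drift \<mu> R t (\<Xi> x t)) (at t within {0..T}))"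
    by metis
  then have "is_flow T (drift \<mu> R) (\<lambda>t x. \<Xi> x t)" by (simp add: is_flow_def)
  then show thesis by (rule that)
qed

lemma drift_flow_continuous:
  assumes X: "is_flow T (drift \<mu> R) X" and conf: "\<And>t. t \<in> {0..T} \<Longrightarrow> confined (\<mu> t) R" and t: "t \<in> {0..T}"
  shows "continuous_on A (X t)"
proof (rule lipschitz_on_continuous_on)
  have "norm (X t x - X t y) \<le> exp (Lip R * t) * norm (x - y)" for x y
    using trajectory_lipschitz[of T "\<lambda>s. X s x" "drift \<mu> R" "\<lambda>s. X s y" "Lip R" t]
      X drift_lipschitz[OF conf] t by (auto simp: is_flow_def)
  then show "(exp (Lip R * t))-lipschitz_on A (X t)"
    by (auto simp: lipschitz_on_def dist_norm)
qed

text \<open>A ball centred on a trajectory and expanding at the rate of the Lipschitz constant cannot lose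
  mass. The barrier is a smooth indicator of a finite union of such balls; since trajectories are only
  \<open>C\<^sup>1\<close> in time, their centres \<open>Z\<close> are polynomial approximations of the trajectories, and the term
  \<open>- r\<^sup>2 t\<close> in \<open>q\<close> absorbs the error.\<close>

lemma moving_balls_estimate:
  assumes w: "weak_solution T \<rho> F \<mu>\<^sub>0 \<mu>" and conf: "\<And>t. t \<in> {0..T} \<Longrightarrow> confined (\<mu> t) R"
    and X: "is_flow T (drift \<mu> R) X" and t: "t \<in> {0..T}"
    and I: "finite I" "E \<subseteq> (\<Union>x\<in>I. ball x r)" and r: "r > 0" and E: "E \<in> sets borel"
    and N: "N \<in> sets borel" "\<And>x y. y \<in> I \<Longrightarrow> norm (x - X t y) \<le> (exp ((Lip R + 1) * T) * sqrt (2 + T) + 1) * r \<Longrightarrow> x \<in> N"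
  shows "measure \<mu>\<^sub>0 E \<le> measure (\<mu> t) N"
proof -
  have T: "0 \<le> T" using t by simp
  have cv: "P2_continuous_curve T \<mu>" and \<mu>0: "\<mu> 0 = \<mu>\<^sub>0" using w by (auto simp: weak_solution_def)
  let ?\<Lambda> = "Lip R"
  have \<Lambda>: "0 \<le> ?\<Lambda>" by (rule Lip_nonneg)
  let ?b = "drift \<mu> R"
  have b_lip: "norm (?b \<tau> y - ?b \<tau> z) \<le> ?\<Lambda> * norm (y - z)" if "\<tau> \<in> {0..T}" for \<tau> y z
    by (intro drift_lipschitz conf that)
  obtain S S' :: "real \<Rightarrow> real" where S: "smooth S" "\<And>x. (S has_real_derivative S' x) (at x)"
    "\<And>x. S' x \<ge> 0" "\<And>x. x \<le> 0 \<Longrightarrow> S x = 0" "\<And>x. x \<ge> 1 \<Longrightarrow> S x = 1"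
    "\<And>x. x \<le> 0 \<Longrightarrow> S' x = 0" "\<And>x. x \<ge> 1 \<Longrightarrow> S' x = 0" "\<And>x. 0 \<le> S x" "\<And>x. S x \<le> 1"
    by (rule smooth_step_exists, rule that; assumption)
  have "\<exists>Z Z'. Z 0 = x \<and> (\<forall>\<tau>. (Z has_vector_derivative Z' \<tau>) (at \<tau>)) \<and> (\<forall>i. smooth (\<lambda>\<tau>. Z \<tau> \<bullet> i)) \<and>
      (\<forall>\<tau>\<in>{0..T}. norm (Z \<tau> - X \<tau> x) \<le> r) \<and> (\<forall>\<tau>\<in>{0..T}. norm (Z' \<tau> - ?b \<tau> (Z \<tau>)) \<le> r)" for x
  proof -
    have der: "\<And>\<tau>. \<tau> \<in> {0..T} \<Longrightarrow> ((\<lambda>s. X s x) has_vector_derivative ?b \<tau> (X \<tau> x)) (at \<tau> within {0..T})"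
      using X by (simp add: is_flow_def)
    have cont: "continuous_on {0..T} (\<lambda>\<tau>. ?b \<tau> (X \<tau> x))"
      by (rule continuous_on_lipschitz_compose[OF drift_lipschitz[OF conf] drift_continuous_time[OF cv conf]
            continuous_on_vector_derivative[OF der]])
    \<comment> \<open>Evaluating the drift at \<open>Z\<close> instead of \<open>X\<close> costs a
      further \<open>?\<Lambda>\<close> times the position error, so this tolerance adds up to
      exactly \<open>r\<close>.\<close>
    have "0 < r / (1 + ?\<Lambda>)" using r \<Lambda> by simp
    from smooth_curve_approximation[OF T der cont this] obtain Z Z' where Z: "Z 0 = X 0 x"
      "\<And>\<tau>. (Z has_vector_derivative Z' \<tau>) (at \<tau>)" "\<And>i. smooth (\<lambda>\<tau>. Z \<tau> \<bullet> i)"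
      "\<And>\<tau>. \<tau> \<in> {0..T} \<Longrightarrow> norm (Z \<tau> - X \<tau> x) \<le> r / (1 + ?\<Lambda>)"
      "\<And>\<tau>. \<tau> \<in> {0..T} \<Longrightarrow> norm (Z' \<tau> - ?b \<tau> (X \<tau> x)) \<le> r / (1 + ?\<Lambda>)"
      by blast
    have "norm (Z' \<tau> - ?b \<tau> (Z \<tau>)) \<le> r" if \<tau>: "\<tau> \<in> {0..T}" for \<tau>
    proof -
      have "norm (?b \<tau> (X \<tau> x) - ?b \<tau> (Z \<tau>)) \<le> ?\<Lambda> * norm (X \<tau> x - Z \<tau>)"
        by (rule b_lip[OF \<tau>])
      also have "\<dots> \<le> ?\<Lambda> * (r / (1 + ?\<Lambda>))"
        using Z(4)[OF \<tau>] \<Lambda> by (intro mult_left_mono) (simp_all add: norm_minus_commute)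
      finally have "norm (Z' \<tau> - ?b \<tau> (Z \<tau>)) \<le> r / (1 + ?\<Lambda>) + ?\<Lambda> * (r / (1 + ?\<Lambda>))"
        using Z(5)[OF \<tau>] norm_triangle_ineq[of "Z' \<tau> - ?b \<tau> (X \<tau> x)" "?b \<tau> (X \<tau> x) - ?b \<tau> (Z \<tau>)"] by simp
      also have "\<dots> = (1 + ?\<Lambda>) * (r / (1 + ?\<Lambda>))" by (simp only: distrib_right mult_1)
      also have "\<dots> = r" using \<Lambda> by simp
      finally show ?thesis .
    qed
    moreover have "r / (1 + ?\<Lambda>) \<le> r" using r \<Lambda> by (simp add: field_simps)
    then have "norm (Z \<tau> - X \<tau> x) \<le> r" if "\<tau> \<in> {0..T}" for \<tau>
      using Z(4)[OF that] by (rule order_trans[rotated])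
    moreover have "Z 0 = x" using Z(1) X by (simp add: is_flow_def)
    ultimately show ?thesis
      using Z(2,3) by (intro exI[of _ Z] exI[of _ Z'] conjI allI ballI)
  qed
  then obtain Z Z' where Z: "\<And>x. Z x 0 = x" "\<And>x \<tau>. (Z x has_vector_derivative Z' x \<tau>) (at \<tau>)"
    "\<And>x i. smooth (\<lambda>\<tau>. Z x \<tau> \<bullet> i)" "\<And>x \<tau>. \<tau> \<in> {0..T} \<Longrightarrow> norm (Z x \<tau> - X \<tau> x) \<le> r"
    "\<And>x \<tau>. \<tau> \<in> {0..T} \<Longrightarrow> norm (Z' x \<tau> - ?b \<tau> (Z x \<tau>)) \<le> r"
    by metis
  \<comment> \<open>Half of \<open>c\<close> is \<open>?\<Lambda> + 1\<close>:
    \<open>?\<Lambda>\<close> offsets the divergence of nearby trajectories, and the extra 1 takes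
    up the quadratic part of the error made by following \<open>Z\<close>.\<close>
  define c where "c = 2 * (?\<Lambda> + 1)"
  have c0: "0 \<le> c" using \<Lambda> by (simp add: c_def)
  define q where "q i z = exp (- c * fst z) * (norm (snd z - Z i (fst z)))\<^sup>2 - r\<^sup>2 * fst z" for i and z :: "real \<times> (real^'d)"
  \<comment> \<open>Each inner step is 1 for \<open>q i z <= r^2\<close>, which at time 0 contains
    the ball of radius \<open>r\<close>, and 0 for \<open>q i z >= 2 * r^2\<close>. The outer step
    sends every sum that is at least 1 to 1: a smooth substitute for the maximum that is monotone in
    each summand.\<close>
  define f where "f z = S (\<Sum>i\<in>I. S (2 - q i z / r\<^sup>2))" for z
  have q_smooth: "smooth (q i)" for i
  proof -
    have "smooth (\<lambda>z::real \<times> (real^'d). (norm (snd z - Z i (fst z)))\<^sup>2)"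
    proof (rule smooth_norm_squared)
      fix j :: "real^'d"
      show "smooth (\<lambda>z::real \<times> (real^'d). (snd z - Z i (fst z)) \<bullet> j)"
        unfolding inner_diff_left
        by (intro smooth_diff smooth_compose[OF Z(3) smooth_fst]
            smooth_bounded_linear[OF bounded_linear_compose[OF bounded_linear_inner_left bounded_linear_snd]])
    qed
    then show ?thesis
      unfolding q_def[abs_def] by (intro smooth_diff smooth_mult smooth_exp smooth_const smooth_fst)
  qed
  have f: "smooth f"
    unfolding f_def[abs_def]
    by (intro smooth_compose[OF S(1)] smooth_sum smooth_diff smooth_const smooth_divide_const q_smooth)
  have q_less: "\<exists>i\<in>I. q i z < 2 * r\<^sup>2" if "f z \<noteq> 0" for z
  proof (rule ccontr)
    assume *: "\<not> ?thesis"
    have "(\<Sum>i\<in>I. S (2 - q i z / r\<^sup>2)) = 0"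
    proof (intro sum.neutral ballI S(4))
      fix i assume "i \<in> I"
      with * have "2 * r\<^sup>2 \<le> q i z" by auto
      then show "2 - q i z / r\<^sup>2 \<le> 0" using r by (simp add: field_simps)
    qed
    then show False using that S(4)[of 0] by (simp add: f_def)
  qed
  \<comment> \<open>Solving \<open>q < 2 * r^2\<close> for the distance; the factor
    \<open>2 + \<tau>\<close> collects the threshold and the correction \<open>r^2 * \<tau>\<close>.
    This is the radius in the hypothesis on \<open>N\<close>, where the additional \<open>r\<close>
    covers the distance from \<open>Z\<close> to the true trajectory.\<close>
  have near: "norm (x - Z i \<tau>) \<le> exp ((?\<Lambda> + 1) * \<tau>) * sqrt (2 + \<tau>) * r"
    if "q i (\<tau>, x) < 2 * r\<^sup>2" "- 1 \<le> \<tau>" for i \<tau> x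
  proof -
    have "exp (- c * \<tau>) * (norm (x - Z i \<tau>))\<^sup>2 \<le> (2 + \<tau>) * r\<^sup>2"
      using that(1) by (simp add: q_def algebra_simps)
    then have "(norm (x - Z i \<tau>))\<^sup>2 \<le> exp (c * \<tau>) * ((2 + \<tau>) * r\<^sup>2)"
      by (simp add: exp_minus field_simps)
    also have "exp (c * \<tau>) = (exp ((?\<Lambda> + 1) * \<tau>))\<^sup>2"
      by (simp add: c_def exp_double[symmetric] algebra_simps)
    also have "(exp ((?\<Lambda> + 1) * \<tau>))\<^sup>2 * ((2 + \<tau>) * r\<^sup>2) = (exp ((?\<Lambda> + 1) * \<tau>) * sqrt (2 + \<tau>) * r)\<^sup>2"
      using that(2) by (simp add: power_mult_distrib)
    finally show ?thesis by (rule power2_le_imp_le) (use r that(2) in simp)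
  qed
  have "bounded (\<Union>i\<in>I. Z i ` {- 1..T + 1})"
  proof (rule bounded_UN[OF I(1)], rule ballI)
    fix i
    have "continuous_on {- 1..T + 1} (Z i)"
      using has_vector_derivative_continuous[OF Z(2)] by (simp add: continuous_at_imp_continuous_on)
    then show "bounded (Z i ` {- 1..T + 1})"
      by (intro compact_imp_bounded compact_continuous_image) auto
  qed
  then obtain B where B: "\<And>i \<tau>. i \<in> I \<Longrightarrow> \<tau> \<in> {- 1..T + 1} \<Longrightarrow> norm (Z i \<tau>) \<le> B"
    unfolding bounded_iff by blast
  define M where "M = B + exp ((?\<Lambda> + 1) * (T + 1)) * sqrt (2 + (T + 1)) * r"
  have supp: "norm x \<le> M" if \<tau>: "- 1 \<le> \<tau>" "\<tau> \<le> T + 1" and nz: "f (\<tau>, x) \<noteq> 0" for \<tau> x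
  proof -
    obtain i where i: "i \<in> I" "q i (\<tau>, x) < 2 * r\<^sup>2" using q_less[OF nz] by blast
    have "norm (x - Z i \<tau>) \<le> exp ((?\<Lambda> + 1) * \<tau>) * sqrt (2 + \<tau>) * r" by (rule near[OF i(2) \<tau>(1)])
    also have "\<dots> \<le> exp ((?\<Lambda> + 1) * (T + 1)) * sqrt (2 + (T + 1)) * r"
      using \<tau> \<Lambda> r by (intro mult_right_mono mult_mono) (auto intro!: mult_left_mono)
    finally show ?thesis
      using B[OF i(1), of \<tau>] \<tau> norm_triangle_ineq[of "x - Z i \<tau>" "Z i \<tau>"] by (simp add: M_def)
  qed
  have "(\<integral>x. f (0, x) \<partial>\<mu> 0) \<le> (\<integral>x. f (t, x) \<partial>\<mu> t)"
  proof (rule weak_solution_barrier[OF w f supp])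
    show "0 \<le> (0::real)" "0 \<le> t" "t \<le> T" using t by auto
    fix \<tau> assume "0 \<le> \<tau>" "\<tau> \<le> t"
    then have \<tau>: "\<tau> \<in> {0..T}" "0 \<le> \<tau>" using t by auto
    have pt: "0 \<le> frechet_derivative f (at (\<tau>, x)) (1, velocity \<rho> F (\<mu> \<tau>) x)" if x: "norm x \<le> R" for x
    proof -
      define v where "v = velocity \<rho> F (\<mu> \<tau>) x"
      have v: "v = ?b \<tau> x" by (simp add: v_def drift_eq[OF x])
      define u where "u i s = x + (s - \<tau>) *\<^sub>R v - Z i s" for i s
      define Q where "Q i = exp (- c * \<tau>) * (2 * (u i \<tau> \<bullet> (v - Z' i \<tau>)) - c * (norm (u i \<tau>))\<^sup>2) - r\<^sup>2" for i
      have u': "(u i has_vector_derivative v - Z' i \<tau>) (at \<tau>)" for i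
        unfolding u_def by (auto intro!: derivative_eq_intros Z(2))
      have Q': "((\<lambda>s. q i (s, x + (s - \<tau>) *\<^sub>R v)) has_real_derivative Q i) (at \<tau>)" for i
      proof -
        have "((\<lambda>s. exp (- c * s) * (norm (u i s))\<^sup>2 - r\<^sup>2 * s) has_real_derivative Q i) (at \<tau>)"
          unfolding Q_def
          using DERIV_diff[OF has_real_derivative_weighted_norm[OF u'] DERIV_cmult_Id[of "r\<^sup>2"]] by simp
        then show ?thesis by (simp add: q_def u_def)
      qed
      have Q_le: "Q i \<le> 0" for i
      proof -
        have "u i \<tau> \<bullet> (v - Z' i \<tau>) = u i \<tau> \<bullet> (?b \<tau> x - ?b \<tau> (Z i \<tau>)) + u i \<tau> \<bullet> (?b \<tau> (Z i \<tau>) - Z' i \<tau>)"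
          by (simp add: v inner_diff_right)
        also have "\<dots> \<le> norm (u i \<tau>) * (?\<Lambda> * norm (u i \<tau>)) + norm (u i \<tau>) * r"
        proof (intro add_mono)
          show "u i \<tau> \<bullet> (?b \<tau> x - ?b \<tau> (Z i \<tau>)) \<le> norm (u i \<tau>) * (?\<Lambda> * norm (u i \<tau>))"
            using b_lip[OF \<tau>(1), of x "Z i \<tau>"]
            by (intro order_trans[OF norm_cauchy_schwarz] mult_left_mono) (simp_all add: u_def)
          show "u i \<tau> \<bullet> (?b \<tau> (Z i \<tau>) - Z' i \<tau>) \<le> norm (u i \<tau>) * r"
            using Z(5)[OF \<tau>(1), of i]
            by (intro order_trans[OF norm_cauchy_schwarz] mult_left_mono) (simp_all add: norm_minus_commute)
        qed
        \<comment> \<open>Young's inequality: doubled, its square is cancelled by the extra 1 in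
          \<open>c\<close>, and the remaining \<open>r^2 / 2\<close> is below the rate
          \<open>r^2\<close> at which \<open>q\<close> is lowered.\<close>
        also have "norm (u i \<tau>) * r \<le> (norm (u i \<tau>))\<^sup>2 + r\<^sup>2 / 4"
          using zero_le_power2[of "norm (u i \<tau>) - r / 2"] by (simp add: power2_diff power_divide)
        finally have "2 * (u i \<tau> \<bullet> (v - Z' i \<tau>)) - c * (norm (u i \<tau>))\<^sup>2 \<le> r\<^sup>2 / 2"
          by (simp add: c_def algebra_simps power2_eq_square)
        then have "exp (- c * \<tau>) * (2 * (u i \<tau> \<bullet> (v - Z' i \<tau>)) - c * (norm (u i \<tau>))\<^sup>2) \<le> exp (- c * \<tau>) * (r\<^sup>2 / 2)"
          by (intro mult_left_mono) auto
        also have "\<dots> \<le> 1 * (r\<^sup>2 / 2)" using c0 \<tau> by (intro mult_right_mono) auto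
        also have "\<dots> \<le> r\<^sup>2" by simp
        finally show ?thesis by (simp add: Q_def)
      qed
      have "((\<lambda>s. f (s, x + (s - \<tau>) *\<^sub>R v)) has_real_derivative
          S' (\<Sum>i\<in>I. S (2 - q i (\<tau>, x + (\<tau> - \<tau>) *\<^sub>R v) / r\<^sup>2)) *
            (\<Sum>i\<in>I. S' (2 - q i (\<tau>, x + (\<tau> - \<tau>) *\<^sub>R v) / r\<^sup>2) * (0 - Q i / r\<^sup>2))) (at \<tau>)"
        unfolding f_def
        by (intro DERIV_chain'[OF _ S(2)] DERIV_sum DERIV_diff DERIV_const DERIV_cdivide Q')
      from DERIV_unique[OF frechet_derivative_along_line[OF smooth_differentiable[OF f]] this]
      have "frechet_derivative f (at (\<tau>, x)) (1, v) =
          S' (\<Sum>i\<in>I. S (2 - q i (\<tau>, x + (\<tau> - \<tau>) *\<^sub>R v) / r\<^sup>2)) *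
            (\<Sum>i\<in>I. S' (2 - q i (\<tau>, x + (\<tau> - \<tau>) *\<^sub>R v) / r\<^sup>2) * (0 - Q i / r\<^sup>2))" .
      also have "\<dots> \<ge> 0"
        using Q_le S(3) r by (intro mult_nonneg_nonneg sum_nonneg) (auto simp: divide_nonpos_pos)
      finally show ?thesis by (simp add: v_def)
    qed
    have "AE x in \<mu> \<tau>. norm x \<le> R" using conf[OF \<tau>(1)] by (simp add: confined_def)
    then show "AE x in \<mu> \<tau>. 0 \<le> frechet_derivative f (at (\<tau>, x)) (1, velocity \<rho> F (\<mu> \<tau>) x)"
      by eventually_elim (rule pt)
  qed
  moreover have "measure (\<mu> 0) E \<le> (\<integral>x. f (0, x) \<partial>\<mu> 0)" and "(\<integral>x. f (t, x) \<partial>\<mu> t) \<le> measure (\<mu> t) N"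
  proof -
    have f01: "0 \<le> f z" "f z \<le> 1" for z using S(8,9) by (auto simp: f_def)
    have fm: "(\<lambda>x. f (s, x)) \<in> borel_measurable borel" for s
      by (intro borel_measurable_continuous_onI continuous_on_compose2[OF smooth_continuous_on[OF f], of UNIV])
        (auto intro: continuous_intros)
    have int: "integrable (\<mu> s) (\<lambda>x. f (s, x))" "integrable (\<mu> s) (indicat_real A)" "prob_space (\<mu> s)"
      if s: "s \<in> {0..T}" and A: "A \<in> sets borel" for s and A :: "(real^'d) set"
    proof -
      interpret prob_space "\<mu> s" by (rule weak_solution_prob(2)[OF w s])
      have st: "sets (\<mu> s) = sets borel" by (rule weak_solution_prob(3)[OF w s])
      show "integrable (\<mu> s) (\<lambda>x. f (s, x))"
        by (rule integrable_const_bound[of _ 1])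
          (use f01 fm in \<open>simp_all add: measurable_cong_sets[OF st refl]\<close>)
      show "integrable (\<mu> s) (indicat_real A)"
        by (rule integrable_real_indicator) (use A st in \<open>simp_all add: less_top[symmetric]\<close>)
      show "prob_space (\<mu> s)" by (rule prob_space_axioms)
    qed
    have z: "0 \<in> {0..T}" using T by simp
    have "measure (\<mu> 0) E = (\<integral>x. indicat_real E x \<partial>\<mu> 0)"
      using E weak_solution_prob(3)[OF w z] sets_eq_imp_space_eq[OF weak_solution_prob(3)[OF w z]] by simp
    also have "\<dots> \<le> (\<integral>x. f (0, x) \<partial>\<mu> 0)"
    proof (rule integral_mono[OF int(2)[OF z E] int(1)[OF z E]])
      fix x
      show "indicat_real E x \<le> f (0, x)"
      proof (cases "x \<in> E")
        case True
        then obtain i where i: "i \<in> I" "norm (x - i) < r" using I(2) by (auto simp: dist_norm norm_minus_commute)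
        have "q i (0, x) \<le> r\<^sup>2" using i r by (simp add: q_def Z(1) power_mono less_imp_le)
        then have "S (2 - q i (0, x) / r\<^sup>2) = 1" using r by (intro S(5)) (simp add: field_simps)
        moreover have "S (2 - q i (0, x) / r\<^sup>2) \<le> (\<Sum>i\<in>I. S (2 - q i (0, x) / r\<^sup>2))"
          using I(1) i(1) S(8) by (intro member_le_sum) auto
        ultimately have "f (0, x) = 1" unfolding f_def by (intro S(5)) simp
        then show ?thesis by simp
      qed (use f01 in simp)
    qed
    finally show "measure (\<mu> 0) E \<le> (\<integral>x. f (0, x) \<partial>\<mu> 0)" .
    have "(\<integral>x. f (t, x) \<partial>\<mu> t) \<le> (\<integral>x. indicat_real N x \<partial>\<mu> t)"
    proof (rule integral_mono[OF int(1)[OF t N(1)] int(2)[OF t N(1)]])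
      fix x
      show "f (t, x) \<le> indicat_real N x"
      proof (cases "f (t, x) = 0")
        case False
        obtain i where i: "i \<in> I" "q i (t, x) < 2 * r\<^sup>2" using q_less[OF False] by blast
        have "norm (x - Z i t) \<le> exp ((?\<Lambda> + 1) * t) * sqrt (2 + t) * r" by (rule near[OF i(2)]) (use t in auto)
        also have "\<dots> \<le> exp ((?\<Lambda> + 1) * T) * sqrt (2 + T) * r"
          using t \<Lambda> r by (intro mult_right_mono mult_mono) (auto intro!: mult_left_mono)
        finally have "norm (x - X t i) \<le> exp ((?\<Lambda> + 1) * T) * sqrt (2 + T) * r + r"
          using Z(4)[OF t, of i] norm_triangle_ineq[of "x - Z i t" "Z i t - X t i"] by simp
        then have "x \<in> N" by (intro N(2)[OF i(1)]) (simp add: algebra_simps)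
        then show ?thesis using f01 by simp
      qed simp
    qed
    also have "\<dots> = measure (\<mu> t) N"
      using N weak_solution_prob(3)[OF w t] sets_eq_imp_space_eq[OF weak_solution_prob(3)[OF w t]] by simp
    finally show "(\<integral>x. f (t, x) \<partial>\<mu> t) \<le> measure (\<mu> t) N" .
  qed
  ultimately show ?thesis using \<mu>0 by simp
qed

text \<open>For compact \<open>A\<close>, the part of its preimage in the ball is compact, hence
  covered by finitely many balls of radius \<open>1 / (n + 1)\<close> centred in it. The centres
  flow into \<open>A\<close>, so \<open>moving_balls_estimate\<close> puts the mass of the preimage
  into a neighbourhood of \<open>A\<close> of radius proportional to \<open>1 / (n + 1)\<close>;
  these shrink to \<open>A\<close>.\<close>

lemma weak_solution_eq_flow:
  assumes w: "weak_solution T \<rho> F \<mu>\<^sub>0 \<mu>" and conf: "\<And>t. t \<in> {0..T} \<Longrightarrow> confined (\<mu> t) R"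
    and X: "is_flow T (drift \<mu> R) X" and t: "t \<in> {0..T}"
  shows "\<mu> t = distr \<mu>\<^sub>0 borel (X t)"
proof -
  have z: "0 \<in> {0..T}" using t by simp
  have \<mu>0: "\<mu> 0 = \<mu>\<^sub>0" using w by (simp add: weak_solution_def)
  have conf0: "confined \<mu>\<^sub>0 R" using conf[OF z] \<mu>0 by simp
  interpret M0: prob_space \<mu>\<^sub>0 using conf0 by (simp add: confined_def)
  interpret Mt: prob_space "\<mu> t" by (rule weak_solution_prob(2)[OF w t])
  have s0: "sets \<mu>\<^sub>0 = sets borel" using conf0 by (simp add: confined_def)
  have st: "sets (\<mu> t) = sets borel" by (rule weak_solution_prob(3)[OF w t])
  have cX: "continuous_on UNIV (X t)" by (rule drift_flow_continuous[OF X conf t])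
  have mX: "X t \<in> measurable \<mu>\<^sub>0 borel"
    unfolding measurable_cong_sets[OF s0 refl] by (rule borel_measurable_continuous_onI[OF cX])
  show ?thesis
  proof (rule measure_eqI_compact[OF Mt.prob_space_axioms st])
    show "prob_space (distr \<mu>\<^sub>0 borel (X t))" by (rule M0.prob_space_distr[OF mX])
    fix A :: "(real^'d) set" assume A: "compact A"
    \<comment> \<open>Intersecting with the ball makes the closed preimage compact and loses no mass
      of \<open>\<mu>\<^sub>0\<close>.\<close>
    define E where "E = X t -` A \<inter> cball 0 R"
    have "closed (X t -` A)" by (rule closed_vimage[OF compact_imp_closed[OF A] cX])
    then have E: "compact E" "E \<in> sets borel"
      unfolding E_def by (auto intro: closed_Int_compact)
    have sp: "space \<mu>\<^sub>0 = UNIV" using sets_eq_imp_space_eq[OF s0] by simp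
    have mE: "measure (distr \<mu>\<^sub>0 borel (X t)) A = measure \<mu>\<^sub>0 E"
    proof -
      have "AE x in \<mu>\<^sub>0. norm x \<le> R" using conf0 by (simp add: confined_def)
      then have "AE x in \<mu>\<^sub>0. x \<in> X t -` A \<longleftrightarrow> x \<in> E"
        by eventually_elim (simp add: E_def)
      moreover have "X t -` A \<in> sets \<mu>\<^sub>0"
        using measurable_sets[OF mX, of A] compact_imp_closed[OF A] sp by auto
      ultimately have "measure \<mu>\<^sub>0 (X t -` A) = measure \<mu>\<^sub>0 E"
        using E(2) s0 by (intro M0.finite_measure_eq_AE) auto
      then show ?thesis
        using compact_imp_closed[OF A] sp by (simp add: measure_distr[OF mX])
    qed
    show "measure (distr \<mu>\<^sub>0 borel (X t)) A \<le> measure (\<mu> t) A"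
    proof (cases "E = {}")
      case True
      then show ?thesis using mE by simp
    next
      case False
      then have ne: "A \<noteq> {}" by (auto simp: E_def)
      define c where "c = exp ((Lip R + 1) * T) * sqrt (2 + T) + 1"
      have c0: "0 \<le> c" using t by (simp add: c_def)
      define N where "N n = {x. infdist x A \<le> c * inverse (real (Suc n))}" for n
      have N_closed: "closed (N n)" for n
        unfolding N_def by (intro closed_Collect_le continuous_intros)
      have le: "measure \<mu>\<^sub>0 E \<le> measure (\<mu> t) (N n)" for n
      proof -
        have r: "inverse (real (Suc n)) > 0" by simp
        from seq_compact_imp_totally_bounded[OF compact_imp_seq_compact[OF E(1)], rule_format, OF r]
        obtain I where I: "finite I" "I \<subseteq> E" "E \<subseteq> (\<Union>x\<in>I. ball x (inverse (real (Suc n))))"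
          by (elim exE conjE)
        show ?thesis
        proof (rule moving_balls_estimate[OF w conf X t I(1,3) r E(2)])
          show "N n \<in> sets borel" using N_closed by simp
          fix x y assume y: "y \<in> I" and xy: "norm (x - X t y) \<le> (exp ((Lip R + 1) * T) * sqrt (2 + T) + 1) * inverse (real (Suc n))"
          have "X t y \<in> A" using y I(2) by (auto simp: E_def)
          then have "infdist x A \<le> dist x (X t y)" by (rule infdist_le)
          then show "x \<in> N n" using xy by (simp add: N_def c_def dist_norm)
        qed
      qed
      have "decseq N"
      proof (rule decseq_SucI, rule subsetI)
        fix n x assume x: "x \<in> N (Suc n)"
        have "c * inverse (real (Suc (Suc n))) \<le> c * inverse (real (Suc n))"
          using c0 by (intro mult_left_mono le_imp_inverse_le) auto
        then show "x \<in> N n" using x unfolding N_def mem_Collect_eq by (rule order_trans[rotated])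
      qed
      then have "(\<lambda>n. measure (\<mu> t) (N n)) \<longlonglongrightarrow> measure (\<mu> t) (\<Inter>n. N n)"
        using N_closed st by (intro Mt.finite_Lim_measure_decseq) auto
      also have "(\<Inter>n. N n) = A"
      proof (intro equalityI subsetI)
        fix x assume "x \<in> (\<Inter>n. N n)"
        then have "infdist x A \<le> c * inverse (real (Suc n))" for n by (auto simp: N_def)
        moreover have "(\<lambda>n. c * inverse (real (Suc n))) \<longlonglongrightarrow> c * 0"
          by (intro tendsto_intros LIMSEQ_inverse_real_of_nat)
        ultimately have "infdist x A \<le> c * 0" by (intro LIMSEQ_le_const) auto
        then have "infdist x A = 0" using infdist_nonneg[of x A] by simp
        then show "x \<in> A" using in_closed_iff_infdist_zero[OF compact_imp_closed[OF A] ne] by simp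
      next
        fix x assume "x \<in> A"
        then show "x \<in> (\<Inter>n. N n)" using c0 by (simp add: N_def)
      qed
      finally have "measure \<mu>\<^sub>0 E \<le> measure (\<mu> t) A"
        by (rule LIMSEQ_le_const) (use le in auto)
      then show ?thesis using mE by simp
    qed
  qed simp
qed

text \<open>The coupling of the initial data is pushed forward along the two flows.\<close>

lemma flow_stability:
  fixes \<gamma> :: "((real^'d) \<times> (real^'d)) measure"
  assumes T: "0 \<le> T" and cv: "P2_continuous_curve T \<mu>" "P2_continuous_curve T \<mu>'"
    and conf: "\<And>t. t \<in> {0..T} \<Longrightarrow> confined (\<mu> t) R" "\<And>t. t \<in> {0..T} \<Longrightarrow> confined (\<mu>' t) R"
    and X: "is_flow T (drift \<mu> R) X" and X': "is_flow T (drift \<mu>' R) X'"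
    and eq: "\<And>t. t \<in> {0..T} \<Longrightarrow> \<mu> t = distr (\<mu> 0) borel (X t)" "\<And>t. t \<in> {0..T} \<Longrightarrow> \<mu>' t = distr (\<mu>' 0) borel (X' t)"
    and \<gamma>: "\<gamma> \<in> couplings (\<mu> 0) (\<mu>' 0)" and t: "t \<in> {0..T}"
  defines "cost \<equiv> \<lambda>t. \<integral>z. (norm (X t (fst z) - X' t (snd z)))\<^sup>2 \<partial>\<gamma>"
  shows "wasserstein2 (\<mu> t) (\<mu>' t) \<le> sqrt (cost t)"
    and "cost t \<le> exp (4 * Lip R * t) * cost 0"
    and "integrable \<gamma> (\<lambda>z. (norm (X t (fst z) - X' t (snd z)))\<^sup>2)"
proof -
  interpret prob_space \<gamma> using \<gamma> by (simp add: couplings_def)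
  have s[measurable_cong]: "sets \<gamma> = sets (borel \<Otimes>\<^sub>M borel)"
    and d: "distr \<gamma> borel fst = \<mu> 0" "distr \<gamma> borel snd = \<mu>' 0"
    using \<gamma> by (auto simp: couplings_def)
  let ?\<Lambda> = "Lip R"
  have z: "0 \<in> {0..T}" using T by simp
  have R: "0 \<le> R" by (rule confined_radius_nonneg[OF conf(1)[OF z]])
  have b_lip: "norm (drift \<mu> R \<tau> x - drift \<mu> R \<tau> y) \<le> ?\<Lambda> * norm (x - y)"
    "norm (drift \<mu>' R \<tau> x - drift \<mu>' R \<tau> y) \<le> ?\<Lambda> * norm (x - y)" if "\<tau> \<in> {0..T}" for \<tau> x y
    by (intro drift_lipschitz conf that)+
  have mX: "X \<tau> \<in> borel_measurable borel" "X' \<tau> \<in> borel_measurable borel" if "\<tau> \<in> {0..T}" for \<tau>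
  proof -
    have "continuous_on UNIV (X \<tau>)" by (rule drift_flow_continuous[OF X conf(1) that])
    then show "X \<tau> \<in> borel_measurable borel" by (rule borel_measurable_continuous_onI)
    have "continuous_on UNIV (X' \<tau>)" by (rule drift_flow_continuous[OF X' conf(2) that])
    then show "X' \<tau> \<in> borel_measurable borel" by (rule borel_measurable_continuous_onI)
  qed
  have mb: "drift \<mu> R \<tau> \<in> borel_measurable borel" "drift \<mu>' R \<tau> \<in> borel_measurable borel" if "\<tau> \<in> {0..T}" for \<tau>
  proof -
    have "?\<Lambda>-lipschitz_on UNIV (drift \<mu> R \<tau>)" "?\<Lambda>-lipschitz_on UNIV (drift \<mu>' R \<tau>)"
      using b_lip[OF that] Lip_nonneg by (auto simp: lipschitz_on_def dist_norm)
    then show "drift \<mu> R \<tau> \<in> borel_measurable borel" "drift \<mu>' R \<tau> \<in> borel_measurable borel"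
      by (auto intro!: borel_measurable_continuous_onI lipschitz_on_continuous_on)
  qed
  define V where "V = D * R + norm (F 0) + D\<^sup>2 * L * R"
  have V: "norm (drift \<mu> R \<tau> x) \<le> V" "norm (drift \<mu>' R \<tau> x) \<le> V" if "\<tau> \<in> {0..T}" for \<tau> x
    unfolding V_def by (intro drift_norm_le conf that)+
  have V0: "0 \<le> V" using V(1)[OF z, of 0] norm_ge_zero order_trans by blast
  have der: "((\<lambda>s. X s x) has_vector_derivative drift \<mu> R \<tau> (X \<tau> x)) (at \<tau> within {0..T})"
    "((\<lambda>s. X' s x) has_vector_derivative drift \<mu>' R \<tau> (X' \<tau> x)) (at \<tau> within {0..T})" if "\<tau> \<in> {0..T}" for \<tau> x
    using X X' that by (auto simp: is_flow_def)
  have Xb: "norm (X \<tau> x) \<le> R + V * T" "norm (X' \<tau> x) \<le> R + V * T" if \<tau>: "\<tau> \<in> {0..T}" and x: "norm x \<le> R" for \<tau> x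
  proof -
    have 1: "norm (X \<tau> x - X 0 x) \<le> V * norm (\<tau> - 0)" "norm (X' \<tau> x - X' 0 x) \<le> V * norm (\<tau> - 0)"
      by (rule within_vector_derivative_bound[OF der(1) V(1) z \<tau>] within_vector_derivative_bound[OF der(2) V(2) z \<tau>]; assumption)+
    have "V * norm (\<tau> - 0) \<le> V * T" using V0 \<tau> by (intro mult_left_mono) auto
    moreover have "X 0 x = x" "X' 0 x = x" using X X' by (simp_all add: is_flow_def)
    ultimately show "norm (X \<tau> x) \<le> R + V * T" "norm (X' \<tau> x) \<le> R + V * T"
      using 1 x norm_triangle_sub[of "X \<tau> x" x] norm_triangle_sub[of "X' \<tau> x" x] by auto
  qed
  have ae: "AE z in \<gamma>. norm (fst z) \<le> R \<and> norm (snd z) \<le> R"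
  proof -
    have "AE x in distr \<gamma> borel fst. norm x \<le> R" "AE x in distr \<gamma> borel snd. norm x \<le> R"
      using conf(1)[OF z] conf(2)[OF z] unfolding d confined_def by simp_all
    then have "AE z in \<gamma>. norm (fst z) \<le> R" "AE z in \<gamma>. norm (snd z) \<le> R"
      by (simp_all add: AE_distr_iff)
    then show ?thesis by eventually_elim simp
  qed
  define u where "u \<tau> w = X \<tau> (fst w) - X' \<tau> (snd w)" for \<tau> and w :: "(real^'d) \<times> (real^'d)"
  define u' where "u' \<tau> w = drift \<mu> R \<tau> (X \<tau> (fst w)) - drift \<mu>' R \<tau> (X' \<tau> (snd w))" for \<tau> and w :: "(real^'d) \<times> (real^'d)"
  define B where "B = 2 * (R + V * T)"
  have B0: "0 \<le> B" using R V0 T by (simp add: B_def)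
  have mu: "u \<tau> \<in> borel_measurable \<gamma>" "u' \<tau> \<in> borel_measurable \<gamma>" if "\<tau> \<in> {0..T}" for \<tau>
  proof -
    note [measurable] = mX[OF that] mb[OF that]
    show "u \<tau> \<in> borel_measurable \<gamma>" "u' \<tau> \<in> borel_measurable \<gamma>"
      unfolding u_def[abs_def] u'_def[abs_def] by measurable
  qed
  have u_le: "AE w in \<gamma>. \<forall>\<tau>\<in>{0..T}. norm (u \<tau> w) \<le> B"
    using ae
  proof eventually_elim
    case (elim w)
    then show ?case
      using Xb norm_triangle_ineq4[of "X _ (fst w)" "X' _ (snd w)"]
      unfolding u_def B_def by (intro ballI) (smt (verit) norm_triangle_ineq4)
  qed
  have int: "integrable \<gamma> (\<lambda>w. (norm (u \<tau> w))\<^sup>2)" if \<tau>: "\<tau> \<in> {0..T}" for \<tau>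
  proof (rule integrable_const_bound[of _ "B\<^sup>2"])
    show "AE w in \<gamma>. norm ((norm (u \<tau> w))\<^sup>2) \<le> B\<^sup>2"
      using u_le by eventually_elim (use \<tau> in \<open>auto intro: power_mono\<close>)
    show "(\<lambda>w. (norm (u \<tau> w))\<^sup>2) \<in> borel_measurable \<gamma>" using mu(1)[OF \<tau>] by measurable
  qed
  have cost: "cost \<tau> = (\<integral>w. (norm (u \<tau> w))\<^sup>2 \<partial>\<gamma>)" for \<tau> by (simp add: cost_def u_def)
  \<comment> \<open>Since the measures are push-forwards by the flows, pushing
    \<open>\<gamma>\<close> by the pair of flows couples them at every time.\<close>
  have coupling: "\<exists>\<gamma>'\<in>couplings (\<mu> \<tau>) (\<mu>' \<tau>). (\<integral>(x, y). (dist x y)\<^sup>2 \<partial>\<gamma>') = cost \<tau>" if \<tau>: "\<tau> \<in> {0..T}" for \<tau>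
  proof -
    have m: "(\<lambda>w. X \<tau> (fst w)) \<in> measurable \<gamma> borel" "(\<lambda>w. X' \<tau> (snd w)) \<in> measurable \<gamma> borel"
      using mX[OF \<tau>] by measurable
    have "distr \<gamma> borel (\<lambda>w. X \<tau> (fst w)) = distr (distr \<gamma> borel fst) borel (X \<tau>)"
      "distr \<gamma> borel (\<lambda>w. X' \<tau> (snd w)) = distr (distr \<gamma> borel snd) borel (X' \<tau>)"
      using mX[OF \<tau>] by (simp_all add: distr_distr o_def)
    then have "distr \<gamma> borel (\<lambda>w. X \<tau> (fst w)) = \<mu> \<tau>" "distr \<gamma> borel (\<lambda>w. X' \<tau> (snd w)) = \<mu>' \<tau>"
      using eq[OF \<tau>] by (simp_all add: d)
    with joint_distr_coupling[OF m] show ?thesis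
      by (intro bexI[of _ "distr \<gamma> (borel \<Otimes>\<^sub>M borel) (\<lambda>w. (X \<tau> (fst w), X' \<tau> (snd w)))"])
        (simp_all add: cost_def dist_norm)
  qed
  show "wasserstein2 (\<mu> t) (\<mu>' t) \<le> sqrt (cost t)"
    using coupling[OF t] wasserstein2_le by fastforce
  show "integrable \<gamma> (\<lambda>z. (norm (X t (fst z) - X' t (snd z)))\<^sup>2)"
    using int[OF t] by (simp add: u_def)
  \<comment> \<open>The measures are compared through the pushed coupling, whose cost is the very
    quantity being estimated; this closes the differential inequality.\<close>
  have u'_le: "norm (u' \<tau> w) \<le> ?\<Lambda> * (norm (u \<tau> w) + sqrt (cost \<tau>))" if \<tau>: "\<tau> \<in> {0..T}" for \<tau> w
  proof -
    obtain \<gamma>' where \<gamma>': "\<gamma>' \<in> couplings (\<mu> \<tau>) (\<mu>' \<tau>)" "(\<integral>(x, y). (dist x y)\<^sup>2 \<partial>\<gamma>') = cost \<tau>"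
      using coupling[OF \<tau>] by blast
    have "norm (drift \<mu> R \<tau> (X \<tau> (fst w)) - drift \<mu>' R \<tau> (X' \<tau> (snd w)))
        \<le> ?\<Lambda> * (norm (X \<tau> (fst w) - X' \<tau> (snd w)) + sqrt (\<integral>(x, y). (dist x y)\<^sup>2 \<partial>\<gamma>'))"
      by (intro drift_lipschitz_cost conf \<tau> \<gamma>'(1))
    then show ?thesis by (simp add: u_def u'_def \<gamma>'(2))
  qed
  have D: "(cost has_real_derivative (\<integral>w. 2 * (u \<tau> w \<bullet> u' \<tau> w) \<partial>\<gamma>)) (at \<tau> within {0..T})" if \<tau>: "\<tau> \<in> {0..T}" for \<tau>
    unfolding cost[abs_def]
  proof (rule has_real_derivative_integral[OF _ \<tau> int])
    show "finite_measure \<gamma>" by (rule finite_measure_axioms)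
    show "(\<lambda>w. 2 * (u \<tau> w \<bullet> u' \<tau> w)) \<in> borel_measurable \<gamma>" using mu[OF \<tau>] by measurable
    show "AE w in \<gamma>. \<forall>\<tau>\<in>{0..T}. ((\<lambda>s. (norm (u s w))\<^sup>2) has_real_derivative 2 * (u \<tau> w \<bullet> u' \<tau> w)) (at \<tau> within {0..T}) \<and>
        \<bar>2 * (u \<tau> w \<bullet> u' \<tau> w)\<bar> \<le> 2 * (B * (2 * V))"
      using u_le
    proof eventually_elim
      case (elim w)
      show ?case
      proof (intro ballI conjI)
        fix \<tau> assume \<tau>: "\<tau> \<in> {0..T}"
        have "((\<lambda>s. u s w) has_vector_derivative u' \<tau> w) (at \<tau> within {0..T})"
          unfolding u_def u'_def by (intro has_vector_derivative_diff der \<tau>)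
        from has_real_derivative_weighted_norm[OF this, of 0]
        show "((\<lambda>s. (norm (u s w))\<^sup>2) has_real_derivative 2 * (u \<tau> w \<bullet> u' \<tau> w)) (at \<tau> within {0..T})" by simp
        have "norm (u' \<tau> w) \<le> 2 * V"
          using V[OF \<tau>] norm_triangle_ineq4[of "drift \<mu> R \<tau> (X \<tau> (fst w))" "drift \<mu>' R \<tau> (X' \<tau> (snd w))"]
          unfolding u'_def by (smt (verit))
        then have "norm (u \<tau> w) * norm (u' \<tau> w) \<le> B * (2 * V)"
          using elim \<tau> B0 by (intro mult_mono) auto
        then show "\<bar>2 * (u \<tau> w \<bullet> u' \<tau> w)\<bar> \<le> 2 * (B * (2 * V))"
          using Cauchy_Schwarz_ineq2[of "u \<tau> w" "u' \<tau> w"] by (simp add: abs_mult)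
      qed
    qed
  qed
  \<comment> \<open>The position part gives \<open>2 * ?\<Lambda> * cost\<close>; the measure part
    gives as much again, since the mean of \<open>norm (u \<tau> w)\<close> is at most the root of
    \<open>cost \<tau>\<close>.\<close>
  have D_le: "(\<integral>w. 2 * (u \<tau> w \<bullet> u' \<tau> w) \<partial>\<gamma>) \<le> 4 * ?\<Lambda> * cost \<tau>" if \<tau>: "\<tau> \<in> {0..T}" for \<tau>
  proof -
    have c0: "0 \<le> cost \<tau>" unfolding cost by (rule Bochner_Integration.integral_nonneg) simp
    have nm: "(\<lambda>w. norm (u \<tau> w)) \<in> borel_measurable \<gamma>" using mu(1)[OF \<tau>] by measurable
    note e = expectation_le_sqrt[OF nm int[OF \<tau>]]
    have "(\<integral>w. 2 * (u \<tau> w \<bullet> u' \<tau> w) \<partial>\<gamma>) \<le> (\<integral>w. 2 * ?\<Lambda> * (norm (u \<tau> w))\<^sup>2 + 2 * ?\<Lambda> * sqrt (cost \<tau>) * norm (u \<tau> w) \<partial>\<gamma>)"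
    proof (cases "integrable \<gamma> (\<lambda>w. 2 * (u \<tau> w \<bullet> u' \<tau> w))")
      case True
      show ?thesis
      proof (rule integral_mono[OF True])
        show "integrable \<gamma> (\<lambda>w. 2 * ?\<Lambda> * (norm (u \<tau> w))\<^sup>2 + 2 * ?\<Lambda> * sqrt (cost \<tau>) * norm (u \<tau> w))"
          using int[OF \<tau>] e(1) by simp
        fix w
        have "u \<tau> w \<bullet> u' \<tau> w \<le> norm (u \<tau> w) * norm (u' \<tau> w)" by (rule norm_cauchy_schwarz)
        also have "\<dots> \<le> norm (u \<tau> w) * (?\<Lambda> * (norm (u \<tau> w) + sqrt (cost \<tau>)))"
          by (intro mult_left_mono u'_le \<tau>) simp
        finally show "2 * (u \<tau> w \<bullet> u' \<tau> w) \<le> 2 * ?\<Lambda> * (norm (u \<tau> w))\<^sup>2 + 2 * ?\<Lambda> * sqrt (cost \<tau>) * norm (u \<tau> w)"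
          by (simp add: algebra_simps power2_eq_square)
      qed
    next
      \<comment> \<open>By convention the integral is then 0, and the upper bound is
        nonnegative.\<close>
      case False
      then have "(\<integral>w. 2 * (u \<tau> w \<bullet> u' \<tau> w) \<partial>\<gamma>) = 0" by (rule not_integrable_integral_eq)
      also have "0 \<le> (\<integral>w. 2 * ?\<Lambda> * (norm (u \<tau> w))\<^sup>2 + 2 * ?\<Lambda> * sqrt (cost \<tau>) * norm (u \<tau> w) \<partial>\<gamma>)"
        using Lip_nonneg c0 by (intro Bochner_Integration.integral_nonneg) simp
      finally show ?thesis .
    qed
    also have "\<dots> = 2 * ?\<Lambda> * cost \<tau> + 2 * ?\<Lambda> * sqrt (cost \<tau>) * (\<integral>w. norm (u \<tau> w) \<partial>\<gamma>)"
      using int[OF \<tau>] e(1) by (simp add: cost)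
    also have "\<dots> \<le> 2 * ?\<Lambda> * cost \<tau> + 2 * ?\<Lambda> * sqrt (cost \<tau>) * sqrt (cost \<tau>)"
      using e(2) Lip_nonneg c0 by (intro add_left_mono mult_left_mono) (simp_all add: cost)
    also have "\<dots> = 4 * ?\<Lambda> * cost \<tau>" using c0 by (simp add: mult.assoc)
    finally show ?thesis .
  qed
  have "exp (- (4 * ?\<Lambda>) * t) * cost t \<le> exp (- (4 * ?\<Lambda>) * 0) * cost 0"
  proof (rule within_DERIV_nonpos_le[OF _ _ t])
    fix \<tau> assume \<tau>: "\<tau> \<in> {0..T}"
    have e: "((\<lambda>s. exp (- (4 * ?\<Lambda>) * s)) has_real_derivative - (4 * ?\<Lambda>) * exp (- (4 * ?\<Lambda>) * \<tau>)) (at \<tau> within {0..T})"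
      by (auto intro!: derivative_eq_intros)
    show "((\<lambda>s. exp (- (4 * ?\<Lambda>) * s) * cost s) has_real_derivative
        - (4 * ?\<Lambda>) * exp (- (4 * ?\<Lambda>) * \<tau>) * cost \<tau> + (\<integral>w. 2 * (u \<tau> w \<bullet> u' \<tau> w) \<partial>\<gamma>) * exp (- (4 * ?\<Lambda>) * \<tau>)) (at \<tau> within {0..T})"
      by (rule DERIV_mult[OF e D[OF \<tau>]])
    have "(\<integral>w. 2 * (u \<tau> w \<bullet> u' \<tau> w) \<partial>\<gamma>) * exp (- (4 * ?\<Lambda>) * \<tau>) \<le> (4 * ?\<Lambda> * cost \<tau>) * exp (- (4 * ?\<Lambda>) * \<tau>)"
      by (rule mult_right_mono[OF D_le[OF \<tau>]]) simp
    then show "- (4 * ?\<Lambda>) * exp (- (4 * ?\<Lambda>) * \<tau>) * cost \<tau> + (\<integral>w. 2 * (u \<tau> w \<bullet> u' \<tau> w) \<partial>\<gamma>) * exp (- (4 * ?\<Lambda>) * \<tau>) \<le> 0"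
      by (simp add: mult_ac)
  qed
  then show "cost t \<le> exp (4 * Lip R * t) * cost 0"
    by (simp add: exp_minus field_simps)
qed

lemma weak_solution_flow:
  assumes T: "0 \<le> T" and w: "weak_solution T \<rho> F \<mu>\<^sub>0 \<mu>" and conf: "\<And>t. t \<in> {0..T} \<Longrightarrow> confined (\<mu> t) R"
  shows "\<exists>X. is_flow T (drift \<mu> R) X \<and> (\<forall>t\<in>{0..T}. \<mu> t = distr (\<mu> 0) borel (X t))"
proof -
  have cv: "P2_continuous_curve T \<mu>" and \<mu>0: "\<mu> 0 = \<mu>\<^sub>0" using w by (auto simp: weak_solution_def)
  obtain X where X: "is_flow T (drift \<mu> R) X" by (rule drift_flow_exists[OF T cv conf])
  show ?thesis
    using X weak_solution_eq_flow[OF w conf X] \<mu>0 by (intro exI[of _ X]) simp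
qed

text \<open>The flows carry a near-optimal coupling of the initial data. Taking the root of the
  quadratic cost halves the exponent \<open>4 * Lip R * t\<close>.\<close>

lemma weak_solution_stability:
  assumes T: "0 \<le> T" and w: "weak_solution T \<rho> F \<mu>\<^sub>0 \<mu>" "weak_solution T \<rho> F \<mu>\<^sub>0' \<mu>'"
    and conf: "\<And>t. t \<in> {0..T} \<Longrightarrow> confined (\<mu> t) R" "\<And>t. t \<in> {0..T} \<Longrightarrow> confined (\<mu>' t) R"
    and t: "t \<in> {0..T}"
  shows "wasserstein2 (\<mu> t) (\<mu>' t) \<le> exp (2 * Lip R * t) * wasserstein2 \<mu>\<^sub>0 \<mu>\<^sub>0'"
proof -
  have cv: "P2_continuous_curve T \<mu>" "P2_continuous_curve T \<mu>'" and \<mu>0: "\<mu> 0 = \<mu>\<^sub>0" "\<mu>' 0 = \<mu>\<^sub>0'"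
    using w by (auto simp: weak_solution_def)
  have z: "0 \<in> {0..T}" using T by simp
  have P2: "\<mu>\<^sub>0 \<in> P2" "\<mu>\<^sub>0' \<in> P2"
    using weak_solution_prob(1)[OF w(1) z] weak_solution_prob(1)[OF w(2) z] \<mu>0 by simp_all
  obtain X where X: "is_flow T (drift \<mu> R) X" "\<And>t. t \<in> {0..T} \<Longrightarrow> \<mu> t = distr (\<mu> 0) borel (X t)"
    using weak_solution_flow[OF T w(1) conf(1)] by blast
  obtain X' where X': "is_flow T (drift \<mu>' R) X'" "\<And>t. t \<in> {0..T} \<Longrightarrow> \<mu>' t = distr (\<mu>' 0) borel (X' t)"
    using weak_solution_flow[OF T w(2) conf(2)] by blast
  have X0: "X 0 x = x" "X' 0 x = x" for x using X(1) X'(1) by (simp_all add: is_flow_def)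
  let ?w = "wasserstein2 \<mu>\<^sub>0 \<mu>\<^sub>0'"
  have le: "wasserstein2 (\<mu> t) (\<mu>' t) \<le> exp (2 * Lip R * t) * sqrt (?w\<^sup>2 + inverse (real (Suc n)))" for n
  proof -
    obtain \<gamma> where \<gamma>: "\<gamma> \<in> couplings \<mu>\<^sub>0 \<mu>\<^sub>0'" "(\<integral>(x, y). (dist x y)\<^sup>2 \<partial>\<gamma>) < ?w\<^sup>2 + inverse (real (Suc n))"
      using wasserstein2_approx[OF P2, of "inverse (real (Suc n))"] by auto
    note st = flow_stability[OF T cv conf X(1) X'(1) X(2) X'(2) \<gamma>(1)[folded \<mu>0] t]
    have "wasserstein2 (\<mu> t) (\<mu>' t) \<le> sqrt (\<integral>z. (norm (X t (fst z) - X' t (snd z)))\<^sup>2 \<partial>\<gamma>)" by (rule st(1))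
    also have "\<dots> \<le> sqrt (exp (4 * Lip R * t) * (\<integral>z. (norm (X 0 (fst z) - X' 0 (snd z)))\<^sup>2 \<partial>\<gamma>))"
      by (rule real_sqrt_le_mono[OF st(2)])
    also have "(\<integral>z. (norm (X 0 (fst z) - X' 0 (snd z)))\<^sup>2 \<partial>\<gamma>) = (\<integral>(x, y). (dist x y)\<^sup>2 \<partial>\<gamma>)"
      by (simp add: X0 dist_norm case_prod_unfold)
    also have "sqrt (exp (4 * Lip R * t) * (\<integral>(x, y). (dist x y)\<^sup>2 \<partial>\<gamma>)) \<le> sqrt ((exp (2 * Lip R * t))\<^sup>2 * (?w\<^sup>2 + inverse (real (Suc n))))"
      using \<gamma>(2) by (intro real_sqrt_le_mono mult_mono) (auto simp: exp_double[symmetric] intro: Bochner_Integration.integral_nonneg)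
    also have "\<dots> = exp (2 * Lip R * t) * sqrt (?w\<^sup>2 + inverse (real (Suc n)))"
      by (simp add: real_sqrt_mult)
    finally show ?thesis .
  qed
  have "(\<lambda>n. exp (2 * Lip R * t) * sqrt (?w\<^sup>2 + inverse (real (Suc n)))) \<longlonglongrightarrow> exp (2 * Lip R * t) * sqrt (?w\<^sup>2 + 0)"
    by (intro tendsto_intros LIMSEQ_inverse_real_of_nat)
  then have "wasserstein2 (\<mu> t) (\<mu>' t) \<le> exp (2 * Lip R * t) * sqrt (?w\<^sup>2 + 0)"
    by (rule LIMSEQ_le_const) (use le in auto)
  then show ?thesis using wasserstein2_nonneg[OF P2] by simp
qed

text \<open>Distance 0 would still have to be turned into equality of measures. The diagonal
  coupling avoids this: its cost stays 0, so the two flows agree almost everywhere and push the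
  initial measure to the same measure.\<close>

lemma weak_solution_unique:
  assumes T: "0 \<le> T" and w: "weak_solution T \<rho> F \<mu>\<^sub>0 \<mu>" "weak_solution T \<rho> F \<mu>\<^sub>0 \<mu>'"
    and conf: "\<And>t. t \<in> {0..T} \<Longrightarrow> confined (\<mu> t) R" "\<And>t. t \<in> {0..T} \<Longrightarrow> confined (\<mu>' t) R"
    and t: "t \<in> {0..T}"
  shows "\<mu> t = \<mu>' t"
proof -
  have cv: "P2_continuous_curve T \<mu>" "P2_continuous_curve T \<mu>'" and \<mu>0: "\<mu> 0 = \<mu>\<^sub>0" "\<mu>' 0 = \<mu>\<^sub>0"
    using w by (auto simp: weak_solution_def)
  have z: "0 \<in> {0..T}" using T by simp
  interpret prob_space \<mu>\<^sub>0 using weak_solution_prob(2)[OF w(1) z] \<mu>0 by simp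
  have s: "sets \<mu>\<^sub>0 = sets borel" using weak_solution_prob(3)[OF w(1) z] \<mu>0 by simp
  obtain X where X: "is_flow T (drift \<mu> R) X" "\<And>t. t \<in> {0..T} \<Longrightarrow> \<mu> t = distr (\<mu> 0) borel (X t)"
    using weak_solution_flow[OF T w(1) conf(1)] by blast
  obtain X' where X': "is_flow T (drift \<mu>' R) X'" "\<And>t. t \<in> {0..T} \<Longrightarrow> \<mu>' t = distr (\<mu>' 0) borel (X' t)"
    using weak_solution_flow[OF T w(2) conf(2)] by blast
  have X0: "X 0 x = x" "X' 0 x = x" for x using X(1) X'(1) by (simp_all add: is_flow_def)
  have id: "(\<lambda>x. x) \<in> measurable \<mu>\<^sub>0 borel" by (simp add: measurable_cong_sets[OF s refl])
  have di: "distr \<mu>\<^sub>0 borel (\<lambda>x. x) = \<mu>\<^sub>0" using s by (intro distr_id2) simp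
  define \<gamma> where "\<gamma> = distr \<mu>\<^sub>0 (borel \<Otimes>\<^sub>M borel) (\<lambda>x. (x, x))"
  have pm: "(\<lambda>x. (x, x)) \<in> measurable \<mu>\<^sub>0 (borel \<Otimes>\<^sub>M borel)" using id id by (rule measurable_Pair)
  have \<gamma>: "\<gamma> \<in> couplings (\<mu> 0) (\<mu>' 0)" using joint_distr_coupling(1)[OF id id] by (simp add: \<gamma>_def di \<mu>0)
  note st = flow_stability[OF T cv conf X(1) X'(1) X(2) X'(2) \<gamma> t]
  have mX: "X t \<in> borel_measurable borel" "X' t \<in> borel_measurable borel"
  proof -
    have "continuous_on UNIV (X t)" by (rule drift_flow_continuous[OF X(1) conf(1) t])
    then show "X t \<in> borel_measurable borel" by (rule borel_measurable_continuous_onI)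
    have "continuous_on UNIV (X' t)" by (rule drift_flow_continuous[OF X'(1) conf(2) t])
    then show "X' t \<in> borel_measurable borel" by (rule borel_measurable_continuous_onI)
  qed
  have "(\<integral>z. (norm (X 0 (fst z) - X' 0 (snd z)))\<^sup>2 \<partial>\<gamma>) = 0"
    unfolding \<gamma>_def X0 by (subst integral_distr[OF pm]) simp_all
  with st(2) have "(\<integral>z. (norm (X t (fst z) - X' t (snd z)))\<^sup>2 \<partial>\<gamma>) \<le> 0" by simp
  moreover have "0 \<le> (\<integral>z. (norm (X t (fst z) - X' t (snd z)))\<^sup>2 \<partial>\<gamma>)"
    by (rule Bochner_Integration.integral_nonneg) simp
  ultimately have "(\<integral>z. (norm (X t (fst z) - X' t (snd z)))\<^sup>2 \<partial>\<gamma>) = 0" by simp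
  then have "AE z in \<gamma>. (norm (X t (fst z) - X' t (snd z)))\<^sup>2 = 0"
    using integral_nonneg_eq_0_iff_AE[OF st(3)] by simp
  then have "AE z in distr \<mu>\<^sub>0 (borel \<Otimes>\<^sub>M borel) (\<lambda>x. (x, x)). X t (fst z) = X' t (snd z)"
    unfolding \<gamma>_def[symmetric] by simp
  then have ae: "AE x in \<mu>\<^sub>0. X t x = X' t x"
    using mX by (subst (asm) AE_distr_iff[OF pm]) simp_all
  have "distr \<mu>\<^sub>0 borel (X t) = distr \<mu>\<^sub>0 borel (X' t)"
    by (rule distr_cong_AE[OF refl refl ae]) (use mX in \<open>simp_all add: measurable_cong_sets[OF s refl]\<close>)
  then show ?thesis using X(2)[OF t] X'(2)[OF t] \<mu>0 by simp
qed

end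

section \<open>Existence\<close>

instance bcontfun :: (metric_space, banach) banach ..

lemma bounded_linear_apply_bcontfun:
  "bounded_linear (\<lambda>Y :: 'a::metric_space \<Rightarrow>\<^sub>C 'b::real_normed_vector. apply_bcontfun Y x)"
  by (rule bounded_linear_intro[of _ 1]) (simp_all add: norm_bounded)

text \<open>By linearity in \<open>v\<close> only finitely many directional derivatives occur, each
  continuous in \<open>z\<close>.\<close>

lemma frechet_derivative_jointly_continuous:
  fixes \<phi> :: "real \<times> 'b::euclidean_space \<Rightarrow> real"
  assumes "smooth \<phi>"
  shows "continuous_on UNIV (\<lambda>(z, v). frechet_derivative \<phi> (at z) (1, v))"
proof -
  have eq: "frechet_derivative \<phi> (at z) (1, v) =
      frechet_derivative \<phi> (at z) (1, 0) + (\<Sum>i\<in>Basis. (v \<bullet> i) * frechet_derivative \<phi> (at z) (0, i))" for z v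
  proof -
    have lin: "linear (frechet_derivative \<phi> (at z))"
      by (rule linear_frechet_derivative[OF smooth_differentiable[OF assms]])
    have "(0, v) = (\<Sum>i\<in>Basis. (v \<bullet> i) *\<^sub>R (0::real, i))"
      by (simp add: prod_eq_iff fst_sum snd_sum euclidean_representation)
    then have "frechet_derivative \<phi> (at z) (0, v) = (\<Sum>i\<in>Basis. (v \<bullet> i) * frechet_derivative \<phi> (at z) (0, i))"
      by (simp add: linear_sum[OF lin] linear_scale[OF lin] del: scaleR_Pair)
    moreover have "(1, v) = (1, 0) + (0::real, v)" by simp
    ultimately show ?thesis by (metis linear_add[OF lin])
  qed
  have c: "continuous_on UNIV (\<lambda>zv. frechet_derivative \<phi> (at (fst zv)) w)" for w
    by (rule continuous_on_compose2[OF smooth_continuous_on[OF smooth_frechet[OF assms]], of UNIV])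
      (auto intro: continuous_intros)
  have "(\<lambda>(z, v). frechet_derivative \<phi> (at z) (1, v)) = (\<lambda>zv. frechet_derivative \<phi> (at (fst zv)) (1, 0) +
      (\<Sum>i\<in>Basis. (snd zv \<bullet> i) * frechet_derivative \<phi> (at (fst zv)) (0, i)))"
    unfolding case_prod_unfold by (rule ext) (rule eq)
  then show ?thesis
    by (simp only:) (intro continuous_on_add continuous_on_sum continuous_on_mult c continuous_on_inner
        continuous_on_snd continuous_on_const continuous_on_id)
qed

lemma continuous_on_integral_bounded:
  fixes \<psi> :: "real \<Rightarrow> 'a \<Rightarrow> real"
  assumes M: "finite_measure M" and meas: "\<And>t. t \<in> S \<Longrightarrow> \<psi> t \<in> borel_measurable M"
    and ae: "AE z in M. continuous_on S (\<lambda>t. \<psi> t z) \<and> (\<forall>t\<in>S. \<bar>\<psi> t z\<bar> \<le> K)"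
  shows "continuous_on S (\<lambda>t. \<integral>z. \<psi> t z \<partial>M)"
proof (rule continuous_on_sequentiallyI)
  interpret finite_measure M by fact
  fix \<tau> a assume \<tau>: "\<forall>n. \<tau> n \<in> S" "a \<in> S" "\<tau> \<longlonglongrightarrow> a"
  show "(\<lambda>n. \<integral>z. \<psi> (\<tau> n) z \<partial>M) \<longlonglongrightarrow> (\<integral>z. \<psi> a z \<partial>M)"
  proof (rule integral_dominated_convergence[where w = "\<lambda>_. K"])
    show "AE z in M. (\<lambda>n. \<psi> (\<tau> n) z) \<longlonglongrightarrow> \<psi> a z"
      using ae by eventually_elim (use \<tau> in \<open>auto simp: continuous_on_sequentially o_def\<close>)
    show "AE z in M. norm (\<psi> (\<tau> n) z) \<le> K" for n
      using ae by eventually_elim (use \<tau> in auto)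
  qed (use meas \<tau> in auto)
qed

section \<open>The displacement equation and the construction of a solution\<close>

context transformer_field
begin

text \<open>Near \<open>x\<close> the velocity agrees with the drift projected on a ball of radius
  at least \<open>norm x + 1\<close>, and the latter is Lipschitz.\<close>

lemma velocity_continuous:
  assumes \<mu>: "confined \<mu> R"
  shows "continuous_on UNIV (velocity \<rho> F \<mu>)"
proof -
  have "isCont (velocity \<rho> F \<mu>) x" for x
  proof -
    define r where "r = max R (norm x + 1)"
    have c: "confined \<mu> r" using confined_mono[OF \<mu>, of r] by (simp add: r_def)
    have "(Lip r)-lipschitz_on UNIV (drift (\<lambda>_. \<mu>) r 0)"
      using drift_lipschitz[of "\<lambda>_. \<mu>" 0 r, OF c] Lip_nonneg by (auto simp: lipschitz_on_def dist_norm)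
    then have "isCont (drift (\<lambda>_. \<mu>) r 0) x"
      using lipschitz_on_continuous_on continuous_on_eq_continuous_at[OF open_UNIV] by blast
    moreover have "\<forall>\<^sub>F y in nhds x. drift (\<lambda>_. \<mu>) r 0 y = velocity \<rho> F \<mu> y"
    proof (rule eventually_mono[OF eventually_nhds_ball[of 1]])
      fix y assume "y \<in> ball x 1"
      then have "norm y \<le> r"
        using norm_triangle_sub[of y x] by (simp add: r_def dist_norm norm_minus_commute)
      then show "drift (\<lambda>_. \<mu>) r 0 y = velocity \<rho> F \<mu> y" by (rule drift_eq)
    qed simp
    ultimately show ?thesis using isCont_cong by blast
  qed
  then show ?thesis by (simp add: continuous_at_imp_continuous_on)
qed

text \<open>The Lagrangian form of the equation: an ordinary differential equation for the displacement
  field in the Banach space of bounded continuous maps. The projection keeps the right-hand side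
  globally Lipschitz; it is inactive along the solution.\<close>

definition push :: "(real^'d) measure \<Rightarrow> real \<Rightarrow> ((real^'d) \<Rightarrow>\<^sub>C (real^'d)) \<Rightarrow> (real^'d) measure" where
  "push \<mu>\<^sub>0 R Y = distr \<mu>\<^sub>0 borel (\<lambda>x. closest_point (cball 0 R) (x + apply_bcontfun Y x))"

definition displacement_rate ::
    "(real^'d) measure \<Rightarrow> real \<Rightarrow> ((real^'d) \<Rightarrow>\<^sub>C (real^'d)) \<Rightarrow> real^'d \<Rightarrow> real^'d" where
  "displacement_rate \<mu>\<^sub>0 R Y x = drift (\<lambda>_. push \<mu>\<^sub>0 R Y) R 0 (x + apply_bcontfun Y x)"

context
  fixes \<mu>\<^sub>0 :: "(real^'d) measure" and R\<^sub>0 :: real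
  assumes \<mu>0: "confined \<mu>\<^sub>0 R\<^sub>0"
begin

lemma measurable_\<mu>0: "f \<in> borel_measurable borel \<Longrightarrow> f \<in> borel_measurable \<mu>\<^sub>0"
  using \<mu>0 measurable_cong_sets[of \<mu>\<^sub>0 borel borel borel] by (auto simp: confined_def)

lemma measurable_position:
  fixes Y :: "(real^'d) \<Rightarrow>\<^sub>C (real^'d)"
  shows "(\<lambda>x. x + apply_bcontfun Y x) \<in> borel_measurable borel"
  by (intro borel_measurable_continuous_onI continuous_on_add continuous_on_id continuous_on_apply_bcontfun)

lemma measurable_closest_point:
  assumes "0 \<le> R"
  shows "closest_point (cball (0::real^'d) R) \<in> borel_measurable borel"
proof (intro borel_measurable_continuous_onI lipschitz_on_continuous_on)
  show "1-lipschitz_on UNIV (closest_point (cball (0::real^'d) R))"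
    using closest_point_cball(2)[OF assms] by (auto simp: lipschitz_on_def dist_norm)
qed

lemma measurable_projected:
  assumes "0 \<le> R"
  shows "(\<lambda>x. closest_point (cball 0 R) (x + apply_bcontfun Y x)) \<in> borel_measurable \<mu>\<^sub>0"
  by (intro measurable_\<mu>0 measurable_compose[OF measurable_position measurable_closest_point[OF assms]])

lemma push_confined:
  assumes "0 \<le> R" and ae: "AE x in \<mu>\<^sub>0. norm (closest_point (cball 0 R) (x + apply_bcontfun Y x)) \<le> r"
  shows "confined (push \<mu>\<^sub>0 R Y) r"
proof -
  interpret prob_space \<mu>\<^sub>0 using \<mu>0 by (simp add: confined_def)
  note m = measurable_projected[OF assms(1), of Y]
  show ?thesis
    unfolding confined_def push_def
    using prob_space_distr[OF m] ae by (subst AE_distr_iff[OF m]) auto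
qed

lemma push_confined_R: "0 \<le> R \<Longrightarrow> confined (push \<mu>\<^sub>0 R Y) R"
  by (rule push_confined) (simp_all add: closest_point_cball)

lemma displacement_rate_norm_le:
  assumes "0 \<le> R"
  shows "norm (displacement_rate \<mu>\<^sub>0 R Y x) \<le> D * R + norm (F 0) + D\<^sup>2 * L * R"
  unfolding displacement_rate_def by (intro drift_norm_le push_confined_R assms)

text \<open>Positions are unbounded in the starting point, but the projected velocity is bounded;
  this is why the unknown is the displacement.\<close>

lemma displacement_rate_bcontfun:
  assumes "0 \<le> R"
  shows "displacement_rate \<mu>\<^sub>0 R Y \<in> bcontfun"
proof (rule bcontfun_normI[OF _ displacement_rate_norm_le[OF assms]])
  have "(Lip R)-lipschitz_on UNIV (drift (\<lambda>_. push \<mu>\<^sub>0 R Y) R 0)"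
    using drift_lipschitz[where \<mu> = "\<lambda>_. push \<mu>\<^sub>0 R Y" and t = 0, OF push_confined_R[OF assms]] Lip_nonneg
    by (auto simp: lipschitz_on_def dist_norm)
  then have "continuous_on UNIV (drift (\<lambda>_. push \<mu>\<^sub>0 R Y) R 0)" by (rule lipschitz_on_continuous_on)
  then show "continuous_on UNIV (displacement_rate \<mu>\<^sub>0 R Y)"
    unfolding displacement_rate_def[abs_def]
    by (rule continuous_on_compose2) (auto intro!: continuous_intros)
qed

text \<open>Changing \<open>Y\<close> moves both the evaluation point and the pushed measure by at
  most the sup norm of the change; hence the factor 2.\<close>

lemma displacement_rate_lipschitz:
  assumes R: "0 \<le> R"
  shows "norm (displacement_rate \<mu>\<^sub>0 R Y x - displacement_rate \<mu>\<^sub>0 R Y' x) \<le> 2 * Lip R * norm (Y - Y')"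
proof -
  interpret prob_space \<mu>\<^sub>0 using \<mu>0 by (simp add: confined_def)
  let ?P = "closest_point (cball 0 R)"
  note m = measurable_projected[OF R, of Y] measurable_projected[OF R, of Y']
  have Y: "norm (apply_bcontfun Y x - apply_bcontfun Y' x) \<le> norm (Y - Y')" for x
    using norm_bounded[of "Y - Y'" x] by simp
  have d: "dist (?P (x + apply_bcontfun Y x)) (?P (x + apply_bcontfun Y' x)) \<le> norm (Y - Y')" for x
    using closest_point_cball(2)[OF R, of "x + apply_bcontfun Y x" "x + apply_bcontfun Y' x"] Y[of x]
    by (simp add: dist_norm)
  have "(\<integral>x. (dist (?P (x + apply_bcontfun Y x)) (?P (x + apply_bcontfun Y' x)))\<^sup>2 \<partial>\<mu>\<^sub>0) \<le> (\<integral>x. (norm (Y - Y'))\<^sup>2 \<partial>\<mu>\<^sub>0)"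
    using d m by (intro integral_mono integrable_const_bound[of _ "(norm (Y - Y'))\<^sup>2"]) (auto intro!: power_mono)
  then have c: "sqrt (\<integral>x. (dist (?P (x + apply_bcontfun Y x)) (?P (x + apply_bcontfun Y' x)))\<^sup>2 \<partial>\<mu>\<^sub>0) \<le> norm (Y - Y')"
    by (intro real_le_lsqrt) (simp_all add: prob_space)
  have "norm (displacement_rate \<mu>\<^sub>0 R Y x - displacement_rate \<mu>\<^sub>0 R Y' x)
      \<le> Lip R * (norm ((x + apply_bcontfun Y x) - (x + apply_bcontfun Y' x))
        + sqrt (\<integral>x. (dist (?P (x + apply_bcontfun Y x)) (?P (x + apply_bcontfun Y' x)))\<^sup>2 \<partial>\<mu>\<^sub>0))"
    unfolding joint_distr_coupling(2)[OF m, symmetric] displacement_rate_def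
    using joint_distr_coupling(1)[OF m] unfolding push_def[symmetric]
    by (intro drift_lipschitz_cost push_confined_R R)
  also have "\<dots> \<le> Lip R * (norm (Y - Y') + norm (Y - Y'))"
    using Y[of x] c Lip_nonneg by (intro mult_left_mono add_mono) auto
  finally show ?thesis by simp
qed

text \<open>Evaluation at a point is bounded and linear, so one equation in the Banach space yields
  the equation for every starting point.\<close>

lemma displacement_exists:
  assumes T: "0 \<le> T" and R: "0 \<le> R"
  obtains u where "u 0 = 0" "continuous_on {0..T} u"
    "\<And>t x. t \<in> {0..T} \<Longrightarrow>
      ((\<lambda>s. apply_bcontfun (u s) x) has_vector_derivative displacement_rate \<mu>\<^sub>0 R (u t) x) (at t within {0..T})"
    "\<And>x. continuous_on {0..T} (\<lambda>t. displacement_rate \<mu>\<^sub>0 R (u t) x)"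
proof -
  define f where "f Y = Bcontfun (displacement_rate \<mu>\<^sub>0 R Y)" for Y
  have f: "apply_bcontfun (f Y) = displacement_rate \<mu>\<^sub>0 R Y" for Y
    unfolding f_def by (rule Bcontfun_inverse[OF displacement_rate_bcontfun[OF R]])
  have f_lip: "norm (f Y - f Y') \<le> 2 * Lip R * norm (Y - Y')" for Y Y'
    by (rule norm_bound) (simp add: f displacement_rate_lipschitz[OF R])
  have "\<exists>u. u 0 = 0 \<and> (\<forall>t\<in>{0..T}. (u has_vector_derivative f (u t)) (at t within {0..T}))"
    using Lip_nonneg f_lip
    by (intro picard_lindelof[where f = "\<lambda>_. f" and L = "2 * Lip R"] T) (auto intro: continuous_intros)
  then obtain u where u: "u 0 = 0" "\<And>t. t \<in> {0..T} \<Longrightarrow> (u has_vector_derivative f (u t)) (at t within {0..T})"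
    by blast
  have uc: "continuous_on {0..T} u"
    by (rule continuous_on_vector_derivative[OF u(2)])
  show thesis
  proof
    show "u 0 = 0" "continuous_on {0..T} u" by fact+
    show "((\<lambda>s. apply_bcontfun (u s) x) has_vector_derivative displacement_rate \<mu>\<^sub>0 R (u t) x) (at t within {0..T})"
      if "t \<in> {0..T}" for t x
      using bounded_linear.has_vector_derivative[OF bounded_linear_apply_bcontfun u(2)[OF that], of x] by (simp add: f)
    show "continuous_on {0..T} (\<lambda>t. displacement_rate \<mu>\<^sub>0 R (u t) x)" for x
    proof -
      have "(2 * Lip R)-lipschitz_on UNIV f" using f_lip Lip_nonneg by (auto simp: lipschitz_on_def dist_norm)
      then have "continuous_on {0..T} (\<lambda>t. f (u t))"
        by (intro continuous_on_compose2[OF lipschitz_on_continuous_on _ , of _ UNIV f, OF _ uc]) auto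
      from bounded_linear.continuous_on[OF bounded_linear_apply_bcontfun this, of x]
      show ?thesis by (simp add: f)
    qed
  qed
qed

text \<open>With \<open>N\<close> the supremum of \<open>(1 + |X t x|) exp (- C t)\<close>, the growth bound on the velocity gives
  \<open>N \<le> 1 + R\<^sub>0 + N / 2\<close>.\<close>

lemma displacement_bound:
  assumes T: "0 \<le> T" and R: "0 \<le> R" and u0: "u 0 = 0"
    and der: "\<And>t x. t \<in> {0..T} \<Longrightarrow>
      ((\<lambda>s. apply_bcontfun (u s) x) has_vector_derivative displacement_rate \<mu>\<^sub>0 R (u t) x) (at t within {0..T})"
    and t: "t \<in> {0..T}" and x: "norm x \<le> R\<^sub>0"
  shows "1 + norm (x + apply_bcontfun (u t) x) \<le> 2 * (1 + R\<^sub>0) * exp (growth_rate * t)"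
proof -
  have R0: "0 \<le> R\<^sub>0" by (rule confined_radius_nonneg[OF \<mu>0])
  let ?C = growth_rate
  define V where "V = D * R + norm (F 0) + D\<^sup>2 * L * R"
  define S where "S = (\<lambda>(t, x). (1 + norm (x + apply_bcontfun (u t) x)) * exp (- ?C * t)) ` ({0..T} \<times> cball 0 R\<^sub>0)"
  \<comment> \<open>Finiteness of the supremum, without which \<open>N / 2\<close> could not be
    absorbed, comes from the crude speed bound \<open>V\<close> due to the projection.\<close>
  have bdd: "bdd_above S"
  proof (rule bdd_aboveI)
    fix y assume "y \<in> S"
    then obtain t x where tx: "t \<in> {0..T}" "norm x \<le> R\<^sub>0" "y = (1 + norm (x + apply_bcontfun (u t) x)) * exp (- ?C * t)"
      by (auto simp: S_def)
    have "norm (apply_bcontfun (u t) x - apply_bcontfun (u 0) x) \<le> V * norm (t - 0)"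
      using within_vector_derivative_bound[OF der displacement_rate_norm_le[OF R, folded V_def] _ tx(1), of 0 x] T by simp
    also have "\<dots> \<le> V * T"
      using tx(1) order_trans[OF norm_ge_zero displacement_rate_norm_le[OF R, of "u 0" x, folded V_def]]
      by (intro mult_left_mono) auto
    finally have "norm (apply_bcontfun (u t) x) \<le> V * T" by (simp add: u0)
    then have "1 + norm (x + apply_bcontfun (u t) x) \<le> 1 + (R\<^sub>0 + V * T)"
      using norm_triangle_ineq[of x "apply_bcontfun (u t) x"] tx(2) by simp
    moreover have "exp (- ?C * t) \<le> 1" using tx(1) growth_rate_nonneg by simp
    ultimately show "y \<le> (1 + (R\<^sub>0 + V * T)) * 1"
      unfolding tx(3) by (intro mult_mono) (auto intro: order_trans[of 0 "1 + norm _"])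
  qed
  define N where "N = Sup S"
  have N: "1 + norm (x + apply_bcontfun (u t) x) \<le> N * exp (?C * t)" if "t \<in> {0..T}" "norm x \<le> R\<^sub>0" for t x
  proof -
    have "(1 + norm (x + apply_bcontfun (u t) x)) * exp (- ?C * t) \<le> N"
      unfolding N_def by (rule cSup_upper[OF _ bdd]) (use that in \<open>auto simp: S_def\<close>)
    then show ?thesis by (simp add: exp_minus field_simps)
  qed
  have N1: "1 \<le> N" using N[of 0 0] T R0 u0 by simp
  have improve: "1 + norm (x + apply_bcontfun (u t) x) \<le> (1 + R\<^sub>0 + N / 2) * exp (?C * t)"
    if t: "t \<in> {0..T}" and x: "norm x \<le> R\<^sub>0" for t x
  proof -
    have rate: "norm (displacement_rate \<mu>\<^sub>0 R (u s) x) \<le> (N / 2) * (?C * exp (?C * s))" if s: "s \<in> {0..T}" for s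
    proof -
      \<comment> \<open>The projection is nonexpansive and fixes 0. Hence the bound on positions by
        \<open>N\<close> passes to the pushed measure.\<close>
      have P_le: "norm (closest_point (cball 0 R) y) \<le> norm y" for y :: "real^'d"
        using closest_point_cball(2)[OF R, of y 0] R by (simp add: closest_point_self)
      let ?g = "N * exp (?C * s) - 1"
      have "AE x in \<mu>\<^sub>0. norm x \<le> R\<^sub>0" using \<mu>0 by (simp add: confined_def)
      then have "AE x in \<mu>\<^sub>0. norm (closest_point (cball 0 R) (x + apply_bcontfun (u s) x)) \<le> ?g"
      proof eventually_elim
        case (elim x)
        show ?case using P_le[of "x + apply_bcontfun (u s) x"] N[OF s elim] by linarith
      qed
      then have "confined (push \<mu>\<^sub>0 R (u s)) ?g" by (rule push_confined[OF R])
      from velocity_norm_le[OF this, of "closest_point (cball 0 R) (x + apply_bcontfun (u s) x)"]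
      have "norm (displacement_rate \<mu>\<^sub>0 R (u s) x) \<le> D * ?g + norm (F 0) + D\<^sup>2 * L * norm (closest_point (cball 0 R) (x + apply_bcontfun (u s) x))"
        by (simp add: displacement_rate_def drift_def)
      also have "\<dots> \<le> (2 * D) * (N * exp (?C * s)) + norm (F 0) * (N * exp (?C * s)) + (2 * (D\<^sup>2 * L)) * (N * exp (?C * s))"
      proof (intro add_mono)
        have "1 \<le> exp (?C * s)" using s growth_rate_nonneg by simp
        then have Ne: "1 \<le> N * exp (?C * s)" using N1 mult_mono[of 1 N 1 "exp (?C * s)"] by simp
        show "D * ?g \<le> (2 * D) * (N * exp (?C * s))"
        proof -
          have "?g \<le> 2 * (N * exp (?C * s))" using Ne by linarith
          from mult_left_mono[OF this D_ge_0] show ?thesis by (simp add: mult_ac)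
        qed
        show "norm (F 0) \<le> norm (F 0) * (N * exp (?C * s))"
          using Ne mult_left_mono[of 1 "N * exp (?C * s)" "norm (F 0)"] by simp
        have "norm (closest_point (cball 0 R) (x + apply_bcontfun (u s) x)) \<le> 2 * (N * exp (?C * s))"
          using P_le[of "x + apply_bcontfun (u s) x"] N[OF s x] Ne by linarith
        then have "(D\<^sup>2 * L) * norm (closest_point (cball 0 R) (x + apply_bcontfun (u s) x)) \<le> (D\<^sup>2 * L) * (2 * (N * exp (?C * s)))"
          using L_nonneg by (intro mult_left_mono) auto
        then show "D\<^sup>2 * L * norm (closest_point (cball 0 R) (x + apply_bcontfun (u s) x)) \<le> (2 * (D\<^sup>2 * L)) * (N * exp (?C * s))"
          by (simp add: mult_ac)
      qed
      also have "\<dots> = (N / 2) * (?C * exp (?C * s))"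
        by (simp add: growth_rate_def algebra_simps)
      finally show ?thesis .
    qed
    let ?Y = "apply_bcontfun (u t) x"
    have "norm ?Y \<le> (N / 2) * exp (?C * t) - N / 2"
    proof (cases "?Y = 0")
      case True
      have "1 \<le> exp (?C * t)" using t growth_rate_nonneg by simp
      then have "(N / 2) * 1 \<le> (N / 2) * exp (?C * t)" using N1 by (intro mult_left_mono) auto
      then show ?thesis using True by simp
    next
      case False
      \<comment> \<open>Testing against the fixed direction of the displacement at time
        \<open>t\<close> makes the estimate scalar.\<close>
      define e where "e = ?Y /\<^sub>R norm ?Y"
      have e: "norm e = 1" "?Y \<bullet> e = norm ?Y"
        using False by (simp_all add: e_def dot_square_norm power2_eq_square)
      have "apply_bcontfun (u t) x \<bullet> e - (N / 2) * exp (?C * t) \<le> apply_bcontfun (u 0) x \<bullet> e - (N / 2) * exp (?C * 0)"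
      proof (rule within_DERIV_nonpos_le[OF _ _ t, where \<phi>' = "\<lambda>s. displacement_rate \<mu>\<^sub>0 R (u s) x \<bullet> e - (N / 2) * (?C * exp (?C * s))"])
        fix s assume s: "s \<in> {0..T}"
        have "((\<lambda>s. apply_bcontfun (u s) x \<bullet> e) has_real_derivative displacement_rate \<mu>\<^sub>0 R (u s) x \<bullet> e) (at s within {0..T})"
          using bounded_linear.has_vector_derivative[OF bounded_linear_inner_left[of e] der[OF s, of x]]
          by (simp add: has_real_derivative_iff_has_vector_derivative)
        moreover have "((\<lambda>s. (N / 2) * exp (?C * s)) has_real_derivative (N / 2) * (?C * exp (?C * s))) (at s within {0..T})"
          by (auto intro!: derivative_eq_intros)
        ultimately show "((\<lambda>s. apply_bcontfun (u s) x \<bullet> e - (N / 2) * exp (?C * s)) has_real_derivative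
            displacement_rate \<mu>\<^sub>0 R (u s) x \<bullet> e - (N / 2) * (?C * exp (?C * s))) (at s within {0..T})"
          by (rule DERIV_diff)
        have "displacement_rate \<mu>\<^sub>0 R (u s) x \<bullet> e \<le> norm (displacement_rate \<mu>\<^sub>0 R (u s) x) * norm e"
          by (rule norm_cauchy_schwarz)
        then show "displacement_rate \<mu>\<^sub>0 R (u s) x \<bullet> e - (N / 2) * (?C * exp (?C * s)) \<le> 0"
          using rate[OF s] e(1) by simp
      qed
      then show ?thesis by (simp add: e u0)
    qed
    then have "1 + norm (x + ?Y) \<le> (1 + R\<^sub>0) * 1 + (N / 2) * exp (?C * t)"
      using norm_triangle_ineq[of x ?Y] x N1 by simp
    also have "\<dots> \<le> (1 + R\<^sub>0) * exp (?C * t) + (N / 2) * exp (?C * t)"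
      using R0 t growth_rate_nonneg by (intro add_right_mono mult_left_mono) auto
    finally show ?thesis by (simp add: distrib_right)
  qed
  have "N \<le> 1 + R\<^sub>0 + N / 2"
    unfolding N_def
  proof (rule cSup_least)
    show "S \<noteq> {}" using T R0 by (auto simp: S_def)
    fix y assume "y \<in> S"
    then obtain t x where tx: "t \<in> {0..T}" "norm x \<le> R\<^sub>0" "y = (1 + norm (x + apply_bcontfun (u t) x)) * exp (- ?C * t)"
      by (auto simp: S_def)
    show "y \<le> 1 + R\<^sub>0 + Sup S / 2"
      using improve[OF tx(1,2)] unfolding tx(3) N_def by (simp add: exp_minus field_simps)
  qed
  then have "N \<le> 2 * (1 + R\<^sub>0)" by simp
  then have "N * exp (?C * t) \<le> 2 * (1 + R\<^sub>0) * exp (?C * t)" by (intro mult_right_mono) auto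
  then show ?thesis using N[OF t x] by linarith
qed

text \<open>Trajectories starting in the support ball stay in the ball of radius \<open>R\<close>,
  so the projection is inactive almost everywhere and the displacement equation becomes the
  characteristic equation. The weak formulation is then the fundamental theorem of calculus for the
  integral of \<open>\<phi> (t, X t x)\<close> against \<open>\<mu>\<^sub>0\<close>.\<close>

lemma weak_solution_exists:
  assumes T: "0 \<le> T"
  shows "\<exists>\<mu>. weak_solution T \<rho> F \<mu>\<^sub>0 \<mu>"
proof -
  interpret prob_space \<mu>\<^sub>0 using \<mu>0 by (simp add: confined_def)
  have s0: "sets \<mu>\<^sub>0 = sets borel" using \<mu>0 by (simp add: confined_def)
  have R0: "0 \<le> R\<^sub>0" by (rule confined_radius_nonneg[OF \<mu>0])
  have ae0: "AE x in \<mu>\<^sub>0. norm x \<le> R\<^sub>0" using \<mu>0 by (simp add: confined_def)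
  \<comment> \<open>The bound of \<open>displacement_bound\<close> at the final time, which
    dominates the bounds at all earlier times.\<close>
  define R where "R = 2 * (1 + R\<^sub>0) * exp (growth_rate * T)"
  have R: "0 \<le> R" using R0 by (simp add: R_def)
  obtain u where u: "u 0 = 0" "continuous_on {0..T} u"
    and der: "\<And>t x. t \<in> {0..T} \<Longrightarrow>
      ((\<lambda>s. apply_bcontfun (u s) x) has_vector_derivative displacement_rate \<mu>\<^sub>0 R (u t) x) (at t within {0..T})"
    and rate_cont: "\<And>x. continuous_on {0..T} (\<lambda>t. displacement_rate \<mu>\<^sub>0 R (u t) x)"
    by (rule displacement_exists[OF T R], rule that; assumption)
  define X where "X t x = x + apply_bcontfun (u t) x" for t x
  define v where "v t = displacement_rate \<mu>\<^sub>0 R (u t)" for t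
  define \<mu> where "\<mu> t = distr \<mu>\<^sub>0 borel (X t)" for t
  have X_cont: "continuous_on UNIV (X t)" for t unfolding X_def by (intro continuous_intros) simp
  have v_cont: "continuous_on UNIV (v t)" for t
    using displacement_rate_bcontfun[OF R] by (simp add: v_def bcontfun_def)
  have mX: "X t \<in> borel_measurable \<mu>\<^sub>0" for t
    by (rule measurable_\<mu>0[OF borel_measurable_continuous_onI[OF X_cont]])
  have X_der: "((\<lambda>s. X s x) has_vector_derivative v t x) (at t within {0..T})" if "t \<in> {0..T}" for t x
    using has_vector_derivative_add[OF has_vector_derivative_const[of x] der[OF that]] by (simp add: X_def v_def)
  have X_le: "norm (X t x) \<le> R" if "t \<in> {0..T}" "norm x \<le> R\<^sub>0" for t x
  proof -
    have "1 + norm (X t x) \<le> 2 * (1 + R\<^sub>0) * exp (growth_rate * t)"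
      unfolding X_def by (rule displacement_bound[OF T R u(1) der that])
    also have "\<dots> \<le> R"
      unfolding R_def using that R0 growth_rate_nonneg by (intro mult_left_mono) (auto intro!: mult_left_mono)
    finally show ?thesis by simp
  qed
  have P: "closest_point (cball 0 R) (X t x) = X t x" if "t \<in> {0..T}" "norm x \<le> R\<^sub>0" for t x
    using X_le[OF that] by (simp add: closest_point_self)
  have push: "push \<mu>\<^sub>0 R (u t) = \<mu> t" if t: "t \<in> {0..T}" for t
    unfolding push_def \<mu>_def
  proof (rule distr_cong_AE[OF refl refl _ measurable_projected[OF R] mX])
    show "AE x in \<mu>\<^sub>0. closest_point (cball 0 R) (x + apply_bcontfun (u t) x) = X t x"
      using ae0 by eventually_elim (use P[OF t] in \<open>simp add: X_def\<close>)
  qed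
  have conf: "confined (\<mu> t) R" if "t \<in> {0..T}" for t
    using push_confined_R[OF R] push[OF that] by metis
  have v_eq: "v t x = velocity \<rho> F (\<mu> t) (X t x)" if "t \<in> {0..T}" "norm x \<le> R\<^sub>0" for t x
    using P[OF that] push[OF that(1)] by (simp add: v_def displacement_rate_def drift_def X_def)
  have curve: "P2_continuous_curve T \<mu>"
    unfolding P2_continuous_curve_def
  proof (intro ballI conjI)
    fix t assume t: "t \<in> {0..T}"
    show "\<mu> t \<in> P2" by (rule confined_in_P2[OF conf[OF t]])
    \<comment> \<open>Positions at two times, driven by the same initial point, are coupled;
      continuity in the sup norm gives Wasserstein continuity.\<close>
    have W: "wasserstein2 (\<mu> s) (\<mu> t) \<le> norm (u s - u t)" for s
    proof -
      have d: "dist (X s x) (X t x) \<le> norm (u s - u t)" for x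
        using norm_bounded[of "u s - u t" x] by (simp add: X_def dist_norm)
      have "wasserstein2 (\<mu> s) (\<mu> t) \<le> sqrt (\<integral>x. (dist (X s x) (X t x))\<^sup>2 \<partial>\<mu>\<^sub>0)"
        using wasserstein2_le[OF joint_distr_coupling(1)[OF mX mX], of s t]
        unfolding joint_distr_coupling(2)[OF mX mX] \<mu>_def .
      also have "\<dots> \<le> sqrt (\<integral>x. (norm (u s - u t))\<^sup>2 \<partial>\<mu>\<^sub>0)"
        using d mX by (intro real_sqrt_le_mono integral_mono integrable_const_bound[of _ "(norm (u s - u t))\<^sup>2"])
          (auto intro!: power_mono)
      finally show ?thesis by (simp add: prob_space)
    qed
    have "((\<lambda>s. norm (u s - u t)) \<longlongrightarrow> norm (u t - u t)) (at t within {0..T})"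
      using u(2) t unfolding continuous_on_def by (intro tendsto_intros) auto
    then have lim: "((\<lambda>s. norm (u s - u t)) \<longlongrightarrow> 0) (at t within {0..T})" by simp
    show "((\<lambda>s. wasserstein2 (\<mu> s) (\<mu> t)) \<longlongrightarrow> 0) (at t within {0..T})"
    proof (rule tendsto_sandwich[OF _ _ tendsto_const lim])
      show "\<forall>\<^sub>F s in at t within {0..T}. 0 \<le> wasserstein2 (\<mu> s) (\<mu> t)"
        using wasserstein2_nonneg[OF confined_in_P2[OF conf] confined_in_P2[OF conf[OF t]]]
        by (auto simp: eventually_at_filter)
    qed (use W in simp)
  qed
  have "weak_solution T \<rho> F \<mu>\<^sub>0 \<mu>"
    unfolding weak_solution_def
  proof (intro conjI ballI allI)
    show "P2_continuous_curve T \<mu>" by fact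
    show "attention_field_defined \<rho> (\<mu> t)" if "t \<in> {0..T}" for t
      by (rule confined_attention_field_defined[OF conf[OF that]])
    show "bounded ((\<lambda>(t, x). attention_field \<rho> (\<mu> t) x) ` ({0..T} \<times> cball 0 r))" for r
      unfolding bounded_iff using attention_field_norm_le[OF conf] by (intro exI[of _ "D * R"]) auto
    have "X 0 = (\<lambda>x. x)" by (rule ext) (simp add: X_def u(1))
    then show "\<mu> 0 = \<mu>\<^sub>0" unfolding \<mu>_def using s0 by (simp add: distr_id2)
    fix \<phi> :: "real \<times> (real^'d) \<Rightarrow> real" assume \<phi>: "\<phi> \<in> test_functions"
    note sm = test_function_smooth[OF \<phi>]
    define H where "H z w = frechet_derivative \<phi> (at z) (1, w)" for z and w :: "real^'d"
    have H_cont: "continuous_on UNIV (\<lambda>(z, w). H z w)"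
      unfolding H_def by (rule frechet_derivative_jointly_continuous[OF sm])
    have H_compose: "continuous_on A (\<lambda>y. H (a y) (b y))" if "continuous_on A a" "continuous_on A b"
      for A :: "'z::topological_space set" and a b
      using continuous_on_compose2[OF H_cont continuous_on_Pair[OF that]] by simp
    have tr: "transport_integrand \<rho> F \<mu> \<phi> t x = H (t, x) (velocity \<rho> F (\<mu> t) x)" for t x
      unfolding H_def by (rule transport_integrand_eq[OF smooth_differentiable[OF sm]])
    define V where "V = D * R + norm (F 0) + D\<^sup>2 * L * R"
    have "compact (({0..T} \<times> cball (0::real^'d) R) \<times> cball (0::real^'d) V)"
      by (intro compact_Times) auto
    then have "bounded ((\<lambda>(z, w). H z w) ` (({0..T} \<times> cball 0 R) \<times> cball 0 V))"
      by (intro compact_imp_bounded compact_continuous_image continuous_on_subset[OF H_cont]) auto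
    then obtain K where K: "\<And>t x w. t \<in> {0..T} \<Longrightarrow> norm x \<le> R \<Longrightarrow> norm w \<le> V \<Longrightarrow> \<bar>H (t, x) w\<bar> \<le> K"
      unfolding bounded_iff by fastforce
    define \<psi> where "\<psi> t x = H (t, X t x) (v t x)" for t x
    have \<psi>_meas: "\<psi> t \<in> borel_measurable \<mu>\<^sub>0" for t
      unfolding \<psi>_def
      by (intro measurable_\<mu>0 borel_measurable_continuous_onI H_compose continuous_intros X_cont v_cont)
    have v_le: "norm (v t x) \<le> V" for t x
      unfolding v_def V_def by (rule displacement_rate_norm_le[OF R])
    have \<psi>_le: "AE x in \<mu>\<^sub>0. \<forall>t\<in>{0..T}. \<bar>\<psi> t x\<bar> \<le> K"
      using ae0 by eventually_elim (use K X_le v_le in \<open>simp add: \<psi>_def\<close>)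
    define G where "G t = (\<integral>x. \<psi> t x \<partial>\<mu>\<^sub>0)" for t
    have tr_meas: "transport_integrand \<rho> F \<mu> \<phi> t \<in> borel_measurable borel" if t: "t \<in> {0..T}" for t
    proof -
      have "continuous_on UNIV (\<lambda>x. H (t, x) (velocity \<rho> F (\<mu> t) x))"
        by (intro H_compose continuous_intros velocity_continuous[OF conf[OF t]])
      then show ?thesis by (simp add: tr[abs_def] borel_measurable_continuous_onI)
    qed
    \<comment> \<open>Only for starting points in the support ball is the projected rate the true
      velocity. The two integrands agree merely almost everywhere, so measurability is established
      for each.\<close>
    have tr_ae: "AE x in \<mu>\<^sub>0. transport_integrand \<rho> F \<mu> \<phi> t (X t x) = \<psi> t x" if t: "t \<in> {0..T}" for t
      using ae0 by eventually_elim (use v_eq[OF t] in \<open>simp add: tr \<psi>_def\<close>)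
    have \<psi>_int: "integrable \<mu>\<^sub>0 (\<psi> t)" if t: "t \<in> {0..T}" for t
      by (rule integrable_const_bound[of _ K]) (use \<psi>_le t \<psi>_meas in \<open>auto elim!: eventually_mono\<close>)
    have tX_meas: "(\<lambda>x. transport_integrand \<rho> F \<mu> \<phi> t (X t x)) \<in> borel_measurable \<mu>\<^sub>0" if t: "t \<in> {0..T}" for t
      by (rule measurable_compose[OF mX tr_meas[OF t]])
    show "integrable (\<mu> t) (transport_integrand \<rho> F \<mu> \<phi> t)" if t: "t \<in> {0..T}" for t
    proof -
      have "integrable \<mu>\<^sub>0 (\<lambda>x. transport_integrand \<rho> F \<mu> \<phi> t (X t x))"
        using integrable_cong_AE[OF tX_meas[OF t] \<psi>_meas tr_ae[OF t]] \<psi>_int[OF t] by simp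
      then show ?thesis
        unfolding \<mu>_def[of t] using integrable_distr_eq[OF mX tr_meas[OF t]] by simp
    qed
    have G_eq: "(\<integral>x. transport_integrand \<rho> F \<mu> \<phi> t x \<partial>\<mu> t) = G t" if t: "t \<in> {0..T}" for t
    proof -
      have "(\<integral>x. transport_integrand \<rho> F \<mu> \<phi> t x \<partial>\<mu> t) = (\<integral>x. transport_integrand \<rho> F \<mu> \<phi> t (X t x) \<partial>\<mu>\<^sub>0)"
        unfolding \<mu>_def[of t] by (rule integral_distr[OF mX tr_meas[OF t]])
      also have "\<dots> = G t"
        unfolding G_def by (rule integral_cong_AE[OF tX_meas[OF t] \<psi>_meas tr_ae[OF t]])
      finally show ?thesis .
    qed
    have Xt_cont: "continuous_on {0..T} (\<lambda>t. X t x)" for x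
      by (rule continuous_on_vector_derivative[OF X_der])
    have \<psi>_cont: "continuous_on {0..T} (\<lambda>t. \<psi> t x)" for x
      unfolding \<psi>_def v_def by (intro H_compose continuous_intros Xt_cont rate_cont)
    have "AE x in \<mu>\<^sub>0. continuous_on {0..T} (\<lambda>t. \<psi> t x) \<and> (\<forall>t\<in>{0..T}. \<bar>\<psi> t x\<bar> \<le> K)"
      using \<psi>_le by eventually_elim (simp add: \<psi>_cont)
    then have G_cont: "continuous_on {0..T} G"
      unfolding G_def by (rule continuous_on_integral_bounded[OF finite_measure_axioms \<psi>_meas])
    have \<phi>_der: "((\<lambda>s. \<phi> (s, X s x)) has_real_derivative \<psi> t x) (at t within {0..T})" if t: "t \<in> {0..T}" for t x
    proof -
      have D: "(\<phi> has_derivative frechet_derivative \<phi> (at (t, X t x))) (at (t, X t x))"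
        by (rule smooth_has_derivative[OF sm])
      have "((\<lambda>s. (s, X s x)) has_derivative (\<lambda>h. (h, h *\<^sub>R v t x))) (at t within {0..T})"
        using X_der[OF t, of x] unfolding has_vector_derivative_def by (intro has_derivative_Pair has_derivative_ident)
      from has_derivative_compose[OF this D]
      have "((\<lambda>s. \<phi> (s, X s x)) has_derivative (\<lambda>h. frechet_derivative \<phi> (at (t, X t x)) (h, h *\<^sub>R v t x))) (at t within {0..T})" .
      moreover have "frechet_derivative \<phi> (at (t, X t x)) (h, h *\<^sub>R v t x) = \<psi> t x * h" for h
        using linear_scale[OF has_derivative_linear[OF D], of h "(1, v t x)"] by (simp add: \<psi>_def H_def)
      ultimately show ?thesis by (simp add: has_field_derivative_def)
    qed
    obtain M where M: "\<And>z. \<bar>\<phi> z\<bar> \<le> M" using test_function_props[OF \<phi>] by metis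
    have \<phi>_cont: "continuous_on UNIV (\<lambda>x. \<phi> (t, x))" for t
      by (rule continuous_on_compose2[OF smooth_continuous_on[OF sm], of UNIV]) (auto intro: continuous_intros)
    have \<phi>_meas: "(\<lambda>x. \<phi> (t, x)) \<in> borel_measurable borel" for t
      by (rule borel_measurable_continuous_onI[OF \<phi>_cont])
    define E where "E t = (\<integral>x. \<phi> (t, X t x) \<partial>\<mu>\<^sub>0)" for t
    have E: "E t = (\<integral>x. \<phi> (t, x) \<partial>\<mu> t)" for t
      unfolding E_def \<mu>_def by (rule integral_distr[OF mX \<phi>_meas, symmetric])
    have E_der: "(E has_real_derivative G t) (at t within {0..T})" if t: "t \<in> {0..T}" for t
      unfolding E_def[abs_def] G_def
    proof (rule has_real_derivative_integral[OF finite_measure_axioms t _ \<psi>_meas])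
      show "integrable \<mu>\<^sub>0 (\<lambda>x. \<phi> (s, X s x))" for s
        by (rule integrable_const_bound[of _ M]) (use M measurable_compose[OF mX \<phi>_meas] in auto)
      show "AE x in \<mu>\<^sub>0. \<forall>t\<in>{0..T}. ((\<lambda>s. \<phi> (s, X s x)) has_real_derivative \<psi> t x) (at t within {0..T}) \<and> \<bar>\<psi> t x\<bar> \<le> K"
        using \<psi>_le by eventually_elim (use \<phi>_der in auto)
    qed
    have G_int: "set_integrable lborel {0..T} G" by (rule borel_integrable_atLeastAtMost'[OF G_cont])
    show "set_integrable lborel {0..T} (\<lambda>t. \<integral>x. transport_integrand \<rho> F \<mu> \<phi> t x \<partial>\<mu> t)"
      using G_int by (rule set_integrable_cong[THEN iffD1, rotated 3]) (auto simp: G_eq)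
    have "(LINT t:{0..T}|lborel. (\<integral>x. transport_integrand \<rho> F \<mu> \<phi> t x \<partial>\<mu> t)) = (LINT t:{0..T}|lborel. G t)"
      by (rule set_lebesgue_integral_cong) (auto simp: G_eq)
    also have "\<dots> = E T - E 0"
      unfolding set_lebesgue_integral_def
      by (rule integral_FTC_atLeastAtMost[OF T _ G_cont])
        (use E_der in \<open>simp add: has_real_derivative_iff_has_vector_derivative\<close>)
    finally show "(\<integral>x. \<phi> (T, x) \<partial>\<mu> T) - (\<integral>x. \<phi> (0, x) \<partial>\<mu>\<^sub>0)
        = (LINT t:{0..T}|lborel. (\<integral>x. transport_integrand \<rho> F \<mu> \<phi> t x \<partial>\<mu> t))"
      using E[of T] E[of 0] \<open>\<mu> 0 = \<mu>\<^sub>0\<close> by simp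
  qed
  then show ?thesis by blast
qed

end

end

text \<open>The field composes two affine maps of operator norm at most \<open>D\<close> with
  \<open>\<sigma>\<close> entrywise, whose Lipschitz constant for the Euclidean norm is again
  \<open>L\<close>.\<close>

lemma perceptron_lipschitz:
  fixes W\<^sub>1 :: "real^'d^'m" and W\<^sub>2 :: "real^'m^'d::finite"
  assumes \<sigma>: "L-lipschitz_on UNIV \<sigma>" and W: "onorm ((*v) W\<^sub>1) \<le> D" "onorm ((*v) W\<^sub>2) \<le> D"
  shows "norm (perceptron \<sigma> W\<^sub>1 W\<^sub>2 b\<^sub>1 b\<^sub>2 x - perceptron \<sigma> W\<^sub>1 W\<^sub>2 b\<^sub>1 b\<^sub>2 y) \<le> D\<^sup>2 * L * norm (x - y)"
proof -
  have L: "0 \<le> L" using \<sigma> by (simp add: lipschitz_on_def)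
  have D: "0 \<le> D" using W(1) onorm_pos_le[OF matrix_vector_mul_bounded_linear[of W\<^sub>1]] by simp
  have le1: "norm (W\<^sub>1 *v z) \<le> D * norm z" for z
    using onorm[OF matrix_vector_mul_bounded_linear[of W\<^sub>1], of z] mult_right_mono[OF W(1) norm_ge_zero[of z]] by simp
  have le2: "norm (W\<^sub>2 *v z) \<le> D * norm z" for z
    using onorm[OF matrix_vector_mul_bounded_linear[of W\<^sub>2], of z] mult_right_mono[OF W(2) norm_ge_zero[of z]] by simp
  define a where "a z = W\<^sub>1 *v z + b\<^sub>1" for z
  define s where "s z = (\<chi> i. \<sigma> (a z $ i))" for z
  have "norm (s x - s y) = L2_set (\<lambda>i. norm (\<sigma> (a x $ i) - \<sigma> (a y $ i))) UNIV"
    by (simp add: norm_vec_def s_def)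
  also have "\<dots> \<le> L2_set (\<lambda>i. L * norm ((a x - a y) $ i)) UNIV"
    using \<sigma> by (intro L2_set_mono) (auto simp: lipschitz_on_def dist_norm)
  also have "\<dots> = L * norm (a x - a y)"
    using L by (simp add: norm_vec_def L2_set_right_distrib)
  finally have s: "norm (s x - s y) \<le> L * norm (a x - a y)" .
  have "a x - a y = W\<^sub>1 *v (x - y)" by (simp add: a_def matrix_vector_mult_diff_distrib)
  then have a: "norm (a x - a y) \<le> D * norm (x - y)" using le1 by simp
  have "perceptron \<sigma> W\<^sub>1 W\<^sub>2 b\<^sub>1 b\<^sub>2 x - perceptron \<sigma> W\<^sub>1 W\<^sub>2 b\<^sub>1 b\<^sub>2 y = W\<^sub>2 *v (s x - s y)"
    by (simp add: perceptron_def a_def s_def matrix_vector_mult_diff_distrib)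
  also have "norm \<dots> \<le> D * norm (s x - s y)" by (rule le2)
  also have "\<dots> \<le> D * (L * (D * norm (x - y)))"
    using s a D L by (intro mult_left_mono order_trans[OF s] mult_left_mono) auto
  finally show ?thesis by (simp add: power2_eq_square mult_ac)
qed

text \<open>The order of quantifiers carries content: \<open>C\<close> is chosen first, so it
  depends on \<open>D\<close>, \<open>L\<close> and \<open>R\<close> alone, while
  \<open>C\<^sub>0\<close> may depend on the perceptron but not on \<open>T\<close> or
  \<open>\<rho>\<close>. The confinement claim exhibits a radius of the announced form, so the
  stability claim is not vacuous in \<open>R\<close>.\<close>

theorem theorem4p1:
  shows "\<exists>C :: real \<Rightarrow> real \<Rightarrow> real \<Rightarrow> real.
    \<forall>(\<Theta> :: ('d::finite, 'k::finite) param set) D \<sigma> L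
      (W\<^sub>1 :: real^'d^'m::finite) (W\<^sub>2 :: real^'m^'d) (b\<^sub>1 :: real^'m) (b\<^sub>2 :: real^'d) F.
      compact \<Theta> \<and> (\<forall>\<theta>\<in>\<Theta>. norm \<theta> \<le> D) \<and> L-lipschitz_on UNIV \<sigma> \<and>
      onorm ((*v) W\<^sub>1) \<le> D \<and> onorm ((*v) W\<^sub>2) \<le> D \<and> norm b\<^sub>1 \<le> D \<and> norm b\<^sub>2 \<le> D \<and>
      F = perceptron \<sigma> W\<^sub>1 W\<^sub>2 b\<^sub>1 b\<^sub>2 \<longrightarrow>
      (\<exists>C\<^sub>0\<ge>0. \<forall>T>0. \<forall>\<rho>\<in>prob_measures_on \<Theta>.
         (\<forall>\<mu>\<^sub>0\<in>P2. compact (measure_support \<mu>\<^sub>0) \<longrightarrow>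
            (\<exists>\<mu>. weak_solution T \<rho> F \<mu>\<^sub>0 \<mu> \<and>
               (\<forall>\<nu>. weak_solution T \<rho> F \<mu>\<^sub>0 \<nu> \<longrightarrow> (\<forall>t\<in>{0..T}. \<nu> t = \<mu> t)))) \<and>
         (\<forall>R\<^sub>0\<ge>0. confinement_radius T \<rho> F R\<^sub>0 (R\<^sub>0 * exp (C\<^sub>0 * T) + (exp (C\<^sub>0 * T) - 1))) \<and>
         (\<forall>R\<^sub>0 R. confinement_radius T \<rho> F R\<^sub>0 R \<longrightarrow>
            (\<forall>\<mu>\<^sub>0\<in>P2. \<forall>\<mu>\<^sub>0'\<in>P2. \<forall>\<mu> \<mu>'.
               measure_support \<mu>\<^sub>0 \<subseteq> cball 0 R\<^sub>0 \<and> measure_support \<mu>\<^sub>0' \<subseteq> cball 0 R\<^sub>0 \<and>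
               weak_solution T \<rho> F \<mu>\<^sub>0 \<mu> \<and> weak_solution T \<rho> F \<mu>\<^sub>0' \<mu>' \<longrightarrow>
               (SUP t\<in>{0..T}. wasserstein2 (\<mu> t) (\<mu>' t))
                 \<le> exp (C D L R * T) * wasserstein2 \<mu>\<^sub>0 \<mu>\<^sub>0')))"
proof (intro exI[of _ "\<lambda>D L R. 2 * (attention_lipschitz_const D R + D\<^sup>2 * L)"] allI impI)
  fix \<Theta> :: "('d, 'k) param set" and D L :: real and \<sigma> :: "real \<Rightarrow> real"
    and W\<^sub>1 :: "real^'d^'m" and W\<^sub>2 :: "real^'m^'d" and b\<^sub>1 :: "real^'m" and b\<^sub>2 :: "real^'d" and F
  assume A: "compact \<Theta> \<and> (\<forall>\<theta>\<in>\<Theta>. norm \<theta> \<le> D) \<and> L-lipschitz_on UNIV \<sigma> \<and>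
      onorm ((*v) W\<^sub>1) \<le> D \<and> onorm ((*v) W\<^sub>2) \<le> D \<and> norm b\<^sub>1 \<le> D \<and> norm b\<^sub>2 \<le> D \<and>
      F = perceptron \<sigma> W\<^sub>1 W\<^sub>2 b\<^sub>1 b\<^sub>2"
  have L: "0 \<le> L" using A by (simp add: lipschitz_on_def)
  have D: "0 \<le> D" using A norm_ge_zero order_trans by blast
  have F: "norm (F x - F y) \<le> D\<^sup>2 * L * norm (x - y)" for x y
    using A perceptron_lipschitz by blast
  \<comment> \<open>This is \<open>growth_rate\<close>, written out before any \<open>\<rho>\<close>
    is fixed.\<close>
  define C\<^sub>0 where "C\<^sub>0 = 4 * D + 2 * norm (F 0) + 4 * (D\<^sup>2 * L)"
  have C0: "0 \<le> C\<^sub>0" using D L by (simp add: C\<^sub>0_def)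
  have field: "transformer_field \<Theta> D L F \<rho>" if "\<rho> \<in> prob_measures_on \<Theta>" for \<rho>
    by unfold_locales (use A F L that in auto)
  have radius: "confinement_radius T \<rho> F R\<^sub>0 (R\<^sub>0 * exp (C\<^sub>0 * T) + (exp (C\<^sub>0 * T) - 1))"
    if "\<rho> \<in> prob_measures_on \<Theta>" for T \<rho> R\<^sub>0
    unfolding confinement_radius_def
  proof (intro ballI allI impI, elim conjE)
    interpret transformer_field \<Theta> D L F \<rho> by (rule field[OF that])
    fix \<mu>\<^sub>0 \<mu> t
    assume P: "\<mu>\<^sub>0 \<in> P2" and t: "t \<in> {0..T}"
      and S: "measure_support \<mu>\<^sub>0 \<subseteq> cball 0 R\<^sub>0" and w: "weak_solution T \<rho> F \<mu>\<^sub>0 \<mu>"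
    have c: "confined \<mu>\<^sub>0 R\<^sub>0" using S confined_iff_support[OF P] by simp
    have "exp (C\<^sub>0 * t) \<le> exp (C\<^sub>0 * T)" using t C0 by (simp add: mult_left_mono)
    then have "(1 + R\<^sub>0) * exp (C\<^sub>0 * t) - 1 \<le> (1 + R\<^sub>0) * exp (C\<^sub>0 * T) - 1"
      using confined_radius_nonneg[OF c] by (intro diff_right_mono mult_left_mono) auto
    moreover have "growth_rate = C\<^sub>0" by (simp add: growth_rate_def C\<^sub>0_def)
    then have "confined (\<mu> t) ((1 + R\<^sub>0) * exp (C\<^sub>0 * t) - 1)"
      using weak_solution_confined[OF w c t] by simp
    ultimately have "confined (\<mu> t) ((1 + R\<^sub>0) * exp (C\<^sub>0 * T) - 1)" by (rule confined_mono[rotated])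
    then have "confined (\<mu> t) (R\<^sub>0 * exp (C\<^sub>0 * T) + (exp (C\<^sub>0 * T) - 1))" by (simp add: algebra_simps)
    then show "measure_support (\<mu> t) \<subseteq> cball 0 (R\<^sub>0 * exp (C\<^sub>0 * T) + (exp (C\<^sub>0 * T) - 1))"
      using confined_iff_support[OF weak_solution_prob(1)[OF w t]] by simp
  qed
  have confined: "confined (\<mu> t) R"
    if "\<rho> \<in> prob_measures_on \<Theta>" "confinement_radius T \<rho> F R\<^sub>0 R" "\<mu>\<^sub>0 \<in> P2" "measure_support \<mu>\<^sub>0 \<subseteq> cball 0 R\<^sub>0"
      "weak_solution T \<rho> F \<mu>\<^sub>0 \<mu>" "t \<in> {0..T}" for T \<rho> R\<^sub>0 R \<mu>\<^sub>0 \<mu> t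
  proof -
    have "measure_support (\<mu> t) \<subseteq> cball 0 R" using that by (auto simp: confinement_radius_def)
    then show ?thesis
      using confined_iff_support[OF transformer_field.weak_solution_prob(1)[OF field[OF that(1)] that(5,6)]] by simp
  qed
  have unique: "\<exists>\<mu>. weak_solution T \<rho> F \<mu>\<^sub>0 \<mu> \<and> (\<forall>\<nu>. weak_solution T \<rho> F \<mu>\<^sub>0 \<nu> \<longrightarrow> (\<forall>t\<in>{0..T}. \<nu> t = \<mu> t))"
    if T: "0 < T" and \<rho>: "\<rho> \<in> prob_measures_on \<Theta>" and P: "\<mu>\<^sub>0 \<in> P2" and S: "compact (measure_support \<mu>\<^sub>0)" for T \<rho> \<mu>\<^sub>0
  proof -
    interpret transformer_field \<Theta> D L F \<rho> by (rule field[OF \<rho>])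
    obtain R\<^sub>0 where "\<And>x. x \<in> measure_support \<mu>\<^sub>0 \<Longrightarrow> norm x \<le> R\<^sub>0"
      using compact_imp_bounded[OF S] unfolding bounded_iff by blast
    then have R0: "measure_support \<mu>\<^sub>0 \<subseteq> cball 0 R\<^sub>0" by auto
    then have "confined \<mu>\<^sub>0 R\<^sub>0" using confined_iff_support[OF P] by simp
    then obtain \<mu> where w: "weak_solution T \<rho> F \<mu>\<^sub>0 \<mu>"
      using weak_solution_exists[of \<mu>\<^sub>0 R\<^sub>0 T] T by auto
    \<comment> \<open>\<open>radius\<close> confines the competitor as well, so uniqueness holds
      among all curves in \<open>P2\<close> that are weak solutions.\<close>
    have "\<nu> t = \<mu> t" if \<nu>: "weak_solution T \<rho> F \<mu>\<^sub>0 \<nu>" and t: "t \<in> {0..T}" for \<nu> t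
      using weak_solution_unique[OF _ \<nu> w confined[OF \<rho> radius[OF \<rho>] P R0 \<nu>] confined[OF \<rho> radius[OF \<rho>] P R0 w] t] T
      by simp
    with w show ?thesis by blast
  qed
  have stable: "(SUP t\<in>{0..T}. wasserstein2 (\<mu> t) (\<mu>' t))
      \<le> exp (2 * (attention_lipschitz_const D R + D\<^sup>2 * L) * T) * wasserstein2 \<mu>\<^sub>0 \<mu>\<^sub>0'"
    if T: "0 < T" and \<rho>: "\<rho> \<in> prob_measures_on \<Theta>" and R: "confinement_radius T \<rho> F R\<^sub>0 R"
      and P: "\<mu>\<^sub>0 \<in> P2" "\<mu>\<^sub>0' \<in> P2" and S: "measure_support \<mu>\<^sub>0 \<subseteq> cball 0 R\<^sub>0" "measure_support \<mu>\<^sub>0' \<subseteq> cball 0 R\<^sub>0"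
      and w: "weak_solution T \<rho> F \<mu>\<^sub>0 \<mu>" "weak_solution T \<rho> F \<mu>\<^sub>0' \<mu>'" for T \<rho> R\<^sub>0 R \<mu>\<^sub>0 \<mu>\<^sub>0' \<mu> \<mu>'
  proof (rule cSUP_least)
    interpret transformer_field \<Theta> D L F \<rho> by (rule field[OF \<rho>])
    show "{0..T} \<noteq> {}" using T by simp
    fix t assume t: "t \<in> {0..T}"
    have "wasserstein2 (\<mu> t) (\<mu>' t) \<le> exp (2 * Lip R * t) * wasserstein2 \<mu>\<^sub>0 \<mu>\<^sub>0'"
      by (rule weak_solution_stability[OF _ w confined[OF \<rho> R P(1) S(1) w(1)] confined[OF \<rho> R P(2) S(2) w(2)] t])
        (use T in simp)
    also have "\<dots> \<le> exp (2 * Lip R * T) * wasserstein2 \<mu>\<^sub>0 \<mu>\<^sub>0'"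
      using t Lip_nonneg[of R] wasserstein2_nonneg[OF P] by (intro mult_right_mono) (auto intro: mult_left_mono)
    finally show "wasserstein2 (\<mu> t) (\<mu>' t)
        \<le> exp (2 * (attention_lipschitz_const D R + D\<^sup>2 * L) * T) * wasserstein2 \<mu>\<^sub>0 \<mu>\<^sub>0'"
      by (simp add: Lip_def)
  qed
  show "\<exists>C\<^sub>0\<ge>0. \<forall>T>0. \<forall>\<rho>\<in>prob_measures_on \<Theta>.
         (\<forall>\<mu>\<^sub>0\<in>P2. compact (measure_support \<mu>\<^sub>0) \<longrightarrow>
            (\<exists>\<mu>. weak_solution T \<rho> F \<mu>\<^sub>0 \<mu> \<and>
               (\<forall>\<nu>. weak_solution T \<rho> F \<mu>\<^sub>0 \<nu> \<longrightarrow> (\<forall>t\<in>{0..T}. \<nu> t = \<mu> t)))) \<and>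
         (\<forall>R\<^sub>0\<ge>0. confinement_radius T \<rho> F R\<^sub>0 (R\<^sub>0 * exp (C\<^sub>0 * T) + (exp (C\<^sub>0 * T) - 1))) \<and>
         (\<forall>R\<^sub>0 R. confinement_radius T \<rho> F R\<^sub>0 R \<longrightarrow>
            (\<forall>\<mu>\<^sub>0\<in>P2. \<forall>\<mu>\<^sub>0'\<in>P2. \<forall>\<mu> \<mu>'.
               measure_support \<mu>\<^sub>0 \<subseteq> cball 0 R\<^sub>0 \<and> measure_support \<mu>\<^sub>0' \<subseteq> cball 0 R\<^sub>0 \<and>
               weak_solution T \<rho> F \<mu>\<^sub>0 \<mu> \<and> weak_solution T \<rho> F \<mu>\<^sub>0' \<mu>' \<longrightarrow>
               (SUP t\<in>{0..T}. wasserstein2 (\<mu> t) (\<mu>' t))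
                 \<le> exp (2 * (attention_lipschitz_const D R + D\<^sup>2 * L) * T) * wasserstein2 \<mu>\<^sub>0 \<mu>\<^sub>0'))"
  proof (rule exI[of _ C\<^sub>0], intro conjI allI impI ballI)
    show "0 \<le> C\<^sub>0" by (rule C0)
  next
    fix T :: real and \<rho> :: "('d, 'k) param measure" and \<mu>\<^sub>0 :: "(real^'d) measure"
    assume "0 < T" "\<rho> \<in> prob_measures_on \<Theta>" "\<mu>\<^sub>0 \<in> P2" "compact (measure_support \<mu>\<^sub>0)"
    then show "\<exists>\<mu>. weak_solution T \<rho> F \<mu>\<^sub>0 \<mu> \<and> (\<forall>\<nu>. weak_solution T \<rho> F \<mu>\<^sub>0 \<nu> \<longrightarrow> (\<forall>t\<in>{0..T}. \<nu> t = \<mu> t))"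
      by (rule unique)
  next
    fix T R\<^sub>0 :: real and \<rho> :: "('d, 'k) param measure"
    assume "\<rho> \<in> prob_measures_on \<Theta>"
    then show "confinement_radius T \<rho> F R\<^sub>0 (R\<^sub>0 * exp (C\<^sub>0 * T) + (exp (C\<^sub>0 * T) - 1))"
      by (rule radius)
  next
    fix T R\<^sub>0 R :: real and \<rho> :: "('d, 'k) param measure"
      and \<mu>\<^sub>0 \<mu>\<^sub>0' :: "(real^'d) measure" and \<mu> \<mu>' :: "real \<Rightarrow> (real^'d) measure"
    assume "0 < T" "\<rho> \<in> prob_measures_on \<Theta>" "confinement_radius T \<rho> F R\<^sub>0 R" "\<mu>\<^sub>0 \<in> P2" "\<mu>\<^sub>0' \<in> P2"
      and "measure_support \<mu>\<^sub>0 \<subseteq> cball 0 R\<^sub>0 \<and> measure_support \<mu>\<^sub>0' \<subseteq> cball 0 R\<^sub>0 \<and>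
         weak_solution T \<rho> F \<mu>\<^sub>0 \<mu> \<and> weak_solution T \<rho> F \<mu>\<^sub>0' \<mu>'"
    then show "(SUP t\<in>{0..T}. wasserstein2 (\<mu> t) (\<mu>' t))
        \<le> exp (2 * (attention_lipschitz_const D R + D\<^sup>2 * L) * T) * wasserstein2 \<mu>\<^sub>0 \<mu>\<^sub>0'"
      by (elim conjE) (rule stable)
  qed
qed

end
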